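(* Let $\mathcal{M}$ be a semifinite von Neumann algebra and $\tau$ a faithful normal semifinite trace on $\mathcal{M}$. Let $t_{h\tau l}$ be the topology on $S_h(\mathcal{M},\tau)$ induced by the $\tau$-locally measure topology $t_{\tau l}$ on $S(\mathcal{M},\tau)$, and let $t_{o\tau}(\mathcal{M})$ be the $(o)$-topology on $S_h(\mathcal{M},\tau)$. If $t_{h\tau l}=t_{o\tau}(\mathcal{M})$, then $\tau(I)<\infty$.
   Context: Let $\mathcal{M}$ be a von Neumann algebra on a complex Hilbert space $\mathcal{H}$ with identity $I$ and lattice of projections $\mathcal{P}(\mathcal{M})$; $P^\bot=I-P$. A closed operator $T$ affiliated with $\mathcal{M}$ with dense domain $\mathfrak{D}(T)$ is measurable (written $T\in S(\mathcal{M})$) if there are $P_n\in\mathcal{P}(\mathcal{M})$, $n=1,2,\dots$, with $P_n\uparrow I$, $P_n(\mathcal{H})\subset\mathfrak{D}(T)$ and $P_n^\bot$ a finite projection. $S(\mathcal{M})$ is a $*$-algebra (with strong sum, strong product and the usual adjoint). For a faithful normal semifinite trace $\tau$ on $\mathcal{M}$, $T\in S(\mathcal{M})$ is $\tau$-measurable if for every $\varepsilon>0$ there is $P\in\mathcal{P}(\mathcal{M})$ with $P(\mathcal{H})\subset\mathfrak{D}(T)$ and $\tau(P^\bot)<\varepsilon$. The set $S(\mathcal{M},\tau)$ of $\tau$-measurable operators is a $*$-subalgebra of $S(\mathcal{M})$; $S_h(\mathcal{M},\tau)$ is its self-adjoint part, ordered by $T\leqslant S\iff S-T$ is a positive operator.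 The topology $t_{\tau l}$ is the Hausdorff vector topology on $S(\mathcal{M},\tau)$ with neighborhood base at zero consisting of the sets $U_\tau(\varepsilon,\delta,P)=\{T\in S(\mathcal{M},\tau):\exists Q\in\mathcal{P}(\mathcal{M}),\ Q\leqslant P,\ \tau(P-Q)\leqslant\delta,\ TQ\in\mathcal{M},\ \|TQ\|\leqslant\varepsilon\}$, where $\varepsilon,\delta>0$ and $P\in\mathcal{P}(\mathcal{M})$ with $\tau(P)<\infty$. A net $(T_\alpha)_{\alpha\in A}\subset S_h(\mathcal{M},\tau)$ $(o)$-converges to $T\in S_h(\mathcal{M},\tau)$ if there are nets $(S_\alpha)_{\alpha\in A},(R_\alpha)_{\alpha\in A}$ in $S_h(\mathcal{M},\tau)$ with $S_\alpha\leqslant T_\alpha\leqslant R_\alpha$ for all $\alpha$, $S_\alpha$ increasing with supremum $T$ and $R_\alpha$ decreasing with infimum $T$ (suprema and infima taken in $S_h(\mathcal{M},\tau)$). The $(o)$-topology $t_{o\tau}(\mathcal{M})$ is the strongest topology on $S_h(\mathcal{M},\tau)$ for which $(o)$-convergence of nets implies topological convergence. *)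

theory Defs
  imports "HOL-Analysis.Analysis"
begin

section \<open>Complex Hilbert spaces\<close>

text \<open>The inner product is linear in its first argument. Definiteness and the relation to the norm
  are inherited from \<^class>\<open>real_inner\<close>: by \<open>cinner_commute\<close> the number \<open>cinner x x\<close> is
  real, hence equal to \<open>inner x x\<close>.\<close>

class chilbert_space = real_inner + complete_space +
  fixes scaleC :: "complex \<Rightarrow> 'a \<Rightarrow> 'a"  (infixr "*\<^sub>C" 75)
    and cinner :: "'a \<Rightarrow> 'a \<Rightarrow> complex"
  assumes scaleC_add_right: "a *\<^sub>C (x + y) = a *\<^sub>C x + a *\<^sub>C y"
    and scaleC_add_left: "(a + b) *\<^sub>C x = a *\<^sub>C x + b *\<^sub>C x"
    and scaleC_scaleC: "a *\<^sub>C (b *\<^sub>C x) = (a * b) *\<^sub>C x"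
    and scaleR_scaleC: "r *\<^sub>R x = complex_of_real r *\<^sub>C x"
    and cinner_commute: "cinner x y = cnj (cinner y x)"
    and cinner_add_left: "cinner (x + y) z = cinner x z + cinner y z"
    and cinner_scaleC_left: "cinner (a *\<^sub>C x) y = a * cinner x y"
    and inner_cinner: "x \<bullet> y = Re (cinner x y)"

instance chilbert_space \<subseteq> banach ..

section \<open>Von Neumann algebras\<close>

text \<open>Bounded operators are elements of the library type of bounded real-linear maps, whose norm
  is the operator norm; complex linearity is imposed by \<open>bounded_ops\<close>.\<close>

type_synonym 'h bop = "'h \<Rightarrow>\<^sub>L 'h"

definition bounded_ops :: "'h::chilbert_space bop set" where
  "bounded_ops = {A. \<forall>c x. blinfun_apply A (c *\<^sub>C x) = c *\<^sub>C blinfun_apply A x}"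

definition bop_adj :: "'h::chilbert_space bop \<Rightarrow> 'h bop" where
  "bop_adj A = (THE B. \<forall>x y. cinner (blinfun_apply A x) y = cinner x (blinfun_apply B y))"

definition commutant :: "'h::chilbert_space bop set \<Rightarrow> 'h bop set" where
  "commutant M = {B \<in> bounded_ops. \<forall>A\<in>M. A o\<^sub>L B = B o\<^sub>L A}"

definition von_neumann_algebra :: "'h::chilbert_space bop set \<Rightarrow> bool" where
  "von_neumann_algebra M \<longleftrightarrow>
     M \<subseteq> bounded_ops \<and> (\<forall>A\<in>M. bop_adj A \<in> M) \<and> commutant (commutant M) = M"

definition unitary_bop :: "'h::chilbert_space bop \<Rightarrow> bool" where
  "unitary_bop U \<longleftrightarrow> U \<in> bounded_ops \<and> bop_adj U o\<^sub>L U = id_blinfun \<and> U o\<^sub>L bop_adj U = id_blinfun"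

definition bop_pos :: "'h::chilbert_space bop \<Rightarrow> bool" where
  "bop_pos A \<longleftrightarrow> A \<in> bounded_ops \<and> (\<forall>x. cinner (blinfun_apply A x) x \<in> \<real>\<^sub>\<ge>\<^sub>0)"

definition bop_le :: "'h::chilbert_space bop \<Rightarrow> 'h bop \<Rightarrow> bool" where
  "bop_le A B \<longleftrightarrow> bop_pos (B - A)"

definition positive_part :: "'h::chilbert_space bop set \<Rightarrow> 'h bop set" where
  "positive_part M = {A \<in> M. bop_pos A}"

definition projections :: "'h::chilbert_space bop set \<Rightarrow> 'h bop set" where
  "projections M = {P \<in> M. P o\<^sub>L P = P \<and> bop_adj P = P}"

definition is_lub_in :: "'a set \<Rightarrow> ('a \<Rightarrow> 'a \<Rightarrow> bool) \<Rightarrow> 'a set \<Rightarrow> 'a \<Rightarrow> bool" where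
  "is_lub_in X le D a \<longleftrightarrow>
     a \<in> X \<and> (\<forall>d\<in>D. le d a) \<and> (\<forall>b\<in>X. (\<forall>d\<in>D. le d b) \<longrightarrow> le a b)"

definition mvn_equiv :: "'h::chilbert_space bop set \<Rightarrow> 'h bop \<Rightarrow> 'h bop \<Rightarrow> bool" where
  "mvn_equiv M P Q \<longleftrightarrow> (\<exists>V\<in>M. bop_adj V o\<^sub>L V = P \<and> V o\<^sub>L bop_adj V = Q)"

definition finite_projection :: "'h::chilbert_space bop set \<Rightarrow> 'h bop \<Rightarrow> bool" where
  "finite_projection M P \<longleftrightarrow> P \<in> projections M \<and>
     (\<forall>Q\<in>projections M. bop_le Q P \<and> mvn_equiv M Q P \<longrightarrow> Q = P)"

definition semifinite_algebra :: "'h::chilbert_space bop set \<Rightarrow> bool" where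
  "semifinite_algebra M \<longleftrightarrow>
     (\<forall>Z\<in>projections M \<inter> commutant M. Z \<noteq> 0 \<longrightarrow>
        (\<exists>P. finite_projection M P \<and> P \<noteq> 0 \<and> bop_le P Z))"

section \<open>Traces\<close>

text \<open>A trace is a map on the positive part of \<open>M\<close>; values elsewhere are irrelevant.\<close>

definition is_trace :: "'h::chilbert_space bop set \<Rightarrow> ('h bop \<Rightarrow> ennreal) \<Rightarrow> bool" where
  "is_trace M \<tau> \<longleftrightarrow>
     (\<forall>A\<in>positive_part M. \<forall>B\<in>positive_part M. \<tau> (A + B) = \<tau> A + \<tau> B) \<and>
     (\<forall>A\<in>positive_part M. \<forall>c\<ge>0. \<tau> (c *\<^sub>R A) = ennreal c * \<tau> A) \<and>
     (\<forall>A\<in>M. \<tau> (bop_adj A o\<^sub>L A) = \<tau> (A o\<^sub>L bop_adj A))"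

definition faithful_trace :: "'h::chilbert_space bop set \<Rightarrow> ('h bop \<Rightarrow> ennreal) \<Rightarrow> bool" where
  "faithful_trace M \<tau> \<longleftrightarrow> (\<forall>A\<in>positive_part M. \<tau> A = 0 \<longrightarrow> A = 0)"

text \<open>Bounded increasing nets are represented by their ranges, i.e. by directed subsets.\<close>

definition normal_trace :: "'h::chilbert_space bop set \<Rightarrow> ('h bop \<Rightarrow> ennreal) \<Rightarrow> bool" where
  "normal_trace M \<tau> \<longleftrightarrow>
     (\<forall>D A. D \<subseteq> positive_part M \<and> D \<noteq> {} \<and>
        (\<forall>B\<in>D. \<forall>C\<in>D. \<exists>E\<in>D. bop_le B E \<and> bop_le C E) \<and>
        is_lub_in (positive_part M) bop_le D A \<longrightarrow> \<tau> A = (SUP B\<in>D. \<tau> B))"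

definition semifinite_trace :: "'h::chilbert_space bop set \<Rightarrow> ('h bop \<Rightarrow> ennreal) \<Rightarrow> bool" where
  "semifinite_trace M \<tau> \<longleftrightarrow>
     (\<forall>A\<in>positive_part M. A \<noteq> 0 \<longrightarrow>
        (\<exists>B\<in>positive_part M. B \<noteq> 0 \<and> bop_le B A \<and> \<tau> B < \<infinity>))"

section \<open>Measurable operators\<close>

text \<open>Unbounded operators are represented by their graphs, so the domain of \<open>T\<close> is
  \<open>Domain T\<close>, and the closure of an operator is the topological closure of its graph.\<close>

type_synonym 'h uop = "('h \<times> 'h) set"

definition graph_of :: "'h::chilbert_space bop \<Rightarrow> 'h uop" where
  "graph_of A = {(x, blinfun_apply A x) | x. True}"

definition closed_densely_defined :: "'h::chilbert_space uop \<Rightarrow> bool" where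
  "closed_densely_defined T \<longleftrightarrow>
     single_valued T \<and> (0, 0) \<in> T \<and>
     (\<forall>(x, y)\<in>T. \<forall>(x', y')\<in>T. (x + x', y + y') \<in> T) \<and>
     (\<forall>c. \<forall>(x, y)\<in>T. (c *\<^sub>C x, c *\<^sub>C y) \<in> T) \<and>
     closed T \<and> closure (Domain T) = UNIV"

definition affiliated :: "'h::chilbert_space bop set \<Rightarrow> 'h uop \<Rightarrow> bool" where
  "affiliated M T \<longleftrightarrow>
     (\<forall>U\<in>commutant M. unitary_bop U \<longrightarrow>
        (\<forall>(x, y)\<in>T. (blinfun_apply U x, blinfun_apply U y) \<in> T))"

definition uop_adj :: "'h::chilbert_space uop \<Rightarrow> 'h uop" where
  "uop_adj T = {(u, v). \<forall>(x, y)\<in>T. cinner y u = cinner x v}"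

definition strong_sum :: "'h::chilbert_space uop \<Rightarrow> 'h uop \<Rightarrow> 'h uop" where
  "strong_sum T S = closure {(x, y + z) | x y z. (x, y) \<in> T \<and> (x, z) \<in> S}"

definition strong_diff :: "'h::chilbert_space uop \<Rightarrow> 'h uop \<Rightarrow> 'h uop" where
  "strong_diff T S = closure {(x, y - z) | x y z. (x, y) \<in> T \<and> (x, z) \<in> S}"

definition strong_prod :: "'h::chilbert_space uop \<Rightarrow> 'h uop \<Rightarrow> 'h uop" where
  "strong_prod T S = closure {(x, z) | x y z. (x, y) \<in> S \<and> (y, z) \<in> T}"

definition measurable_ops :: "'h::chilbert_space bop set \<Rightarrow> 'h uop set" where
  "measurable_ops M = {T. closed_densely_defined T \<and> affiliated M T \<and>
     (\<exists>P :: nat \<Rightarrow> 'h bop.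
        range P \<subseteq> projections M \<and>
        (\<forall>n. bop_le (P n) (P (Suc n))) \<and>
        is_lub_in (projections M) bop_le (range P) id_blinfun \<and>
        (\<forall>n. range (blinfun_apply (P n)) \<subseteq> Domain T) \<and>
        (\<forall>n. finite_projection M (id_blinfun - P n)))}"

definition tau_measurable_ops ::
  "'h::chilbert_space bop set \<Rightarrow> ('h bop \<Rightarrow> ennreal) \<Rightarrow> 'h uop set" where
  "tau_measurable_ops M \<tau> = {T \<in> measurable_ops M.
     \<forall>\<epsilon>::real. \<epsilon> > 0 \<longrightarrow>
       (\<exists>P\<in>projections M. range (blinfun_apply P) \<subseteq> Domain T \<and> \<tau> (id_blinfun - P) < ennreal \<epsilon>)}"

definition tau_measurable_sa ::
  "'h::chilbert_space bop set \<Rightarrow> ('h bop \<Rightarrow> ennreal) \<Rightarrow> 'h uop set" where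
  "tau_measurable_sa M \<tau> = {T \<in> tau_measurable_ops M \<tau>. uop_adj T = T}"

definition uop_le :: "'h::chilbert_space uop \<Rightarrow> 'h uop \<Rightarrow> bool" where
  "uop_le T S \<longleftrightarrow> (\<forall>(x, y)\<in>strong_diff S T. cinner y x \<in> \<real>\<^sub>\<ge>\<^sub>0)"

section \<open>The tau-locally measure topology\<close>

definition tau_l_nhd ::
  "'h::chilbert_space bop set \<Rightarrow> ('h bop \<Rightarrow> ennreal) \<Rightarrow> real \<Rightarrow> real \<Rightarrow> 'h bop \<Rightarrow> 'h uop set" where
  "tau_l_nhd M \<tau> \<epsilon> \<delta> P = {T \<in> tau_measurable_ops M \<tau>.
     \<exists>Q\<in>projections M. bop_le Q P \<and> \<tau> (P - Q) \<le> ennreal \<delta> \<and>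
       (\<exists>B\<in>M. strong_prod T (graph_of Q) = graph_of B \<and> norm B \<le> \<epsilon>)}"

text \<open>The neighbourhoods of an arbitrary point are the translates of those of zero.\<close>

definition tau_l_topology ::
  "'h::chilbert_space bop set \<Rightarrow> ('h bop \<Rightarrow> ennreal) \<Rightarrow> 'h uop topology" where
  "tau_l_topology M \<tau> = topology (\<lambda>W. W \<subseteq> tau_measurable_ops M \<tau> \<and>
     (\<forall>T\<in>W. \<exists>\<epsilon>>0. \<exists>\<delta>>0. \<exists>P\<in>projections M. \<tau> P < \<infinity> \<and>
        strong_sum T ` tau_l_nhd M \<tau> \<epsilon> \<delta> P \<subseteq> W))"

section \<open>Order convergence of nets and the order topology\<close>

definition directed_set :: "'i set \<Rightarrow> ('i \<Rightarrow> 'i \<Rightarrow> bool) \<Rightarrow> bool" where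
  "directed_set A le \<longleftrightarrow> A \<noteq> {} \<and> reflp_on A le \<and> transp_on A le \<and>
     (\<forall>a\<in>A. \<forall>b\<in>A. \<exists>c\<in>A. le a c \<and> le b c)"

definition net_filter :: "'i set \<Rightarrow> ('i \<Rightarrow> 'i \<Rightarrow> bool) \<Rightarrow> 'i filter" where
  "net_filter A le = (INF a\<in>A. principal {b\<in>A. le a b})"

definition o_converges ::
  "'h::chilbert_space bop set \<Rightarrow> ('h bop \<Rightarrow> ennreal) \<Rightarrow> 'i set \<Rightarrow> ('i \<Rightarrow> 'i \<Rightarrow> bool) \<Rightarrow>
     ('i \<Rightarrow> 'h uop) \<Rightarrow> 'h uop \<Rightarrow> bool" where
  "o_converges M \<tau> A le T t \<longleftrightarrow>
     directed_set A le \<and> T ` A \<subseteq> tau_measurable_sa M \<tau> \<and> t \<in> tau_measurable_sa M \<tau> \<and>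
     (\<exists>S R. S ` A \<subseteq> tau_measurable_sa M \<tau> \<and> R ` A \<subseteq> tau_measurable_sa M \<tau> \<and>
        (\<forall>a\<in>A. uop_le (S a) (T a) \<and> uop_le (T a) (R a)) \<and>
        monotone_on A le uop_le S \<and> is_lub_in (tau_measurable_sa M \<tau>) uop_le (S ` A) t \<and>
        monotone_on A le (\<lambda>X Y. uop_le Y X) R \<and>
        is_lub_in (tau_measurable_sa M \<tau>) (\<lambda>X Y. uop_le Y X) (R ` A) t)"

text \<open>The index sets of the nets have to be taken from a fixed type. Triples of operators suffice:
  see \<open>o_converges_imp_limitin\<close> below, where the type of indices is arbitrary.\<close>

definition o_compatible ::
  "'h::chilbert_space bop set \<Rightarrow> ('h bop \<Rightarrow> ennreal) \<Rightarrow> 'h uop topology \<Rightarrow> bool" where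
  "o_compatible M \<tau> X \<longleftrightarrow> topspace X = tau_measurable_sa M \<tau> \<and>
     (\<forall>(A :: ('h uop \<times> 'h uop \<times> 'h uop) set) le T t.
        o_converges M \<tau> A le T t \<longrightarrow> limitin X T t (net_filter A le))"

definition o_topology ::
  "'h::chilbert_space bop set \<Rightarrow> ('h bop \<Rightarrow> ennreal) \<Rightarrow> 'h uop topology" where
  "o_topology M \<tau> = (THE X. o_compatible M \<tau> X \<and>
     (\<forall>Y. o_compatible M \<tau> Y \<longrightarrow> (\<forall>W. openin Y W \<longrightarrow> openin X W)))"

lemma eventually_net_filter:
  assumes "directed_set A le"
  shows "eventually P (net_filter A le) \<longleftrightarrow> (\<exists>a\<in>A. \<forall>b\<in>A. le a b \<longrightarrow> P b)"
proof -
  have "eventually P (net_filter A le) \<longleftrightarrow>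
      (\<exists>a\<in>A. eventually P (principal {b\<in>A. le a b}))"
    unfolding net_filter_def
  proof (rule eventually_INF_base)
    show "A \<noteq> {}" using assms by (simp add: directed_set_def)
  next
    fix a b assume ab: "a \<in> A" "b \<in> A"
    then obtain c where c: "c \<in> A" "le a c" "le b c"
      using assms unfolding directed_set_def by blast
    have "{d\<in>A. le c d} \<subseteq> {d\<in>A. le a d} \<inter> {d\<in>A. le b d}"
      using assms ab c unfolding directed_set_def by (auto dest: transp_onD)
    then show "\<exists>x\<in>A. principal {d\<in>A. le x d} \<le>
        inf (principal {d\<in>A. le a d}) (principal {d\<in>A. le b d})"
      using c(1) by auto
  qed
  then show ?thesis by (auto simp: eventually_principal)
qed

lemma o_converges_eventually_sa:
  assumes "o_converges M \<tau> A le T t"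
  shows "eventually (\<lambda>a. T a \<in> tau_measurable_sa M \<tau>) (net_filter A le)"
proof -
  have dir: "directed_set A le" and "T ` A \<subseteq> tau_measurable_sa M \<tau>"
    using assms unfolding o_converges_def by blast+
  then show ?thesis
    unfolding eventually_net_filter[OF dir] directed_set_def by blast
qed

text \<open>The strongest compatible topology exists, and its open sets are as expected.\<close>

lemma o_topology_strongest:
  fixes M :: "'h::chilbert_space bop set"
  shows "o_compatible M \<tau> (o_topology M \<tau>)" (is ?comp)
    and "\<And>Y W. o_compatible M \<tau> Y \<Longrightarrow> openin Y W \<Longrightarrow> openin (o_topology M \<tau>) W"
    and "openin (o_topology M \<tau>) W \<longleftrightarrow> W \<subseteq> tau_measurable_sa M \<tau> \<and>
       (\<forall>(A :: ('h uop \<times> 'h uop \<times> 'h uop) set) le T t. o_converges M \<tau> A le T t \<and> t \<in> W \<longrightarrow>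
          eventually (\<lambda>a. T a \<in> W) (net_filter A le))" (is "?open W")
proof -
  define opn where "opn = (\<lambda>W. W \<subseteq> tau_measurable_sa M \<tau> \<and>
       (\<forall>(A :: ('h uop \<times> 'h uop \<times> 'h uop) set) le T t. o_converges M \<tau> A le T t \<and> t \<in> W \<longrightarrow>
          eventually (\<lambda>a. T a \<in> W) (net_filter A le)))"
  have "istopology opn"
    unfolding istopology_def
  proof (intro conjI allI impI)
    fix V W assume VW: "opn V" "opn W"
    show "opn (V \<inter> W)"
      unfolding opn_def
    proof (intro conjI allI impI)
      show "V \<inter> W \<subseteq> tau_measurable_sa M \<tau>" using VW unfolding opn_def by blast
    next
      fix A :: "('h uop \<times> 'h uop \<times> 'h uop) set" and le T t
      assume "o_converges M \<tau> A le T t \<and> t \<in> V \<inter> W"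
      then have "eventually (\<lambda>a. T a \<in> V) (net_filter A le)"
        "eventually (\<lambda>a. T a \<in> W) (net_filter A le)"
        using VW unfolding opn_def by blast+
      then show "eventually (\<lambda>a. T a \<in> V \<inter> W) (net_filter A le)"
        by (simp add: eventually_conj_iff)
    qed
  next
    fix K assume K: "\<forall>V\<in>K. opn V"
    show "opn (\<Union>K)"
      unfolding opn_def
    proof (intro conjI allI impI)
      show "\<Union>K \<subseteq> tau_measurable_sa M \<tau>" using K unfolding opn_def by blast
    next
      fix A :: "('h uop \<times> 'h uop \<times> 'h uop) set" and le T t
      assume *: "o_converges M \<tau> A le T t \<and> t \<in> \<Union>K"
      then obtain V where V: "V \<in> K" "t \<in> V" by blast
      then have "eventually (\<lambda>a. T a \<in> V) (net_filter A le)"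
        using K * unfolding opn_def by blast
      then show "eventually (\<lambda>a. T a \<in> \<Union>K) (net_filter A le)"
        by (rule eventually_mono) (use V in blast)
    qed
  qed
  then have op: "openin (topology opn) W \<longleftrightarrow> opn W" for W by simp
  have full: "opn (tau_measurable_sa M \<tau>)"
    unfolding opn_def using o_converges_eventually_sa by blast
  have top: "topspace (topology opn) = tau_measurable_sa M \<tau>"
  proof
    show "topspace (topology opn) \<subseteq> tau_measurable_sa M \<tau>"
      using op[of "topspace (topology opn)"] unfolding opn_def by simp
    show "tau_measurable_sa M \<tau> \<subseteq> topspace (topology opn)"
      using full op openin_subset by blast
  qed
  have comp: "o_compatible M \<tau> (topology opn)"
    unfolding o_compatible_def limitin_def op top
  proof (intro conjI allI impI refl)
    fix A :: "('h uop \<times> 'h uop \<times> 'h uop) set" and le T t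
    assume *: "o_converges M \<tau> A le T t"
    show "t \<in> tau_measurable_sa M \<tau>" using * unfolding o_converges_def by blast
    show "eventually (\<lambda>a. T a \<in> U) (net_filter A le)" if "opn U \<and> t \<in> U" for U
      using * that unfolding opn_def by blast
  qed
  have strongest: "openin (topology opn) W" if "o_compatible M \<tau> Y" "openin Y W" for Y W
    using that openin_subset[OF that(2)]
    unfolding op unfolding opn_def o_compatible_def limitin_def by blast
  have eq: "o_topology M \<tau> = topology opn"
    unfolding o_topology_def
  proof (rule the_equality)
    show "o_compatible M \<tau> (topology opn) \<and>
      (\<forall>Y. o_compatible M \<tau> Y \<longrightarrow> (\<forall>W. openin Y W \<longrightarrow> openin (topology opn) W))"
      using comp strongest by blast
  next
    fix X assume "o_compatible M \<tau> X \<and>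
      (\<forall>Y. o_compatible M \<tau> Y \<longrightarrow> (\<forall>W. openin Y W \<longrightarrow> openin X W))"
    then show "X = topology opn"
      using comp strongest by (auto simp: topology_eq)
  qed
  show ?comp by (simp add: eq comp)
  show "\<And>Y W. o_compatible M \<tau> Y \<Longrightarrow> openin Y W \<Longrightarrow> openin (o_topology M \<tau>) W"
    by (simp add: eq strongest)
  show "?open W" unfolding eq op by (simp add: opn_def)
qed

text \<open>If the net is frequently outside an open set, then passing to the cofinal part and indexing
  by the triples of values yields a net of the restricted kind. Transitivity of the order holds in
  every \<open>S\<^sub>h(M,\<tau>)\<close>; it is a hypothesis here because it needs the theory of strong sums.\<close>

lemma o_converges_imp_limitin:
  fixes M :: "'h::chilbert_space bop set" and A :: "'i set"
  assumes trans: "transp_on (tau_measurable_sa M \<tau>) uop_le"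
    and conv: "o_converges M \<tau> A le T t"
  shows "limitin (o_topology M \<tau>) T t (net_filter A le)"
proof -
  let ?H = "tau_measurable_sa M \<tau>"
  have dir: "directed_set A le" and TH: "T ` A \<subseteq> ?H" and tH: "t \<in> ?H"
    using conv unfolding o_converges_def by simp_all
  obtain S R where SH: "S ` A \<subseteq> ?H" and RH: "R ` A \<subseteq> ?H"
    and STR: "\<forall>a\<in>A. uop_le (S a) (T a) \<and> uop_le (T a) (R a)"
    and S: "monotone_on A le uop_le S" and Slub: "is_lub_in ?H uop_le (S ` A) t"
    and R: "monotone_on A le (\<lambda>X Y. uop_le Y X) R"
    and Rlub: "is_lub_in ?H (\<lambda>X Y. uop_le Y X) (R ` A) t"
    using conv unfolding o_converges_def by (elim conjE exE) (rule that)
  note Smono = monotone_onD[OF S] and Rmono = monotone_onD[OF R]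
  have top: "topspace (o_topology M \<tau>) = ?H"
    using o_topology_strongest(1) unfolding o_compatible_def by blast
  have "eventually (\<lambda>a. T a \<in> W) (net_filter A le)"
    if W: "openin (o_topology M \<tau>) W" "t \<in> W" for W
  proof (rule ccontr)
    assume "\<not> ?thesis"
    then have freq: "\<exists>b\<in>A. le a b \<and> T b \<notin> W" if "a \<in> A" for a
      using that by (auto simp: eventually_net_filter[OF dir])
    define C where "C = {b\<in>A. T b \<notin> W}"
    define B where "B = (\<lambda>a. (S a, R a, T a)) ` C"
    define ord where "ord = (\<lambda>(s :: 'h uop, r :: 'h uop, x :: 'h uop) (s' :: 'h uop, r' :: 'h uop, x' :: 'h uop).
      uop_le s s' \<and> uop_le r' r)"
    have CA: "C \<subseteq> A" by (auto simp: C_def)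
    have cof: "\<exists>b\<in>C. le a b" if "a \<in> A" for a using freq[OF that] by (auto simp: C_def)
    have refl: "le a a" if "a \<in> A" for a
      using dir that unfolding directed_set_def by (auto dest: reflp_onD)
    have dirB: "directed_set B ord"
      unfolding directed_set_def
    proof (intro conjI ballI)
      show "B \<noteq> {}" using dir cof unfolding directed_set_def B_def by blast
      show "reflp_on B ord"
        by (rule reflp_onI) (use CA Smono Rmono refl in \<open>auto simp: B_def ord_def\<close>)
      have "transp_on C (\<lambda>a b. uop_le (S a) (S b) \<and> uop_le (R b) (R a))"
      proof (rule transp_onI)
        fix a b c assume m: "a \<in> C" "b \<in> C" "c \<in> C"
          and 1: "uop_le (S a) (S b) \<and> uop_le (R b) (R a)"
          and 2: "uop_le (S b) (S c) \<and> uop_le (R c) (R b)"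
        have "S a \<in> ?H" "S b \<in> ?H" "S c \<in> ?H" "R a \<in> ?H" "R b \<in> ?H" "R c \<in> ?H"
          using m CA SH RH by auto
        then show "uop_le (S a) (S c) \<and> uop_le (R c) (R a)"
          using 1 2 transp_onD[OF trans] by blast
      qed
      then have tr: "uop_le (S a) (S c) \<and> uop_le (R c) (R a)"
        if "a \<in> C" "b \<in> C" "c \<in> C" "uop_le (S a) (S b) \<and> uop_le (R b) (R a)"
          "uop_le (S b) (S c) \<and> uop_le (R c) (R b)" for a b c
        using that by (blast dest: transp_onD)
      show "transp_on B ord"
      proof (rule transp_onI)
        fix p q r assume "p \<in> B" "q \<in> B" "r \<in> B" and 1: "ord p q" "ord q r"
        then obtain a b c where "a \<in> C" "b \<in> C" "c \<in> C" "p = (S a, R a, T a)"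
          "q = (S b, R b, T b)" "r = (S c, R c, T c)"
          unfolding B_def by blast
        then show "ord p r" using 1 tr[of a b c] by (simp add: ord_def)
      qed
    next
      fix p q assume "p \<in> B" "q \<in> B"
      then obtain a b where ab: "a \<in> C" "b \<in> C" "p = (S a, R a, T a)" "q = (S b, R b, T b)"
        unfolding B_def by blast
      then obtain c where c: "c \<in> A" "le a c" "le b c"
        using dir CA unfolding directed_set_def by blast
      obtain d where d: "d \<in> C" "le c d" using cof c(1) by blast
      have "le a d" "le b d"
        using dir ab c d CA unfolding directed_set_def by (meson subsetD transp_onD)+
      then have "ord p (S d, R d, T d)" "ord q (S d, R d, T d)"
        using ab d CA by (auto simp: ord_def intro!: Smono Rmono)
      then show "\<exists>c\<in>B. ord p c \<and> ord q c" using d(1) unfolding B_def by blast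
    qed
    have SlubC: "is_lub_in ?H uop_le (S ` C) t"
      unfolding is_lub_in_def
    proof (intro conjI ballI impI)
      show "t \<in> ?H" by (fact tH)
      show "uop_le d t" if "d \<in> S ` C" for d
        using that Slub CA unfolding is_lub_in_def by blast
      fix b assume b: "b \<in> ?H" "\<forall>d\<in>S ` C. uop_le d b"
      have "uop_le (S a) b" if a: "a \<in> A" for a
      proof -
        obtain c where c: "c \<in> C" "le a c" using cof a by blast
        then have "uop_le (S a) (S c)" "uop_le (S c) b" using a b CA Smono by auto
        moreover have "S a \<in> ?H" "S c \<in> ?H" using a c CA SH by auto
        ultimately show ?thesis using transp_onD[OF trans] b(1) by blast
      qed
      then show "uop_le t b" using Slub b(1) unfolding is_lub_in_def by blast
    qed
    have RlubC: "is_lub_in ?H (\<lambda>X Y. uop_le Y X) (R ` C) t"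
      unfolding is_lub_in_def
    proof (intro conjI ballI impI)
      show "t \<in> ?H" by (fact tH)
      show "uop_le t d" if "d \<in> R ` C" for d
        using that Rlub CA unfolding is_lub_in_def by blast
      fix b assume b: "b \<in> ?H" "\<forall>d\<in>R ` C. uop_le b d"
      have "uop_le b (R a)" if a: "a \<in> A" for a
      proof -
        obtain c where c: "c \<in> C" "le a c" using cof a by blast
        then have "uop_le (R c) (R a)" "uop_le b (R c)" using a b CA Rmono by auto
        moreover have "R a \<in> ?H" "R c \<in> ?H" using a c CA RH by auto
        ultimately show ?thesis using transp_onD[OF trans] b(1) by blast
      qed
      then show "uop_le b t" using Rlub b(1) unfolding is_lub_in_def by blast
    qed
    have HC: "S ` C \<subseteq> ?H" "R ` C \<subseteq> ?H" using CA SH RH by blast+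
    have img: "(fst ` B) = S ` C" "((\<lambda>p. fst (snd p)) ` B) = R ` C" "((\<lambda>p. snd (snd p)) ` B) = T ` C"
      by (auto simp: B_def image_image)
    have "o_converges M \<tau> B ord (\<lambda>p. snd (snd p)) t"
      unfolding o_converges_def img
    proof (intro conjI)
      show "\<exists>S' R'. S' ` B \<subseteq> ?H \<and> R' ` B \<subseteq> ?H \<and>
        (\<forall>p\<in>B. uop_le (S' p) (snd (snd p)) \<and> uop_le (snd (snd p)) (R' p)) \<and>
        monotone_on B ord uop_le S' \<and> is_lub_in ?H uop_le (S' ` B) t \<and>
        monotone_on B ord (\<lambda>X Y. uop_le Y X) R' \<and> is_lub_in ?H (\<lambda>X Y. uop_le Y X) (R' ` B) t"
        by (rule exI[of _ fst], rule exI[of _ "\<lambda>p. fst (snd p)"])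
          (unfold img, intro conjI SlubC RlubC HC,
            use CA STR in \<open>auto simp: monotone_on_def ord_def B_def\<close>)
    qed (use dirB TH tH CA in auto)
    then have "eventually (\<lambda>p. snd (snd p) \<in> W) (net_filter B ord)"
      using W o_topology_strongest(3) by blast
    then obtain p where "p \<in> B" "snd (snd p) \<in> W"
      using dirB unfolding eventually_net_filter[OF dirB] directed_set_def
      by (blast dest: reflp_onD)
    then show False by (auto simp: B_def C_def)
  qed
  then show ?thesis using tH top by (auto simp: limitin_def)
qed

end

theory Submission
  imports Defs
begin

text \<open>Suppose \<open>\<tau>(I) = \<infinity>\<close>. Then there are orthogonal projections \<open>E\<^sub>n\<close> with \<open>\<tau>(E\<^sub>n) \<ge> 1\<close>; put
  \<open>F\<^sub>n = \<surd>(n + 1) E\<^sub>n\<close>. On the one hand, \<open>0\<close> is in the closure of \<open>{F\<^sub>n}\<close> for the \<open>\<tau>\<close>-locally measure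
  topology: if \<open>\<tau>(P) < \<infinity>\<close>, then \<open>\<Sum> \<tau>(P E\<^sub>n P) \<le> \<tau>(P)\<close>, so by divergence of the harmonic series
  \<open>(n + 1) \<tau>(P E\<^sub>n P)\<close> takes arbitrarily small values, and \<open>F\<^sub>n\<close> is small on \<open>P\<close> up to a spectral
  projection of \<open>P E\<^sub>n P\<close> of small trace. On the other hand, the self-adjoint operators that dominate no
  \<open>F\<^sub>n\<close> form an (o)-open neighbourhood of \<open>0\<close>: a \<open>\<tau>\<close>-measurable \<open>R\<close> is bounded on a projection \<open>p\<close> with
  \<open>\<tau>(p\<^sup>\<bottom>) < 1\<close>, which meets every \<open>E\<^sub>n\<close>, so \<open>F\<^sub>n \<le> R\<close> only for finitely many \<open>n\<close>; hence if a net
  decreasing to \<open>t\<close> frequently dominates some \<open>F\<^sub>n\<close>, then one \<open>F\<^sub>n\<close> is below the whole net, and below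
  \<open>t\<close>. The transitivity of the order used here holds because the domain of a \<open>\<tau>\<close>-measurable operator
  contains a core of every self-adjoint one.\<close>

section \<open>Hilbert space preliminaries\<close>

text \<open>The weight \<open>sqrt (n + 1)\<close> balances two demands on a sequence
  \<open>c n\<close>: it must tend to infinity, so that a bound \<open>c n \<le> C\<close> leaves
  finitely many indices, and the reciprocals of \<open>(c n)\<^sup>2\<close> must have divergent
  sum. The square enters because the neighbourhoods measure the norm of \<open>F\<^sub>n Q\<close>,
  whose square is governed by \<open>(c n)\<^sup>2\<close> times the form of
  \<open>P E\<^sub>n P\<close>. This yields accumulation at 0, not convergence, which is enough to
  violate one open set. All comparisons of projections rest on \<open>trace_le_if_injective\<close>:
  an element of the algebra that is injective on the range of \<open>r\<close> and maps into the
  range of \<open>p\<close> forces \<open>\<tau> r \<le> \<tau> p\<close>. It gives the traces of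
  joins and meets, the common vector of \<open>p\<close> and \<open>E\<^sub>n\<close>, and the
  density behind the core. Bounded operators are treated over the real inner product, complex
  linearity being commutation with multiplication by i. As affiliation is tested on unitaries only,
  Cayley transforms are used to bring resolvents into the algebra.\<close>

lemma le_if_square_le_mult:
  fixes a n :: real
  assumes "n * n \<le> a * n" "0 \<le> n" "0 \<le> a"
  shows "n \<le> a"
  using assms by (cases "n = 0") (simp_all add: mult_le_cancel_right)

text \<open>A minimising sequence for the distance from \<open>x\<close> to \<open>K\<close> is
  Cauchy by the parallelogram law, and its limit is the foot of the perpendicular by a
  first-variation argument.\<close>

lemma hilbert_projection_exists:
  fixes K :: "'a::{real_inner,complete_space} set"
  assumes "subspace K" "closed K"
  shows "\<exists>p\<in>K. \<forall>k\<in>K. (x - p) \<bullet> k = 0"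
proof -
  have ne: "K \<noteq> {}" using assms(1) subspace_0 by blast
  define d where "d = infdist x K"
  have d0: "0 \<le> d" by (simp add: d_def infdist_nonneg)
  have dle: "d \<le> norm (x - k)" if "k \<in> K" for k
    using infdist_le[OF that, of x] by (simp add: d_def dist_norm)
  have "\<exists>k\<in>K. norm (x - k) < d + 1 / real (Suc n)" for n
  proof -
    have "infdist x K < d + 1 / real (Suc n)" by (simp add: d_def)
    then have "Inf (dist x ` K) < d + 1 / real (Suc n)" using ne by (simp add: infdist_def)
    then obtain r where "r \<in> dist x ` K" "r < d + 1 / real (Suc n)"
      using cInf_lessD[of "dist x ` K"] ne by blast
    then show ?thesis by (auto simp: dist_norm)
  qed
  then obtain k where kK: "\<And>n. k n \<in> K" and k: "\<And>n. norm (x - k n) < d + 1 / real (Suc n)"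
    by metis
  \<comment> \<open>The midpoint of \<open>a\<close> and \<open>b\<close> lies in \<open>K\<close>,
    so its distance from \<open>x\<close> is at least \<open>d\<close>; the parallelogram law then
    leaves \<open>4 (d + e)\<^sup>2 - 4 d\<^sup>2\<close>.\<close>
  have par: "(norm (a - b))\<^sup>2 \<le> 8 * d * e + 4 * e\<^sup>2"
    if "a \<in> K" "b \<in> K" "norm (x - a) \<le> d + e" "norm (x - b) \<le> d + e" for a b e
  proof -
    have m: "(1/2) *\<^sub>R (a + b) \<in> K"
      by (intro subspace_scale subspace_add assms that)
    have "d\<^sup>2 \<le> (norm (x - (1/2) *\<^sub>R (a + b)))\<^sup>2"
      using dle[OF m] d0 by (intro power_mono)
    moreover have "(norm (x - a))\<^sup>2 \<le> (d + e)\<^sup>2" "(norm (x - b))\<^sup>2 \<le> (d + e)\<^sup>2"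
      using that by (auto intro!: power_mono)
    moreover have "(norm (a - b))\<^sup>2 = 2 * (norm (x - a))\<^sup>2 + 2 * (norm (x - b))\<^sup>2
        - 4 * (norm (x - (1/2) *\<^sub>R (a + b)))\<^sup>2"
      by (simp add: power2_norm_eq_inner algebra_simps inner_commute)
    ultimately show ?thesis by (simp add: power2_eq_square algebra_simps)
  qed
  have "Cauchy k"
  proof (rule metric_CauchyI)
    fix r :: real assume r: "0 < r"
    have "(\<lambda>n. 8 * d * (1 / real (Suc n)) + 4 * (1 / real (Suc n))\<^sup>2) \<longlonglongrightarrow> 8 * d * 0 + 4 * 0\<^sup>2"
      by (intro tendsto_intros LIMSEQ_Suc[OF lim_1_over_n])
    then have "eventually (\<lambda>n. 8 * d * (1 / real (Suc n)) + 4 * (1 / real (Suc n))\<^sup>2 < r\<^sup>2) sequentially"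
      by (rule order_tendstoD) (use r in simp)
    then obtain N where N: "8 * d * (1 / real (Suc N)) + 4 * (1 / real (Suc N))\<^sup>2 < r\<^sup>2"
      by (auto simp: eventually_sequentially)
    have kN: "norm (x - k n) \<le> d + 1 / real (Suc N)" if "N \<le> n" for n
      using k[of n] frac_le[of 1 1 "real (Suc N)" "real (Suc n)"] that by linarith
    have "dist (k m) (k n) < r" if "N \<le> m" "N \<le> n" for m n
    proof -
      have "(norm (k m - k n))\<^sup>2 < r\<^sup>2"
        using par[OF kK kK kN[OF that(1)] kN[OF that(2)]] N by linarith
      then show ?thesis using r by (simp add: dist_norm power2_less_imp_less)
    qed
    then show "\<exists>M. \<forall>m\<ge>M. \<forall>n\<ge>M. dist (k m) (k n) < r" by blast
  qed
  then obtain p where p: "k \<longlonglongrightarrow> p" using Cauchy_convergent convergent_def by blast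
  have pK: "p \<in> K" using closed_sequentially[OF assms(2)] kK p by blast
  have "norm (x - p) \<le> d"
  proof (rule LIMSEQ_le)
    show "(\<lambda>n. norm (x - k n)) \<longlonglongrightarrow> norm (x - p)" by (intro tendsto_intros p)
    have "(\<lambda>n. d + 1 / real (Suc n)) \<longlonglongrightarrow> d + 0"
      by (intro tendsto_intros LIMSEQ_Suc[OF lim_1_over_n])
    then show "(\<lambda>n. d + 1 / real (Suc n)) \<longlonglongrightarrow> d" by simp
    show "\<exists>N. \<forall>n\<ge>N. norm (x - k n) \<le> d + 1 / real (Suc n)" using k less_imp_le by blast
  qed
  then have min: "norm (x - p) \<le> norm (x - q)" if "q \<in> K" for q using dle[OF that] by simp
  have "(x - p) \<bullet> q = 0" if q: "q \<in> K" for q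
  proof (cases "q = 0")
    case False
    \<comment> \<open>The value of \<open>t\<close> that minimises the distance from
      \<open>x\<close> to \<open>p + t q\<close>.\<close>
    define t where "t = ((x - p) \<bullet> q) / (q \<bullet> q)"
    have "p + t *\<^sub>R q \<in> K" by (intro subspace_add subspace_scale assms pK q)
    then have "(norm (x - p))\<^sup>2 \<le> (norm (x - (p + t *\<^sub>R q)))\<^sup>2"
      by (intro power_mono min) auto
    also have "\<dots> = (norm (x - p))\<^sup>2 - 2 * t * ((x - p) \<bullet> q) + t * (t * (q \<bullet> q))"
      by (simp add: power2_norm_eq_inner algebra_simps inner_commute)
    also have "t * (q \<bullet> q) = (x - p) \<bullet> q" using False by (simp add: t_def)
    finally have "t * ((x - p) \<bullet> q) \<le> 0" by simp
    then have "((x - p) \<bullet> q) * ((x - p) \<bullet> q) / (q \<bullet> q) \<le> 0" by (simp add: t_def)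
    moreover have "0 < q \<bullet> q" using False by simp
    ultimately show ?thesis by (auto simp: divide_le_0_iff mult_le_0_iff)
  qed simp
  then show ?thesis using pK by blast
qed

definition orth_proj :: "'a::{real_inner,complete_space} set \<Rightarrow> 'a \<Rightarrow>\<^sub>L 'a" where
  "orth_proj K = Blinfun (\<lambda>x. SOME p. p \<in> K \<and> (\<forall>k\<in>K. (x - p) \<bullet> k = 0))"

text \<open>Uniqueness of the foot \<open>f x\<close> makes \<open>f\<close> linear, and
  \<open>(norm (f x))\<^sup>2 = x \<bullet> f x\<close> makes it a contraction; hence
  \<open>Blinfun\<close> is applied to a genuine bounded map in the definition.\<close>

lemma orth_proj:
  fixes K :: "'a::{real_inner,complete_space} set"
  assumes "subspace K" "closed K"
  shows orth_proj_in: "orth_proj K x \<in> K"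
    and orth_proj_orthogonal: "k \<in> K \<Longrightarrow> (x - orth_proj K x) \<bullet> k = 0"
    and orth_proj_unique: "p \<in> K \<Longrightarrow> (\<And>k. k \<in> K \<Longrightarrow> (x - p) \<bullet> k = 0) \<Longrightarrow> orth_proj K x = p"
proof -
  define f where "f = (\<lambda>x. SOME p. p \<in> K \<and> (\<forall>k\<in>K. (x - p) \<bullet> k = 0))"
  have f: "f x \<in> K \<and> (\<forall>k\<in>K. (x - f x) \<bullet> k = 0)" for x
    unfolding f_def by (rule someI_ex) (use hilbert_projection_exists[OF assms] in blast)
  have u: "f x = p" if "p \<in> K" "\<And>k. k \<in> K \<Longrightarrow> (x - p) \<bullet> k = 0" for x p
  proof -
    have "f x - p \<in> K" using f that assms(1) by (simp add: subspace_diff)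
    then have "(x - p) \<bullet> (f x - p) - (x - f x) \<bullet> (f x - p) = 0" using f that by simp
    then have "(f x - p) \<bullet> (f x - p) = 0" by (simp add: algebra_simps)
    then show ?thesis by simp
  qed
  have nf: "norm (f x) \<le> norm x" for x
  proof -
    have "(norm (f x))\<^sup>2 = x \<bullet> f x"
      using f[of x] by (simp add: power2_norm_eq_inner inner_diff_left)
    also have "\<dots> \<le> norm x * norm (f x)" by (rule norm_cauchy_schwarz)
    finally show ?thesis
      unfolding power2_eq_square by (rule le_if_square_le_mult) simp_all
  qed
  have "bounded_linear f"
  proof (rule bounded_linear_intro[where K = 1])
    show "f (x + y) = f x + f y" for x y
    proof (rule u)
      show "f x + f y \<in> K" using f assms(1) by (simp add: subspace_add)
      fix k assume "k \<in> K"
      then have "(x - f x) \<bullet> k + (y - f y) \<bullet> k = 0" using f by simp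
      then show "(x + y - (f x + f y)) \<bullet> k = 0" by (simp only: inner_add_left inner_diff_left)
    qed
    show "f (r *\<^sub>R x) = r *\<^sub>R f x" for r x
    proof (rule u)
      show "r *\<^sub>R f x \<in> K" using f assms(1) by (simp add: subspace_scale)
      fix k assume "k \<in> K"
      then have "r * ((x - f x) \<bullet> k) = 0" using f by simp
      then show "(r *\<^sub>R x - r *\<^sub>R f x) \<bullet> k = 0"
        by (simp only: inner_scaleR_left flip: scaleR_diff_right)
    qed
  qed (use nf in simp)
  then have eq: "blinfun_apply (orth_proj K) = f"
    unfolding orth_proj_def f_def by (rule bounded_linear_Blinfun_apply)
  show "orth_proj K x \<in> K" "k \<in> K \<Longrightarrow> (x - orth_proj K x) \<bullet> k = 0"
    "p \<in> K \<Longrightarrow> (\<And>k. k \<in> K \<Longrightarrow> (x - p) \<bullet> k = 0) \<Longrightarrow> orth_proj K x = p"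
    using f u by (auto simp: eq)
qed

lemma orth_proj_selfadjoint:
  fixes K :: "'a::{real_inner,complete_space} set"
  assumes "subspace K" "closed K"
  shows "orth_proj K x \<bullet> y = x \<bullet> orth_proj K y"
proof -
  have "(x - orth_proj K x) \<bullet> orth_proj K y = 0" "(y - orth_proj K y) \<bullet> orth_proj K x = 0"
    by (rule orth_proj_orthogonal[OF assms orth_proj_in[OF assms]])+
  then have "x \<bullet> orth_proj K y = orth_proj K x \<bullet> orth_proj K y"
    "y \<bullet> orth_proj K x = orth_proj K y \<bullet> orth_proj K x"
    by (simp_all add: inner_diff_left)
  then show ?thesis by (metis inner_commute)
qed

lemma orth_proj_eq_self_iff:
  fixes K :: "'a::{real_inner,complete_space} set"
  assumes "subspace K" "closed K"
  shows "orth_proj K x = x \<longleftrightarrow> x \<in> K"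
proof
  assume "orth_proj K x = x"
  then show "x \<in> K" using orth_proj_in[OF assms, of x] by simp
next
  assume "x \<in> K"
  then show "orth_proj K x = x" by (intro orth_proj_unique[OF assms]) simp_all
qed

lemma orth_proj_eq_0_iff:
  fixes K :: "'a::{real_inner,complete_space} set"
  assumes "subspace K" "closed K"
  shows "orth_proj K x = 0 \<longleftrightarrow> (\<forall>k\<in>K. x \<bullet> k = 0)"
proof
  assume "orth_proj K x = 0"
  then show "\<forall>k\<in>K. x \<bullet> k = 0" using orth_proj_orthogonal[OF assms, of _ x] by simp
next
  assume "\<forall>k\<in>K. x \<bullet> k = 0"
  then show "orth_proj K x = 0"
    by (intro orth_proj_unique[OF assms]) (simp_all add: subspace_0[OF assms(1)])
qed

lemma closed_orthogonal_complement: "closed {x::'a::real_inner. \<forall>s\<in>S. x \<bullet> s = 0}"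
proof -
  have "{x. \<forall>s\<in>S. x \<bullet> s = 0} = (\<Inter>s\<in>S. {x. x \<bullet> s = 0})" by auto
  moreover have "closed {x. x \<bullet> s = 0}" for s :: 'a
    by (intro closed_Collect_eq continuous_intros)
  ultimately show ?thesis by (simp add: closed_INT)
qed

lemma subspace_orthogonal_complement: "subspace {x::'a::real_inner. \<forall>s\<in>S. x \<bullet> s = 0}"
  by (auto simp: subspace_def inner_add_left)

lemma subspace_closure:
  fixes K :: "'a::real_normed_vector set"
  assumes "subspace K"
  shows "subspace (closure K)"
  unfolding subspace_def
proof (intro conjI ballI allI)
  show "0 \<in> closure K" using assms closure_subset subspace_0 by blast
next
  fix x y assume "x \<in> closure K" "y \<in> closure K"
  then obtain u v where "\<And>n::nat. u n \<in> K" "u \<longlonglongrightarrow> x" "\<And>n::nat. v n \<in> K" "v \<longlonglongrightarrow> y"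
    unfolding closure_sequential by blast
  then have "\<forall>n. u n + v n \<in> K" "(\<lambda>n. u n + v n) \<longlonglongrightarrow> x + y"
    using assms by (auto intro: subspace_add tendsto_add)
  then show "x + y \<in> closure K" unfolding closure_sequential by (intro exI[of _ "\<lambda>n. u n + v n"]) simp
next
  fix r x assume "x \<in> closure K"
  then obtain u where "\<And>n::nat. u n \<in> K" "u \<longlonglongrightarrow> x" unfolding closure_sequential by blast
  then have "\<forall>n. r *\<^sub>R u n \<in> K" "(\<lambda>n. r *\<^sub>R u n) \<longlonglongrightarrow> r *\<^sub>R x"
    using assms by (auto intro: subspace_scale tendsto_scaleR)
  then show "r *\<^sub>R x \<in> closure K" unfolding closure_sequential by (intro exI[of _ "\<lambda>n. r *\<^sub>R u n"]) simp
qed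

lemma dense_if_orthogonal_trivial:
  fixes K :: "'a::{real_inner,complete_space} set"
  assumes "subspace K" and "\<And>v. (\<And>k. k \<in> K \<Longrightarrow> v \<bullet> k = 0) \<Longrightarrow> v = 0"
  shows "closure K = UNIV"
proof -
  have c: "subspace (closure K)" "closed (closure K)" using assms(1) by (auto intro: subspace_closure)
  have "x \<in> closure K" for x
  proof -
    have "x - orth_proj (closure K) x = 0"
      by (rule assms(2)) (use orth_proj_orthogonal[OF c] closure_subset in blast)
    then show ?thesis using orth_proj_in[OF c, of x] by simp
  qed
  then show ?thesis by blast
qed

text \<open>The representing vector is a multiple of a vector \<open>q\<close> orthogonal to the
  kernel of \<open>f\<close>, because \<open>x - (f x / f q) q\<close> lies in that kernel.\<close>

lemma riesz_representation:
  fixes f :: "'a::{real_inner,complete_space} \<Rightarrow> real"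
  assumes "bounded_linear f"
  shows "\<exists>r. \<forall>x. f x = x \<bullet> r"
proof (cases "\<forall>x. f x = 0")
  case True then show ?thesis by (intro exI[of _ 0]) simp
next
  case False
  then obtain a where a: "f a \<noteq> 0" by blast
  interpret bounded_linear f by fact
  let ?K = "{x. f x = 0}"
  have K: "subspace ?K" "closed ?K"
    by (simp add: subspace_def zero add scaleR)
      (intro closed_Collect_eq continuous_on continuous_on_id continuous_on_const)
  define q where "q = a - orth_proj ?K a"
  have fq: "f q = f a" using orth_proj_in[OF K, of a] by (simp add: q_def diff)
  have qk: "q \<bullet> k = 0" if "f k = 0" for k
    using orth_proj_orthogonal[OF K, of k a] that by (simp add: q_def)
  have q0: "q \<bullet> q \<noteq> 0" using fq a by (auto simp: zero)
  have "f x = x \<bullet> ((f q / (q \<bullet> q)) *\<^sub>R q)" for x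
  proof -
    have "q \<bullet> (x - (f x / f q) *\<^sub>R q) = 0" using fq a by (intro qk) (simp add: diff scaleR)
    then have "q \<bullet> x = f x / f q * (q \<bullet> q)" by (simp add: inner_diff_right)
    then show ?thesis using q0 fq a by (simp add: inner_commute)
  qed
  then show ?thesis by blast
qed

section \<open>Adjoints and bounded operators obtained from graphs\<close>

definition adj_op :: "('a::{real_inner,complete_space} \<Rightarrow>\<^sub>L 'a) \<Rightarrow> 'a \<Rightarrow>\<^sub>L 'a" where
  "adj_op A = Blinfun (\<lambda>y. SOME z. \<forall>x. A x \<bullet> y = x \<bullet> z)"

lemma adj_op: "blinfun_apply A x \<bullet> y = x \<bullet> adj_op A y"
proof -
  define f where "f = (\<lambda>y. SOME z. \<forall>x. blinfun_apply A x \<bullet> y = x \<bullet> z)"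
  have ex: "\<exists>z. \<forall>x. blinfun_apply A x \<bullet> y = x \<bullet> z" for y
    by (rule riesz_representation)
      (rule bounded_linear_compose[OF bounded_linear_inner_left blinfun.bounded_linear_right])
  have f: "blinfun_apply A x \<bullet> y = x \<bullet> f y" for x y
    unfolding f_def by (rule someI_ex[OF ex, THEN spec])
  have u: "f y = z" if "\<And>x. blinfun_apply A x \<bullet> y = x \<bullet> z" for y z
  proof (rule vector_eq_ldot[THEN iffD1], rule allI)
    show "x \<bullet> f y = x \<bullet> z" for x by (rule trans[OF f[symmetric] that])
  qed
  have "bounded_linear f"
  proof (rule bounded_linear_intro[where K = "norm A"])
    show "f (x + y) = f x + f y" for x y by (rule u) (simp only: inner_add_right f)
    show "f (r *\<^sub>R x) = r *\<^sub>R f x" for r x by (rule u) (simp only: inner_scaleR_right f)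
    fix x
    have "norm (f x) * norm (f x) = A (f x) \<bullet> x"
      using f[of "f x" x] by (simp flip: power2_eq_square power2_norm_eq_inner)
    also have "\<dots> \<le> norm (A (f x)) * norm x" by (rule norm_cauchy_schwarz)
    also have "\<dots> \<le> (norm A * norm (f x)) * norm x" by (intro mult_right_mono norm_blinfun) simp
    also have "\<dots> = (norm x * norm A) * norm (f x)" by (simp only: ac_simps)
    finally show "norm (f x) \<le> norm x * norm A" by (rule le_if_square_le_mult) simp_all
  qed
  then have "blinfun_apply (adj_op A) = f"
    unfolding adj_op_def f_def by (rule bounded_linear_Blinfun_apply)
  then show ?thesis by (simp add: f)
qed

lemma adj_op_eqI: "(\<And>x y. blinfun_apply A x \<bullet> y = x \<bullet> blinfun_apply B y) \<Longrightarrow> adj_op A = B"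
proof (rule blinfun_eqI)
  fix y assume *: "\<And>x y. blinfun_apply A x \<bullet> y = x \<bullet> blinfun_apply B y"
  have "\<forall>x. x \<bullet> adj_op A y = x \<bullet> B y" using * adj_op by metis
  then show "adj_op A y = B y" by (rule vector_eq_ldot[THEN iffD1])
qed

text \<open>Extension by continuity, phrased for graphs. Partial isometries and resolvents both
  arise below as closed linear relations with dense domain and a norm bound.\<close>

lemma graph_of_bounded_operator:
  fixes L :: "('a::{real_normed_vector} \<times> 'b::banach) set"
  assumes "subspace L" "closed L" and bd: "\<And>x y. (x, y) \<in> L \<Longrightarrow> norm y \<le> c * norm x"
    and dense: "closure (fst ` L) = UNIV"
  obtains V :: "'a \<Rightarrow>\<^sub>L 'b" where "\<And>x y. (x, y) \<in> L \<longleftrightarrow> y = V x"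
proof -
  have ex: "\<exists>y. (x, y) \<in> L" for x
  proof -
    obtain u where u: "\<And>n. u n \<in> fst ` L" "u \<longlonglongrightarrow> x"
      using dense closure_sequential[of x "fst ` L"] by auto
    then have "\<forall>n. \<exists>y. (u n, y) \<in> L" by force
    then obtain v where v: "\<And>n. (u n, v n) \<in> L" by metis
    have c: "norm (v m - v n) \<le> c * norm (u m - u n)" for m n
      using subspace_diff[OF assms(1) v v, of m n] by (intro bd) simp
    \<comment> \<open>\<open>c\<close> may be zero or negative; a positive factor is needed for the
      division that follows.\<close>
    have c': "norm (v m - v n) \<le> (\<bar>c\<bar> + 1) * norm (u m - u n)" for m n
      using c[of m n] by (rule order_trans) (intro mult_right_mono, auto)
    have "Cauchy v"
    proof (rule metric_CauchyI)
      fix r :: real assume "0 < r"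
      then have "0 < r / (\<bar>c\<bar> + 1)" by (simp add: add_nonneg_pos)
      then obtain N where N: "\<forall>m\<ge>N. \<forall>n\<ge>N. dist (u m) (u n) < r / (\<bar>c\<bar> + 1)"
        using LIMSEQ_imp_Cauchy[OF u(2)] unfolding Cauchy_def by blast
      have "dist (v m) (v n) < r" if "N \<le> m" "N \<le> n" for m n
      proof -
        have "(\<bar>c\<bar> + 1) * norm (u m - u n) < r"
          using N that by (simp add: dist_norm pos_less_divide_eq add_nonneg_pos mult.commute)
        then show ?thesis using c'[of m n] by (simp add: dist_norm)
      qed
      then show "\<exists>M. \<forall>m\<ge>M. \<forall>n\<ge>M. dist (v m) (v n) < r" by blast
    qed
    then obtain y where y: "v \<longlonglongrightarrow> y" using Cauchy_convergent convergent_def by blast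
    have "(\<lambda>n. (u n, v n)) \<longlonglongrightarrow> (x, y)" by (intro tendsto_Pair u y)
    with v have "(x, y) \<in> L" by (rule closed_sequentially[OF assms(2)])
    then show ?thesis by blast
  qed
  have un: "y = z" if "(x, y) \<in> L" "(x, z) \<in> L" for x y z
  proof -
    have "(0, y - z) \<in> L" using subspace_diff[OF assms(1) that] by simp
    then show ?thesis using bd[of 0 "y - z"] by simp
  qed
  define f where "f = (\<lambda>x. THE y. (x, y) \<in> L)"
  have fL: "(x, f x) \<in> L" for x
    unfolding f_def by (rule theI') (use ex un in blast)
  have "bounded_linear f"
  proof (rule bounded_linear_intro[where K = c])
    show "f (x + y) = f x + f y" for x y
      by (rule un[OF fL]) (use subspace_add[OF assms(1) fL fL, of x y] in simp)
    show "f (r *\<^sub>R x) = r *\<^sub>R f x" for r x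
      by (rule un[OF fL]) (use subspace_scale[OF assms(1) fL, of r x] in simp)
    show "norm (f x) \<le> norm x * c" for x using bd[OF fL, of x] by (simp add: mult.commute)
  qed
  then have "blinfun_apply (Blinfun f) = f" by (rule bounded_linear_Blinfun_apply)
  then have "(x, y) \<in> L \<longleftrightarrow> y = Blinfun f x" for x y
    using fL[of x] un[OF _ fL, of x y] by auto
  then show ?thesis by (rule that)
qed

section \<open>Square roots and spectral splitting of bounded operators\<close>

text \<open>By Baire's theorem one of the closed sets \<open>B n\<close> contains a ball; moving the
  bound from its centre to the origin bounds all norms at once.\<close>

lemma uniform_boundedness:
  fixes f :: "'i \<Rightarrow> 'a::banach \<Rightarrow>\<^sub>L 'b::real_normed_vector"
  assumes "\<And>x. \<exists>C. \<forall>i. norm (f i x) \<le> C"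
  shows "\<exists>C. \<forall>i. norm (f i) \<le> C"
proof -
  define B where "B = (\<lambda>n::nat. {x. \<forall>i. norm (f i x) \<le> real n})"
  have cl: "closed (B n)" for n
  proof -
    have "B n = (\<Inter>i. {x. norm (f i x) \<le> real n})" by (auto simp: B_def)
    moreover have "continuous_on UNIV (\<lambda>x. norm (f i x))" for i
      by (intro continuous_intros)
    ultimately show ?thesis by (auto intro!: closed_INT closed_Collect_le continuous_on_const)
  qed
  have "(\<Union>n. B n) = UNIV"
  proof -
    have "\<exists>n. x \<in> B n" for x
    proof -
      obtain C where "\<forall>i. norm (f i x) \<le> C" using assms by blast
      moreover obtain n where "C \<le> real n" using real_arch_simple by blast
      ultimately have "x \<in> B n" by (auto simp: B_def intro: order_trans)
      then show ?thesis ..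
    qed
    then show ?thesis by blast
  qed
  have "\<exists>n. interior (B n) \<noteq> {}"
  proof (rule ccontr)
    assume "\<not> ?thesis"
    then have "(euclidean :: 'a topology) interior_of \<Union>(range B) = {}"
      by (intro Baire_category_alt) (auto simp: cl completely_metrizable_space_euclidean)
    then show False using \<open>(\<Union>n. B n) = UNIV\<close> by simp
  qed
  then obtain n a r where r: "r > 0" "ball a r \<subseteq> B n" by (meson all_not_in_conv mem_interior)
  have "norm (f i) \<le> 4 * real n / r" for i
  proof (rule norm_blinfun_bound)
    fix y
    show "norm (f i y) \<le> 4 * real n / r * norm y"
    proof (cases "y = 0")
      case False
      \<comment> \<open>Scales \<open>y\<close> to length \<open>r / 2\<close>, so that
        \<open>a + s y\<close> stays in the ball.\<close>
      define s where "s = r / (2 * norm y)"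
      have s: "s > 0" using r False by (simp add: s_def)
      have "a + s *\<^sub>R y \<in> ball a r" "a \<in> ball a r"
        using r False by (auto simp: dist_norm s_def)
      then have "a + s *\<^sub>R y \<in> B n" "a \<in> B n" using r by blast+
      then have "norm (f i (a + s *\<^sub>R y)) \<le> n" "norm (f i a) \<le> n" by (simp_all add: B_def)
      moreover have "f i (a + s *\<^sub>R y) - f i a = s *\<^sub>R f i y"
        by (simp add: blinfun.add_right blinfun.scaleR_right)
      ultimately have "norm (s *\<^sub>R f i y) \<le> 2 * real n"
        using norm_triangle_ineq4[of "f i (a + s *\<^sub>R y)" "f i a"] by simp
      then show ?thesis using s r False by (simp add: s_def field_simps)
    qed simp
  qed (use r in simp)
  then show ?thesis by blast
qed

lemma compose_add_left: "(A + B) o\<^sub>L C = (A o\<^sub>L C) + (B o\<^sub>L C)"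
  and compose_add_right: "A o\<^sub>L (B + C) = (A o\<^sub>L B) + (A o\<^sub>L C)"
  and compose_diff_left: "(A - B) o\<^sub>L C = (A o\<^sub>L C) - (B o\<^sub>L C)"
  and compose_diff_right: "A o\<^sub>L (B - C) = (A o\<^sub>L B) - (A o\<^sub>L C)"
  and compose_scaleR_left: "(r *\<^sub>R A) o\<^sub>L B = r *\<^sub>R (A o\<^sub>L B)"
  and compose_scaleR_right: "A o\<^sub>L (r *\<^sub>R B) = r *\<^sub>R (A o\<^sub>L B)"
  and compose_assoc: "(A o\<^sub>L B) o\<^sub>L C = A o\<^sub>L (B o\<^sub>L C)"
  and compose_id_left [simp]: "id_blinfun o\<^sub>L A = A"
  and compose_id_right [simp]: "A o\<^sub>L id_blinfun = A"
  by (auto intro!: blinfun_eqI simp: blinfun.bilinear_simps)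

abbreviation selfadjoint :: "('a::real_inner \<Rightarrow>\<^sub>L 'a) \<Rightarrow> bool" where
  "selfadjoint A \<equiv> \<forall>x y. A x \<bullet> y = x \<bullet> A y"

text \<open>With \<open>c = 1 - A\<close> and \<open>S = 1 - y\<close> the equation \<open>S\<^sup>2 = A\<close> reads \<open>y = (c + y\<^sup>2) / 2\<close>; it is solved
  by iteration from \<open>0\<close>, with the steps dominated by those of \<open>t \<mapsto> (1 + t\<^sup>2) / 2\<close>.\<close>

lemma operator_sqrt:
  fixes A :: "'a::{real_inner,banach} \<Rightarrow>\<^sub>L 'a"
  assumes "norm (id_blinfun - A) \<le> 1" "selfadjoint A"
  obtains S where "S o\<^sub>L S = A" "selfadjoint S" "\<And>x. 0 \<le> S x \<bullet> x"
    "\<And>B. B o\<^sub>L A = A o\<^sub>L B \<Longrightarrow> B o\<^sub>L S = S o\<^sub>L B"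
proof -
  define c where "c = id_blinfun - A"
  define y where "y = rec_nat (0 :: 'a \<Rightarrow>\<^sub>L 'a) (\<lambda>_ y. (1/2) *\<^sub>R (c + (y o\<^sub>L y)))"
  define t where "t = rec_nat (0::real) (\<lambda>_ t. (1 + t * t) / 2)"
  have y0: "y 0 = 0" and yS: "y (Suc n) = (1/2) *\<^sub>R (c + (y n o\<^sub>L y n))" for n
    by (simp_all add: y_def)
  have t0: "t 0 = 0" and tS: "t (Suc n) = (1 + t n * t n) / 2" for n
    by (simp_all add: t_def)
  have t01: "0 \<le> t n \<and> t n \<le> 1" for n
  proof (induction n)
    case (Suc n)
    then have "t n * t n \<le> 1" by (simp add: mult_le_one)
    then show ?case using Suc by (simp add: tS)
  qed (simp add: t0)
  have tinc: "t n \<le> t (Suc n)" for n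
    using zero_le_power2[of "t n - 1"] by (simp add: tS power2_eq_square algebra_simps)
  have comm: "B o\<^sub>L y n = y n o\<^sub>L B" if "B o\<^sub>L c = c o\<^sub>L B" for B n
  proof (induction n)
    case (Suc n)
    have "B o\<^sub>L (y n o\<^sub>L y n) = (y n o\<^sub>L y n) o\<^sub>L B" using Suc by (metis compose_assoc)
    then show ?case using that
      by (simp add: yS compose_scaleR_left compose_scaleR_right compose_add_left compose_add_right)
  qed (auto simp: y0)
  have yy: "y m o\<^sub>L y n = y n o\<^sub>L y m" for m n by (intro comm comm[symmetric]) simp
  have ny: "norm (y n) \<le> t n" for n
  proof (induction n)
    case (Suc n)
    have "norm (y n o\<^sub>L y n) \<le> t n * t n"
      using norm_blinfun_compose[of "y n" "y n"] mult_mono[OF Suc Suc] t01[of n] by fastforce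
    moreover have "norm c \<le> 1" using assms(1) by (simp add: c_def)
    ultimately show ?case using norm_triangle_ineq[of c "y n o\<^sub>L y n"] by (simp add: yS tS)
  qed (simp add: y0 t0)
  have step: "norm (y (Suc n) - y n) \<le> t (Suc n) - t n" for n
  proof (induction n)
    case 0
    then show ?case using assms(1) by (simp add: y0 t0 yS tS c_def)
  next
    case (Suc n)
    \<comment> \<open>The difference of the squares factors because the iterates commute with each
      other.\<close>
    have "y (Suc (Suc n)) - y (Suc n) = (1/2) *\<^sub>R ((y (Suc n) - y n) o\<^sub>L (y (Suc n) + y n))"
      using yy[of "Suc n" n]
      by (simp add: yS[of "Suc n"] yS[of n, symmetric] compose_add_right compose_diff_left
          scaleR_diff_right[symmetric]) (simp add: yS[of n] scaleR_add_right[symmetric] scaleR_diff_right[symmetric])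
    then have "norm (y (Suc (Suc n)) - y (Suc n))
        \<le> (norm (y (Suc n) - y n) * norm (y (Suc n) + y n)) / 2"
      using norm_blinfun_compose[of "y (Suc n) - y n" "y (Suc n) + y n"] by simp
    also have "\<dots> \<le> ((t (Suc n) - t n) * (t (Suc n) + t n)) / 2"
      using ny[of n] ny[of "Suc n"] norm_triangle_ineq[of "y (Suc n)" "y n"] tinc[of n]
      by (intro divide_right_mono mult_mono Suc) auto
    also have "\<dots> = t (Suc (Suc n)) - t (Suc n)"
      by (simp add: tS[of "Suc n"] tS[of n]) (simp add: tS field_simps)
    finally show ?case .
  qed
  \<comment> \<open>The increments of \<open>t\<close> dominate those of \<open>y\<close> and
    telescope, so convergence of \<open>t\<close> makes the iteration converge in norm.\<close>
  have "convergent t"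
  proof (rule Bseq_mono_convergent)
    show "Bseq t" by (rule BseqI'[of _ 1]) (use t01 in auto)
    show "\<forall>m n. m \<le> n \<longrightarrow> t m \<le> t n" using incseq_SucI[of t] tinc by (auto simp: incseq_def)
  qed
  then have "summable (\<lambda>n. t (Suc n) - t n)"
    using telescope_summable unfolding convergent_def by blast
  then have "summable (\<lambda>n. y (Suc n) - y n)"
    by (rule summable_comparison_test'[where N = 0]) (rule step)
  then have "convergent (\<lambda>n. \<Sum>i<n. y (Suc i) - y i)" by (simp add: summable_iff_convergent)
  then obtain l where l: "y \<longlonglongrightarrow> l"
    by (auto simp: sum_lessThan_telescope y0 convergent_def)
  have l2: "l = (1/2) *\<^sub>R (c + (l o\<^sub>L l))"
  proof (rule LIMSEQ_unique)
    show "(\<lambda>n. y (Suc n)) \<longlonglongrightarrow> l" using l by (rule LIMSEQ_Suc)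
    show "(\<lambda>n. y (Suc n)) \<longlonglongrightarrow> (1/2) *\<^sub>R (c + (l o\<^sub>L l))"
      unfolding yS by (intro tendsto_intros l bounded_bilinear.tendsto[OF bounded_bilinear_blinfun_compose])
  qed
  have nl: "norm l \<le> 1"
    by (rule LIMSEQ_le_const2[OF tendsto_norm[OF l]]) (use ny t01 order_trans in blast)
  have lim: "(\<lambda>n. y n x) \<longlonglongrightarrow> l x" for x
    by (intro bounded_linear.tendsto[OF bounded_linear_apply_blinfun] l)
  have sy: "selfadjoint (y n)" for n
  proof (induction n)
    case (Suc n)
    then show ?case
      using assms(2) by (simp add: yS c_def blinfun.bilinear_simps inner_add_left inner_add_right
          inner_diff_left inner_diff_right)
  qed (simp add: y0)
  have sl: "l u \<bullet> v = u \<bullet> l v" for u v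
  proof (rule LIMSEQ_unique)
    show "(\<lambda>n. y n u \<bullet> v) \<longlonglongrightarrow> l u \<bullet> v" by (intro tendsto_intros lim)
    show "(\<lambda>n. y n u \<bullet> v) \<longlonglongrightarrow> u \<bullet> l v" using sy by (simp add: tendsto_inner lim)
  qed
  have lc: "B o\<^sub>L l = l o\<^sub>L B" if "B o\<^sub>L A = A o\<^sub>L B" for B
  proof (rule LIMSEQ_unique)
    have "B o\<^sub>L c = c o\<^sub>L B" using that by (simp add: c_def compose_diff_left compose_diff_right)
    note * = comm[OF this]
    show "(\<lambda>n. B o\<^sub>L y n) \<longlonglongrightarrow> (B o\<^sub>L l)"
      by (intro bounded_bilinear.tendsto[OF bounded_bilinear_blinfun_compose] l tendsto_const)
    show "(\<lambda>n. B o\<^sub>L y n) \<longlonglongrightarrow> (l o\<^sub>L B)" unfolding *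
      by (intro bounded_bilinear.tendsto[OF bounded_bilinear_blinfun_compose] l tendsto_const)
  qed
  have "(2::real) *\<^sub>R l = c + (l o\<^sub>L l)" by (subst l2) simp
  then have "l o\<^sub>L l = l + l - c" by (simp add: scaleR_2)
  then have "(id_blinfun - l) o\<^sub>L (id_blinfun - l) = A"
    by (simp add: compose_diff_left compose_diff_right c_def)
  moreover have "selfadjoint (id_blinfun - l)"
    by (simp add: blinfun.diff_left inner_diff_left inner_diff_right sl)
  moreover have "0 \<le> (id_blinfun - l) x \<bullet> x" for x
  proof -
    have "l x \<bullet> x \<le> norm (l x) * norm x" by (rule norm_cauchy_schwarz)
    also have "\<dots> \<le> (1 * norm x) * norm x"
      by (intro mult_right_mono order_trans[OF norm_blinfun] nl) auto
    finally show ?thesis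
      by (simp add: blinfun.diff_left inner_diff_left dot_square_norm power2_eq_square)
  qed
  moreover have "B o\<^sub>L (id_blinfun - l) = (id_blinfun - l) o\<^sub>L B" if "B o\<^sub>L A = A o\<^sub>L B" for B
    by (simp add: compose_diff_left compose_diff_right lc[OF that])
  ultimately show ?thesis by (rule that)
qed

text \<open>Supplies the hypothesis of \<open>operator_sqrt\<close> for
  \<open>adj_op X o\<^sub>L X\<close>. With \<open>w\<close> the image of \<open>x\<close>,
  expanding the square of \<open>x - w\<close> produces \<open>- 2 (norm (X x))\<^sup>2\<close>,
  which outweighs the square of \<open>norm w \<le> norm (X x)\<close>.\<close>

lemma norm_id_minus_square_le:
  fixes X :: "'a::{real_inner,banach} \<Rightarrow>\<^sub>L 'a"
  assumes "norm X \<le> 1"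
  shows "norm (id_blinfun - (adj_op X o\<^sub>L X)) \<le> 1"
proof (rule norm_blinfun_bound)
  fix x
  have c: "norm (X z) \<le> norm z" for z
    using norm_blinfun[of X z] mult_right_mono[OF assms, of "norm z"] by simp
  have a: "norm (adj_op X z) \<le> norm z" for z
  proof -
    have "norm (adj_op X z) * norm (adj_op X z) = X (adj_op X z) \<bullet> z"
      by (simp add: adj_op power2_eq_square flip: power2_norm_eq_inner)
    also have "\<dots> \<le> norm (X (adj_op X z)) * norm z" by (rule norm_cauchy_schwarz)
    also have "\<dots> \<le> norm (adj_op X z) * norm z" by (intro mult_right_mono c) simp
    finally show ?thesis
      by (intro le_if_square_le_mult[OF _ norm_ge_zero norm_ge_zero]) (simp only: mult.commute)
  qed
  define w where "w = adj_op X (X x)"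
  have xw: "x \<bullet> w = (norm (X x))\<^sup>2" by (simp add: w_def power2_norm_eq_inner flip: adj_op)
  have "(norm (x - w))\<^sup>2 = (norm x)\<^sup>2 - 2 * (x \<bullet> w) + (norm w)\<^sup>2"
    by (simp add: power2_norm_eq_inner algebra_simps inner_commute)
  also have "(norm w)\<^sup>2 \<le> (norm (X x))\<^sup>2" unfolding w_def by (intro power_mono a) simp
  finally have "(norm (x - w))\<^sup>2 \<le> (norm x)\<^sup>2" using xw zero_le_power2[of "norm (X x)"] by linarith
  then show "norm ((id_blinfun - (adj_op X o\<^sub>L X)) x) \<le> 1 * norm x"
    by (simp add: w_def blinfun.diff_left power2_le_iff_abs_le)
qed simp

text \<open>\<open>S\<close> is the absolute value of the rescaled operator \<open>D\<close>, and
  \<open>(S + D) (S - D) = 0\<close>. On the kernel \<open>N\<close> of \<open>S + D\<close> the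
  operator \<open>D\<close> equals \<open>- S\<close>; on the orthogonal complement \<open>K\<close>
  it equals \<open>S\<close>. The invariance clause is what later places the projection onto
  \<open>K\<close> in the algebra.\<close>

lemma spectral_splitting:
  fixes C :: "'a::{real_inner,banach} \<Rightarrow>\<^sub>L 'a"
  assumes C: "selfadjoint C"
  obtains K where "subspace K" "closed K"
    "\<And>x. x \<in> K \<Longrightarrow> 0 \<le> C x \<bullet> x" "\<And>x. (\<And>k. k \<in> K \<Longrightarrow> x \<bullet> k = 0) \<Longrightarrow> C x \<bullet> x \<le> 0"
    "\<And>B x. B o\<^sub>L C = C o\<^sub>L B \<Longrightarrow> adj_op B o\<^sub>L C = C o\<^sub>L adj_op B \<Longrightarrow> x \<in> K \<Longrightarrow> B x \<in> K"
proof -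
  \<comment> \<open>Makes \<open>D\<close> a contraction; the added 1 keeps the denominator
    positive.\<close>
  define s where "s = 1 / (norm C + 1)"
  have s: "0 < s" by (simp add: s_def add_nonneg_pos)
  define D where "D = s *\<^sub>R C"
  have "norm C / (norm C + 1) \<le> 1"
    by (subst divide_le_eq_1_pos) (simp_all add: add_nonneg_pos)
  moreover have "norm D = s * norm C" using s by (simp add: D_def)
  ultimately have nD: "norm D \<le> 1" by (simp only: s_def times_divide_eq_left mult_1)
  have sD: "selfadjoint D" using C by (simp add: D_def blinfun.scaleR_left)
  have aD: "adj_op D = D" by (rule adj_op_eqI) (use sD in simp)
  have n: "norm (id_blinfun - (D o\<^sub>L D)) \<le> 1" using norm_id_minus_square_le[OF nD] aD by simp
  have sDD: "selfadjoint (D o\<^sub>L D)" using sD by (metis blinfun_apply_blinfun_compose)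
  obtain S where S: "S o\<^sub>L S = D o\<^sub>L D" "selfadjoint S" "\<And>x. 0 \<le> S x \<bullet> x"
    and Sc: "\<And>B. B o\<^sub>L (D o\<^sub>L D) = (D o\<^sub>L D) o\<^sub>L B \<Longrightarrow> B o\<^sub>L S = S o\<^sub>L B"
    by (rule operator_sqrt[OF n sDD]) blast
  have SD: "S o\<^sub>L D = D o\<^sub>L S" by (rule Sc[symmetric]) (simp add: compose_assoc)
  define N where "N = {x. S x + D x = 0}"
  define K where "K = {x. \<forall>k\<in>N. x \<bullet> k = 0}"
  have K: "subspace K" "closed K"
    unfolding K_def by (rule subspace_orthogonal_complement closed_orthogonal_complement)+
  have Ndiff: "S x - D x \<in> N" for x
  proof -
    have "S (S x) = D (D x)" "S (D x) = D (S x)"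
      using arg_cong[OF S(1), of "\<lambda>F. blinfun_apply F x"] arg_cong[OF SD, of "\<lambda>F. blinfun_apply F x"]
      by simp_all
    then show ?thesis by (simp add: N_def blinfun.bilinear_simps)
  qed
  have K1: "D x = S x" if "x \<in> K" for x
  proof -
    have "x \<bullet> (S z - D z) = 0" for z using that Ndiff by (simp add: K_def)
    then have "(S x - D x) \<bullet> z = 0" for z
      using S(2) sD by (simp add: inner_diff_left inner_diff_right)
    from this[of "S x - D x"] show ?thesis by simp
  qed
  have N: "subspace N" "closed N"
  proof -
    have "N = {x. (S + D) x = 0}" by (simp add: N_def blinfun.add_left)
    then show "subspace N" by (simp add: subspace_def blinfun.add_right blinfun.scaleR_right)
    show "closed N" unfolding N_def
      by (intro closed_Collect_eq continuous_intros)
  qed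
  \<comment> \<open>The closed subspace \<open>N\<close> is its own double orthogonal
    complement.\<close>
  have K2: "x \<in> N" if x: "\<And>k. k \<in> K \<Longrightarrow> x \<bullet> k = 0" for x
  proof -
    have "x - orth_proj N x \<in> K" using orth_proj_orthogonal[OF N] by (simp add: K_def)
    then have "x \<bullet> (x - orth_proj N x) = 0" by (rule x)
    moreover have "(x - orth_proj N x) \<bullet> orth_proj N x = 0"
      by (rule orth_proj_orthogonal[OF N orth_proj_in[OF N]])
    ultimately have "(x - orth_proj N x) \<bullet> (x - orth_proj N x) = 0"
      by (simp add: inner_diff_right inner_commute)
    then have "orth_proj N x = x" by simp
    then show ?thesis using orth_proj_in[OF N] by metis
  qed
  have CD: "C x = (1 / s) *\<^sub>R D x" for x using s by (simp add: D_def blinfun.scaleR_left)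
  show ?thesis
  proof (rule that[OF K])
    show "0 \<le> C x \<bullet> x" if "x \<in> K" for x using K1[OF that] S(3)[of x] s by (simp add: CD)
    show "C x \<bullet> x \<le> 0" if "\<And>k. k \<in> K \<Longrightarrow> x \<bullet> k = 0" for x
    proof -
      have "D x = - S x" using K2[OF that] by (simp add: N_def add_eq_0_iff)
      then show ?thesis using S(3)[of x] s by (simp add: CD)
    qed
    fix B x assume B: "B o\<^sub>L C = C o\<^sub>L B" "adj_op B o\<^sub>L C = C o\<^sub>L adj_op B" and x: "x \<in> K"
    define E where "E = adj_op B"
    have ED: "E o\<^sub>L D = D o\<^sub>L E" using B(2) by (simp add: E_def D_def compose_scaleR_left compose_scaleR_right)
    then have ES: "E o\<^sub>L S = S o\<^sub>L E" by (intro Sc) (metis compose_assoc)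
    have "E k \<in> N" if "k \<in> N" for k
    proof -
      have "E (S k + D k) = S (E k) + D (E k)"
        using arg_cong[OF ED, of "\<lambda>F. blinfun_apply F k"] arg_cong[OF ES, of "\<lambda>F. blinfun_apply F k"]
        by (simp add: blinfun.add_right)
      then show ?thesis using that by (simp add: N_def)
    qed
    then show "B x \<in> K" using x by (simp add: K_def E_def adj_op)
  qed
qed

section \<open>Bounded operators on complex Hilbert spaces and von Neumann algebras\<close>

abbreviation iC :: "'h::chilbert_space \<Rightarrow> 'h" where "iC x \<equiv> \<i> *\<^sub>C x"

lemma cinner_eq: "cinner x y = Complex (x \<bullet> y) (- (iC x \<bullet> y))"
  by (rule complex_eqI) (simp_all add: inner_cinner cinner_scaleC_left)

lemma scaleC_eq: "c *\<^sub>C x = Re c *\<^sub>R x + Im c *\<^sub>R iC x"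
proof -
  have "c = complex_of_real (Re c) + complex_of_real (Im c) * \<i>" by (simp add: complex_eq_iff)
  then have "c *\<^sub>C x = (complex_of_real (Re c) + complex_of_real (Im c) * \<i>) *\<^sub>C x" by simp
  then show ?thesis by (simp add: scaleC_add_left scaleR_scaleC scaleC_scaleC)
qed

lemma iC_iC [simp]: "iC (iC x) = - x"
  by (simp add: scaleC_scaleC scaleC_eq[of "-1"])

lemma iC_add: "iC (x + y) = iC x + iC y" by (rule scaleC_add_right)

lemma iC_scaleR: "iC (r *\<^sub>R x) = r *\<^sub>R iC x"
  by (simp add: scaleR_scaleC scaleC_scaleC mult.commute)

lemma inner_iC_left: "iC x \<bullet> y = - (x \<bullet> iC y)"
proof -
  have "cinner x (iC y) = cnj (\<i> * cinner y x)" by (subst cinner_commute) (simp add: cinner_scaleC_left)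
  also have "\<dots> = - \<i> * cinner x y" by (subst cinner_commute) simp
  finally show ?thesis by (simp add: inner_cinner cinner_scaleC_left)
qed

lemma norm_iC [simp]: "norm (iC x) = norm x"
  by (simp add: norm_eq_sqrt_inner inner_iC_left)

lemma bounded_linear_iC: "bounded_linear (iC :: 'h::chilbert_space \<Rightarrow> 'h)"
  by (rule bounded_linear_intro[where K = 1]) (auto simp: iC_add iC_scaleR)

text \<open>Multiplication by i as an element of the operator type, so that complex linearity
  becomes commutation with \<open>iop\<close>.\<close>

definition iop :: "'h::chilbert_space bop" where "iop = Blinfun iC"

lemma iop [simp]: "blinfun_apply iop x = iC x"
  by (simp add: iop_def bounded_linear_Blinfun_apply bounded_linear_iC)

lemma iC_minus: "iC (- x) = - iC x" and iC_diff: "iC (x - y) = iC x - iC y" and iC_0 [simp]: "iC 0 = 0"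
  by (metis iop blinfun.minus_right, metis iop blinfun.diff_right, metis iop blinfun.zero_right)

lemma bounded_ops_iff: "A \<in> bounded_ops \<longleftrightarrow> (\<forall>x. A (iC x) = iC (A x))"
proof
  assume *: "\<forall>x. A (iC x) = iC (A x)"
  show "A \<in> bounded_ops"
    unfolding bounded_ops_def
  proof (intro CollectI allI)
    fix c x
    have "A (c *\<^sub>C x) = A (Re c *\<^sub>R x + Im c *\<^sub>R iC x)" by (simp only: scaleC_eq[of c x])
    also have "\<dots> = Re c *\<^sub>R A x + Im c *\<^sub>R iC (A x)"
      by (simp add: blinfun.add_right blinfun.scaleR_right *)
    also have "\<dots> = c *\<^sub>C A x" by (rule scaleC_eq[symmetric])
    finally show "A (c *\<^sub>C x) = c *\<^sub>C A x" .
  qed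
qed (simp add: bounded_ops_def)

lemma iop_commute_iff: "iop o\<^sub>L A = A o\<^sub>L iop \<longleftrightarrow> A \<in> bounded_ops"
proof
  assume "iop o\<^sub>L A = A o\<^sub>L iop"
  then have "iop (A x) = A (iop x)" for x by (metis blinfun_apply_blinfun_compose)
  then show "A \<in> bounded_ops" by (simp add: bounded_ops_iff)
qed (auto intro!: blinfun_eqI simp: bounded_ops_iff)

lemma iop_in_bounded_ops: "iop \<in> bounded_ops" by (simp add: bounded_ops_iff)

lemma cinner_adj_op:
  assumes "A \<in> bounded_ops"
  shows "cinner (blinfun_apply A x) y = cinner x (adj_op A y)"
proof -
  have "iC (A x) \<bullet> y = iC x \<bullet> adj_op A y" using assms by (simp add: bounded_ops_iff flip: adj_op)
  then show ?thesis by (simp add: cinner_eq adj_op)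
qed

text \<open>For complex-linear \<open>A\<close> the adjoint for the real inner product satisfies the
  complex identity too, and real parts alone already determine it; so the definite description is
  meaningful.\<close>

lemma bop_adj_eq:
  assumes "A \<in> bounded_ops"
  shows "bop_adj A = adj_op A"
  unfolding bop_adj_def
proof (rule the_equality)
  show "\<forall>x y. cinner (A x) y = cinner x (adj_op A y)" using cinner_adj_op[OF assms] by blast
  fix B assume *: "\<forall>x y. cinner (blinfun_apply A x) y = cinner x (blinfun_apply B y)"
  show "B = adj_op A" by (rule adj_op_eqI[symmetric]) (simp add: inner_cinner *)
qed

lemma adj_op_bounded_ops:
  assumes "A \<in> bounded_ops"
  shows "adj_op A \<in> bounded_ops"
  unfolding bounded_ops_iff
proof
  fix y
  have "x \<bullet> adj_op A (iC y) = x \<bullet> iC (adj_op A y)" for x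
  proof -
    have "x \<bullet> adj_op A (iC y) = - (iC (A x) \<bullet> y)" by (simp add: inner_iC_left flip: adj_op)
    also have "\<dots> = - (A (iC x) \<bullet> y)" using assms by (simp add: bounded_ops_iff)
    also have "\<dots> = - (iC x \<bullet> adj_op A y)" by (simp add: adj_op)
    finally show ?thesis by (simp add: inner_iC_left)
  qed
  then show "adj_op A (iC y) = iC (adj_op A y)" by (metis vector_eq_ldot)
qed

lemma adj_op_adj_op [simp]: "adj_op (adj_op A) = A"
  by (rule adj_op_eqI) (metis adj_op inner_commute)

lemma adj_op_add: "adj_op (A + B) = adj_op A + adj_op B"
  and adj_op_diff: "adj_op (A - B) = adj_op A - adj_op B"
  and adj_op_scaleR: "adj_op (r *\<^sub>R A) = r *\<^sub>R adj_op A"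
  and adj_op_compose: "adj_op (A o\<^sub>L C) = adj_op C o\<^sub>L adj_op A"
  by (rule adj_op_eqI, simp add: blinfun.bilinear_simps inner_add_left inner_add_right
      inner_diff_left inner_diff_right adj_op)+

lemma adj_op_selfadjoint: "adj_op A = A \<longleftrightarrow> selfadjoint A"
  using adj_op_eqI[of A A] adj_op[of A] by metis

lemma adj_op_iop: "adj_op iop = - iop"
  by (rule adj_op_eqI) (simp add: inner_iC_left blinfun.minus_left)

text \<open>A complex quadratic form with real values polarises to a symmetric operator; positivity
  of the form therefore brings self-adjointness with it.\<close>

lemma bop_pos_iff: "bop_pos A \<longleftrightarrow> A \<in> bounded_ops \<and> selfadjoint A \<and> (\<forall>x. 0 \<le> A x \<bullet> x)"
proof
  assume "bop_pos A"
  then have b: "A \<in> bounded_ops" and "\<And>x. cinner (A x) x \<in> \<real>\<^sub>\<ge>\<^sub>0" by (auto simp: bop_pos_def)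
  then have z: "iC (A x) \<bullet> x = 0" and p: "0 \<le> A x \<bullet> x" for x
    by (auto simp: cinner_eq complex_nonneg_Reals_iff)
  \<comment> \<open>Polarisation of \<open>z\<close>; inserting a multiple by i in the second
    argument turns it into symmetry of \<open>A\<close>.\<close>
  have "iC (A x) \<bullet> y = - (iC (A y) \<bullet> x)" for x y
    using z[of "x + y"] z[of x] z[of y] by (simp add: blinfun.add_right iC_add inner_add_left inner_add_right)
  from this[of _ "iC _"] have "A x \<bullet> y = x \<bullet> A y" for x y
    using b by (simp add: inner_iC_left bounded_ops_iff inner_commute)
  then show "A \<in> bounded_ops \<and> selfadjoint A \<and> (\<forall>x. 0 \<le> A x \<bullet> x)" using b p by blast
next
  assume *: "A \<in> bounded_ops \<and> selfadjoint A \<and> (\<forall>x. 0 \<le> A x \<bullet> x)"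
  have "iC (A x) \<bullet> x = 0" for x
  proof -
    have "iC (A x) \<bullet> x = A (iC x) \<bullet> x" using * by (simp add: bounded_ops_iff)
    also have "\<dots> = iC x \<bullet> A x" using * by blast
    also have "\<dots> = - (x \<bullet> iC (A x))" by (rule inner_iC_left)
    also have "x \<bullet> iC (A x) = iC (A x) \<bullet> x" by (rule inner_commute)
    finally show ?thesis by simp
  qed
  then show "bop_pos A" using * by (auto simp: bop_pos_def cinner_eq complex_nonneg_Reals_iff)
qed

lemma blinfun_eq_on_dense:
  fixes F G :: "'a::real_normed_vector \<Rightarrow>\<^sub>L 'b::real_normed_vector"
  assumes "closure D = UNIV" "\<And>x. x \<in> D \<Longrightarrow> F x = G x"
  shows "F = G"
proof (rule blinfun_eqI)
  fix x
  have "closed {x. F x = G x}" by (intro closed_Collect_eq continuous_intros)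
  then have "closure D \<subseteq> {x. F x = G x}" using assms(2) by (intro closure_minimal) auto
  then show "F x = G x" using assms(1) by blast
qed

section \<open>Membership, projections and their order in a von Neumann algebra\<close>

locale vna =
  fixes M :: "'h::chilbert_space bop set"
  assumes vna: "von_neumann_algebra M"
begin

lemma in_bounded_ops: "A \<in> M \<Longrightarrow> A \<in> bounded_ops"
  using vna by (auto simp: von_neumann_algebra_def)

lemma iC_commute: "A \<in> M \<Longrightarrow> A (iC x) = iC (A x)"
  using in_bounded_ops bounded_ops_iff by blast

lemma adj_mem: "A \<in> M \<Longrightarrow> adj_op A \<in> M"
  using vna bop_adj_eq[OF in_bounded_ops, of A] by (auto simp: von_neumann_algebra_def)

lemma commutant_commute:
  assumes "A \<in> M" "B \<in> commutant M"
  shows "A (B x) = B (A x)"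
proof -
  have "A o\<^sub>L B = B o\<^sub>L A" using assms by (simp add: commutant_def)
  then have "(A o\<^sub>L B) x = (B o\<^sub>L A) x" by simp
  then show ?thesis by simp
qed

lemma iop_in_commutant: "iop \<in> commutant M"
  unfolding commutant_def
  using iop_in_bounded_ops iop_commute_iff[THEN iffD2, OF in_bounded_ops, symmetric] by blast

lemma adj_in_commutant:
  assumes "B \<in> commutant M"
  shows "adj_op B \<in> commutant M"
  unfolding commutant_def
proof safe
  show "adj_op B \<in> bounded_ops" using assms by (simp add: commutant_def adj_op_bounded_ops)
  fix A assume "A \<in> M"
  then have "adj_op A o\<^sub>L B = B o\<^sub>L adj_op A" using assms adj_mem by (simp add: commutant_def)
  then have "adj_op (adj_op A o\<^sub>L B) = adj_op (B o\<^sub>L adj_op A)" by simp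
  then show "A o\<^sub>L adj_op B = adj_op B o\<^sub>L A" by (simp add: adj_op_compose)
qed

text \<open>The bicommutant property without a separate linearity check: \<open>iop\<close> is in
  the commutant, so an operator commuting with the commutant is complex linear.\<close>

lemma memI:
  fixes A :: "'h bop"
  assumes "\<And>B x. B \<in> commutant M \<Longrightarrow> A (B x) = B (A x)"
  shows "A \<in> M"
proof -
  have "A \<in> bounded_ops" using assms[OF iop_in_commutant] by (simp add: bounded_ops_iff)
  then have "A \<in> commutant (commutant M)"
    unfolding commutant_def[of "commutant M"] using assms by (auto intro!: blinfun_eqI)
  then show ?thesis using vna by (simp add: von_neumann_algebra_def)
qed

lemma
  shows compose_mem: "A \<in> M \<Longrightarrow> B \<in> M \<Longrightarrow> A o\<^sub>L B \<in> M"
    and diff_mem: "A \<in> M \<Longrightarrow> B \<in> M \<Longrightarrow> A - B \<in> M"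
    and scaleR_mem: "A \<in> M \<Longrightarrow> r *\<^sub>R A \<in> M"
    and id_mem: "id_blinfun \<in> M"
    and zero_mem: "0 \<in> M"
  by (rule memI, simp add: blinfun.bilinear_simps commutant_commute)+

lemma positive_part_iff: "A \<in> positive_part M \<longleftrightarrow> A \<in> M \<and> selfadjoint A \<and> (\<forall>x. 0 \<le> A x \<bullet> x)"
  using in_bounded_ops by (auto simp: positive_part_def bop_pos_iff)

lemma bop_le_iff:
  assumes "A \<in> M" "B \<in> M" "selfadjoint A" "selfadjoint B"
  shows "bop_le A B \<longleftrightarrow> (\<forall>x. A x \<bullet> x \<le> B x \<bullet> x)"
  using assms in_bounded_ops[OF diff_mem[OF assms(2,1)]]
  by (simp add: bop_le_def bop_pos_iff blinfun.diff_left inner_diff_left inner_diff_right)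

lemma projections_iff: "P \<in> projections M \<longleftrightarrow> P \<in> M \<and> (\<forall>x. P (P x) = P x) \<and> selfadjoint P"
proof (cases "P \<in> M")
  case True
  have "P o\<^sub>L P = P \<longleftrightarrow> (\<forall>x. P (P x) = P x)" by (metis blinfun_eqI blinfun_apply_blinfun_compose)
  then show ?thesis
    using True bop_adj_eq[OF in_bounded_ops[OF True]] adj_op_selfadjoint[of P]
    by (simp add: projections_def)
qed (simp add: projections_def)

lemma
  assumes "P \<in> projections M"
  shows proj_mem: "P \<in> M" and proj_idem [simp]: "P (P x) = P x" and proj_selfadjoint: "selfadjoint P"
    and proj_inner: "P x \<bullet> x = (norm (P x))\<^sup>2"
    and proj_inner_le: "P x \<bullet> x \<le> x \<bullet> x"
    and proj_norm_le: "norm (P x) \<le> norm x"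
proof -
  show 1: "P \<in> M" "\<And>x. P (P x) = P x" "selfadjoint P" using assms by (auto simp: projections_iff)
  have 2: "P x \<bullet> x = P x \<bullet> P x" for x using 1 by metis
  then show "P x \<bullet> x = (norm (P x))\<^sup>2" by (simp add: power2_norm_eq_inner)
  have "0 \<le> (x - P x) \<bullet> (x - P x)" by simp
  then show "P x \<bullet> x \<le> x \<bullet> x" using 2[of x] by (simp add: inner_diff_left inner_diff_right inner_commute)
  then have "(norm (P x))\<^sup>2 \<le> (norm x)\<^sup>2" using 2[of x] by (simp add: power2_norm_eq_inner)
  then show "norm (P x) \<le> norm x" by (simp add: power2_le_iff_abs_le)
qed

lemma proj_positive: "P \<in> projections M \<Longrightarrow> P \<in> positive_part M"
  unfolding positive_part_iff
  by (intro conjI proj_mem proj_selfadjoint, assumption, assumption) (simp add: proj_inner)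

text \<open>Evaluating the order at \<open>P x\<close> shows that \<open>P x - Q (P x)\<close> has
  norm 0; taking adjoints exchanges the two characterisations.\<close>

lemma proj_le_iff:
  assumes "P \<in> projections M" "Q \<in> projections M"
  shows "bop_le P Q \<longleftrightarrow> (\<forall>x. Q (P x) = P x)" and "bop_le P Q \<longleftrightarrow> (\<forall>x. P (Q x) = P x)"
proof -
  note P = proj_mem[OF assms(1)] proj_selfadjoint[OF assms(1)] proj_idem[OF assms(1)]
  note Q = proj_mem[OF assms(2)] proj_selfadjoint[OF assms(2)] proj_idem[OF assms(2)]
  note le = bop_le_iff[OF P(1) Q(1) P(2) Q(2)]
  have 1: "Q (P x) = P x" if "bop_le P Q" for x
  proof -
    have "P (P x) \<bullet> P x \<le> Q (P x) \<bullet> P x" using that le by blast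
    then have "P x \<bullet> P x \<le> Q (P x) \<bullet> P x" by (simp add: P)
    moreover have "Q (P x) \<bullet> P x = Q (P x) \<bullet> Q (P x)" using Q by metis
    ultimately have "(P x - Q (P x)) \<bullet> (P x - Q (P x)) \<le> 0"
      by (simp add: inner_diff_left inner_diff_right inner_commute)
    then show ?thesis by (metis eq_iff_diff_eq_0 inner_eq_zero_iff inner_ge_zero order_antisym)
  qed
  have 2: "(\<forall>x. P (Q x) = P x) \<longleftrightarrow> (\<forall>x. Q (P x) = P x)"
  proof -
    have "(\<forall>x. P (Q x) = P x) \<longleftrightarrow> (\<forall>x y. P (Q x) \<bullet> y = P x \<bullet> y)" by (metis vector_eq_rdot)
    also have "\<dots> \<longleftrightarrow> (\<forall>x y. x \<bullet> Q (P y) = x \<bullet> P y)" using P(2) Q(2) by metis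
    also have "\<dots> \<longleftrightarrow> (\<forall>y. Q (P y) = P y)" by (metis vector_eq_ldot)
    finally show ?thesis .
  qed
  have 3: "bop_le P Q" if *: "\<forall>x. P (Q x) = P x"
    unfolding le
  proof
    fix x
    have "P x \<bullet> x = P (Q x) \<bullet> Q x" using * P(2) Q(2) 2 by metis
    also have "\<dots> \<le> Q x \<bullet> Q x" by (rule proj_inner_le[OF assms(1)])
    also have "\<dots> = Q x \<bullet> x" using Q by metis
    finally show "P x \<bullet> x \<le> Q x \<bullet> x" .
  qed
  show "bop_le P Q \<longleftrightarrow> (\<forall>x. Q (P x) = P x)" "bop_le P Q \<longleftrightarrow> (\<forall>x. P (Q x) = P x)"
    using 1 2 3 by blast+
qed

text \<open>The commutant is closed under adjoints, so an invariant subspace reduces it and the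
  projection commutes with the whole commutant.\<close>

lemma orth_proj_in_projections:
  assumes K: "subspace K" "closed K" and inv: "\<And>B x. B \<in> commutant M \<Longrightarrow> x \<in> K \<Longrightarrow> B x \<in> K"
  shows "orth_proj K \<in> projections M"
  unfolding projections_iff
proof (intro conjI allI)
  show "orth_proj K x \<bullet> y = x \<bullet> orth_proj K y" for x y by (rule orth_proj_selfadjoint[OF K])
  show "orth_proj K (orth_proj K x) = orth_proj K x" for x
    by (simp add: orth_proj_eq_self_iff[OF K] orth_proj_in[OF K])
  show "orth_proj K \<in> M"
  proof (rule memI)
    fix B x assume B: "B \<in> commutant M"
    show "orth_proj K (B x) = B (orth_proj K x)"
    proof (rule orth_proj_unique[OF K])
      show "B (orth_proj K x) \<in> K" by (intro inv B orth_proj_in K)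
      fix k assume "k \<in> K"
      then have "(x - orth_proj K x) \<bullet> adj_op B k = 0"
        by (intro orth_proj_orthogonal[OF K] inv adj_in_commutant B)
      then show "(B x - B (orth_proj K x)) \<bullet> k = 0" by (simp add: blinfun.diff_right flip: adj_op)
    qed
  qed
qed

lemma proj_complement: "P \<in> projections M \<Longrightarrow> id_blinfun - P \<in> projections M"
  by (simp add: projections_iff diff_mem id_mem blinfun.bilinear_simps inner_diff_left inner_diff_right)

lemma id_proj: "id_blinfun \<in> projections M" and zero_proj: "0 \<in> projections M"
  by (simp_all add: projections_iff id_mem zero_mem)

lemma proj_diff:
  assumes "P \<in> projections M" "Q \<in> projections M" "bop_le P Q"
  shows "Q - P \<in> projections M"
  using assms proj_le_iff[OF assms(1,2)]
  by (simp add: projections_iff diff_mem blinfun.bilinear_simps inner_diff_left inner_diff_right)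

lemma projections_eqI:
  assumes "P \<in> projections M" "Q \<in> projections M" "bop_le P Q" "bop_le Q P"
  shows "P = Q"
  using assms proj_le_iff[OF assms(1,2)] proj_le_iff[OF assms(2,1)] by (metis blinfun_eqI)

text \<open>Constructed as the complement of the projection onto the common kernel; the kernel
  clause is the form in which joins are fed to \<open>trace_le_if_injective\<close>.\<close>

lemma proj_join:
  assumes P: "P \<in> projections M" and Q: "Q \<in> projections M"
  obtains J where "J \<in> projections M" "bop_le P J" "bop_le Q J"
    "\<And>x. P x = 0 \<Longrightarrow> Q x = 0 \<Longrightarrow> J x = 0"
proof -
  define K where "K = {x. P x = 0 \<and> Q x = 0}"
  have K: "subspace K" "closed K"
    unfolding K_def
    by (simp_all add: subspace_def blinfun.bilinear_simps)
      (intro closed_Collect_conj closed_Collect_eq continuous_intros)+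
  have R: "orth_proj K \<in> projections M"
    by (rule orth_proj_in_projections[OF K])
      (auto simp: K_def commutant_commute proj_mem P Q)
  let ?J = "id_blinfun - orth_proj K"
  have J: "?J \<in> projections M" by (rule proj_complement[OF R])
  show ?thesis
  proof (rule that[OF J])
    show "bop_le P ?J" "bop_le Q ?J"
      unfolding proj_le_iff(2)[OF P J] proj_le_iff(2)[OF Q J]
      using orth_proj_in[OF K, unfolded K_def] by (simp_all add: blinfun.bilinear_simps K_def)
    fix x assume "P x = 0" "Q x = 0"
    then have "orth_proj K x = x" using orth_proj_eq_self_iff[OF K] by (simp add: K_def)
    then show "?J x = 0" by (simp add: blinfun.diff_left)
  qed
qed

lemma proj_meet:
  assumes P: "P \<in> projections M" and Q: "Q \<in> projections M"
  obtains R where "R \<in> projections M" "bop_le R P" "bop_le R Q"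
    "\<And>x. P x = x \<Longrightarrow> Q x = x \<Longrightarrow> R x = x"
proof -
  define K where "K = {x. P x = x \<and> Q x = x}"
  have K: "subspace K" "closed K"
    unfolding K_def
    by (simp_all add: subspace_def blinfun.bilinear_simps)
      (intro closed_Collect_conj closed_Collect_eq continuous_intros)+
  have R: "orth_proj K \<in> projections M"
    by (rule orth_proj_in_projections[OF K])
      (auto simp: K_def commutant_commute proj_mem P Q)
  show ?thesis
  proof (rule that[OF R])
    show "bop_le (orth_proj K) P" "bop_le (orth_proj K) Q"
      unfolding proj_le_iff(1)[OF R P] proj_le_iff(1)[OF R Q]
      using orth_proj_in[OF K, unfolded K_def] by (simp_all add: K_def)
    show "orth_proj K x = x" if "P x = x" "Q x = x" for x
      using orth_proj_eq_self_iff[OF K] that by (simp add: K_def)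
  qed
qed

text \<open>The commutant preserves the subspace from \<open>spectral_splitting\<close>, which puts
  the projection in \<open>M\<close>. The self-adjoint \<open>C\<close> preserves it as well and
  hence commutes with the projection.\<close>

lemma spectral_projection:
  assumes C: "C \<in> M" "selfadjoint C"
  obtains e where "e \<in> projections M" "\<And>x. C (e x) = e (C x)"
    "\<And>x. e x = x \<Longrightarrow> 0 \<le> C x \<bullet> x" "\<And>x. e x = 0 \<Longrightarrow> C x \<bullet> x \<le> 0"
proof -
  obtain K where K: "subspace K" "closed K"
    and pos: "\<And>x. x \<in> K \<Longrightarrow> 0 \<le> C x \<bullet> x" and neg: "\<And>x. (\<And>k. k \<in> K \<Longrightarrow> x \<bullet> k = 0) \<Longrightarrow> C x \<bullet> x \<le> 0"
    and inv: "\<And>B x. B o\<^sub>L C = C o\<^sub>L B \<Longrightarrow> adj_op B o\<^sub>L C = C o\<^sub>L adj_op B \<Longrightarrow> x \<in> K \<Longrightarrow> B x \<in> K"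
    using spectral_splitting[OF C(2)] by metis
  have e: "orth_proj K \<in> projections M"
  proof (rule orth_proj_in_projections[OF K])
    fix B x assume B: "B \<in> commutant M" and x: "x \<in> K"
    have "B o\<^sub>L C = C o\<^sub>L B" "adj_op B o\<^sub>L C = C o\<^sub>L adj_op B"
      using B adj_in_commutant[OF B] C(1) by (simp_all add: commutant_def)
    then show "B x \<in> K" using x by (rule inv)
  qed
  have aC: "adj_op C = C" using C(2) by (simp add: adj_op_selfadjoint)
  have CK: "C k \<in> K" if "k \<in> K" for k using inv[of C k] that by (simp add: aC)
  have "orth_proj K (C x) = C (orth_proj K x)" for x
  proof (rule orth_proj_unique[OF K])
    show "C (orth_proj K x) \<in> K" by (intro CK orth_proj_in K)
    show "(C x - C (orth_proj K x)) \<bullet> k = 0" if "k \<in> K" for k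
      using orth_proj_orthogonal[OF K CK[OF that]] C(2) by (simp add: inner_diff_left)
  qed
  then show ?thesis
    by (intro that[OF e]) (simp_all add: orth_proj_eq_self_iff[OF K] orth_proj_eq_0_iff[OF K] pos neg)
qed

end

section \<open>Traces on projections\<close>

locale traced_vna = vna M for M :: "'h::chilbert_space bop set" +
  fixes \<tau> :: "'h bop \<Rightarrow> ennreal"
  assumes trace: "is_trace M \<tau>" and faithful: "faithful_trace M \<tau>"
    and normal: "normal_trace M \<tau>" and semifinite: "semifinite_trace M \<tau>"
begin

lemma trace_add: "A \<in> positive_part M \<Longrightarrow> B \<in> positive_part M \<Longrightarrow> \<tau> (A + B) = \<tau> A + \<tau> B"
  using trace by (simp add: is_trace_def)

lemma trace_scaleR: "A \<in> positive_part M \<Longrightarrow> 0 \<le> c \<Longrightarrow> \<tau> (c *\<^sub>R A) = ennreal c * \<tau> A"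
  using trace by (simp add: is_trace_def)

lemma trace_adj: "A \<in> M \<Longrightarrow> \<tau> (adj_op A o\<^sub>L A) = \<tau> (A o\<^sub>L adj_op A)"
  using trace bop_adj_eq[OF in_bounded_ops] by (metis is_trace_def)

lemma trace_mono:
  assumes "A \<in> positive_part M" "B \<in> positive_part M" "\<And>x. A x \<bullet> x \<le> B x \<bullet> x"
  shows "\<tau> A \<le> \<tau> B"
proof -
  have "B - A \<in> positive_part M"
    using assms unfolding positive_part_iff
    by (simp add: diff_mem blinfun.diff_left inner_diff_left inner_diff_right)
  then have "\<tau> (A + (B - A)) = \<tau> A + \<tau> (B - A)" by (intro trace_add assms)
  then show ?thesis by simp
qed

lemma trace_0: "\<tau> 0 = 0"
proof -
  have "(0::'h bop) \<in> positive_part M" by (rule proj_positive[OF zero_proj])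
  from trace_scaleR[OF this, of 0] show ?thesis by simp
qed

lemma trace_proj_mono:
  assumes "P \<in> projections M" "Q \<in> projections M" "bop_le P Q"
  shows "\<tau> P \<le> \<tau> Q"
proof (intro trace_mono proj_positive assms)
  show "P x \<bullet> x \<le> Q x \<bullet> x" for x
    using assms bop_le_iff[OF proj_mem proj_mem proj_selfadjoint proj_selfadjoint, OF assms(1,2,1,2)] by blast
qed

lemma trace_proj_diff:
  assumes "P \<in> projections M" "Q \<in> projections M" "bop_le P Q"
  shows "\<tau> Q = \<tau> P + \<tau> (Q - P)"
  using trace_add[OF proj_positive[OF assms(1)] proj_positive[OF proj_diff[OF assms]]] by simp

lemma proj_eq_0_if_trace_0: "P \<in> projections M \<Longrightarrow> \<tau> P = 0 \<Longrightarrow> P = 0"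
  using faithful proj_positive by (auto simp: faithful_trace_def)

text \<open>The polar decomposition \<open>X r = V \<bar>X r\<bar>\<close> makes \<open>r = V\<^sup>* V\<close> equivalent to the subprojection
  \<open>V V\<^sup>*\<close> of \<open>p\<close>.\<close>

lemma trace_le_if_injective:
  assumes X: "X \<in> M" and p: "p \<in> projections M" and r: "r \<in> projections M"
    and pX: "\<And>x. p (X x) = X x" and inj: "\<And>x. r x = x \<Longrightarrow> X x = 0 \<Longrightarrow> x = 0"
  shows "\<tau> r \<le> \<tau> p"
proof -
  note r_simps = proj_idem[OF r]
  \<comment> \<open>Rescaling makes \<open>Y\<close> a contraction, as
    \<open>norm_id_minus_square_le\<close> requires, without changing the kernel.\<close>
  define s where "s = 1 / (norm (X o\<^sub>L r) + 1)"
  have s: "0 < s" by (simp add: s_def add_nonneg_pos)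
  define Y where "Y = s *\<^sub>R (X o\<^sub>L r)"
  have Y: "Y \<in> M" unfolding Y_def by (intro scaleR_mem compose_mem X proj_mem r)
  have nY: "norm Y \<le> 1"
  proof -
    have "norm Y = norm (X o\<^sub>L r) / (norm (X o\<^sub>L r) + 1)" using s by (simp add: Y_def s_def)
    also have "\<dots> \<le> 1" by (subst divide_le_eq_1_pos) (simp_all add: add_nonneg_pos)
    finally show ?thesis .
  qed
  have Y0: "Y x = 0 \<longleftrightarrow> r x = 0" for x
    using inj[of "r x"] s r_simps by (auto simp: Y_def blinfun.scaleR_left)
  have pY: "p (Y x) = Y x" for x by (simp add: Y_def blinfun.scaleR_left blinfun.scaleR_right pX)
  \<comment> \<open>The square root \<open>S\<close> of \<open>A\<close> is the absolute value of
    \<open>Y\<close>.\<close>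
  define A where "A = adj_op Y o\<^sub>L Y"
  have A: "A \<in> M" unfolding A_def by (intro compose_mem adj_mem Y)
  have Axy: "A x \<bullet> y = Y x \<bullet> Y y" for x y
    using adj_op[of "adj_op Y" "Y x" y] by (simp add: A_def)
  have sA: "selfadjoint A" using Axy by (metis inner_commute)
  obtain S where S: "S o\<^sub>L S = A" "selfadjoint S"
    and Sc: "\<And>B. B o\<^sub>L A = A o\<^sub>L B \<Longrightarrow> B o\<^sub>L S = S o\<^sub>L B"
    by (rule operator_sqrt[OF norm_id_minus_square_le[OF nY, folded A_def] sA]) blast
  have SB: "S (B x) = B (S x)" if "B \<in> commutant M" for B x
  proof -
    have "B o\<^sub>L S = S o\<^sub>L B" by (rule Sc) (use that A in \<open>simp add: commutant_def\<close>)
    then have "(B o\<^sub>L S) x = (S o\<^sub>L B) x" by simp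
    then show ?thesis by simp
  qed
  have SS: "S x \<bullet> S y = Y x \<bullet> Y y" for x y
  proof -
    have "S x \<bullet> S y = S (S x) \<bullet> y" using S(2) by simp
    also have "S (S x) = A x" using S(1) by auto
    finally show ?thesis by (simp add: Axy)
  qed
  have S0: "S x = 0 \<longleftrightarrow> r x = 0" for x
    using SS[of x x] Y0[of x] by (metis inner_eq_zero_iff)
  \<comment> \<open>\<open>S\<close> is self-adjoint with the same kernel as \<open>r\<close>, so
    its values are orthogonal to that kernel.\<close>
  have rS: "r (S x) = S x" for x
  proof -
    have "r (S x - r (S x)) = 0" by (simp add: blinfun.diff_right r_simps)
    then have "S (S x - r (S x)) = 0" by (simp add: S0)
    then have "(S x - r (S x)) \<bullet> S x = 0" using S(2) by (metis inner_zero_left)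
    moreover have "(S x - r (S x)) \<bullet> r (S x) = 0"
      using proj_selfadjoint[OF r] \<open>r (S x - r (S x)) = 0\<close> by (metis inner_zero_left)
    ultimately have "(S x - r (S x)) \<bullet> (S x - r (S x)) = 0" by (simp add: inner_diff_right)
    then show ?thesis by simp
  qed
  \<comment> \<open>\<open>L\<close> is the graph of the partial isometry on \<open>D\<close> that
    sends \<open>S x\<close> to \<open>Y x\<close> and the kernel of \<open>r\<close> to 0.
    \<open>D\<close> is dense, since a vector orthogonal to the range of \<open>S\<close> lies in
    the kernel of \<open>r\<close>. \<open>L\<close> is contractive, since \<open>S x\<close> and
    \<open>Y x\<close> have equal norms and \<open>S x\<close> is orthogonal to
    \<open>z\<close>.\<close>
  define D where "D = {S x + z | x z. r z = 0}"
  define L where "L = {(S x + z, Y x) | x z. r z = 0}"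
  have D: "subspace D" unfolding subspace_def
  proof (intro conjI ballI allI)
    show "0 \<in> D" unfolding D_def by (intro CollectI exI[of _ 0]) simp
    fix u assume "u \<in> D"
    then obtain x z where u: "u = S x + z" "r z = 0" by (auto simp: D_def)
    show "c *\<^sub>R u \<in> D" for c unfolding D_def
      by (intro CollectI exI[of _ "c *\<^sub>R x"] exI[of _ "c *\<^sub>R z"])
        (simp add: u blinfun.scaleR_right scaleR_add_right)
    fix v assume "v \<in> D"
    then obtain y w where v: "v = S y + w" "r w = 0" by (auto simp: D_def)
    show "u + v \<in> D" unfolding D_def
      by (intro CollectI exI[of _ "x + y"] exI[of _ "z + w"]) (simp add: u v blinfun.add_right)
  qed
  have L: "subspace L" unfolding subspace_def
  proof (intro conjI ballI allI)
    show "0 \<in> L" unfolding L_def by (intro CollectI exI[of _ 0]) (simp add: zero_prod_def)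
    fix u assume "u \<in> L"
    then obtain x z where u: "u = (S x + z, Y x)" "r z = 0" by (auto simp: L_def)
    show "c *\<^sub>R u \<in> L" for c unfolding L_def
      by (intro CollectI exI[of _ "c *\<^sub>R x"] exI[of _ "c *\<^sub>R z"])
        (simp add: u blinfun.scaleR_right scaleR_add_right)
    fix v assume "v \<in> L"
    then obtain y w where v: "v = (S y + w, Y y)" "r w = 0" by (auto simp: L_def)
    show "u + v \<in> L" unfolding L_def
      by (intro CollectI exI[of _ "x + y"] exI[of _ "z + w"]) (simp add: u v blinfun.add_right)
  qed
  have Dperp: "w = 0" if w: "\<And>k. k \<in> D \<Longrightarrow> w \<bullet> k = 0" for w
  proof -
    have "S x \<in> D" for x unfolding D_def by (intro CollectI exI[of _ x] exI[of _ 0]) simp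
    then have "w \<bullet> S (S w) = 0" by (rule w)
    then have "S w \<bullet> S w = 0" using S(2) by metis
    then have "r w = 0" by (simp add: S0)
    then have "w \<in> D" unfolding D_def by (intro CollectI exI[of _ 0] exI[of _ w]) simp
    then show ?thesis using w[of w] by simp
  qed
  have Ddense: "closure D = UNIV" by (rule dense_if_orthogonal_trivial[OF D Dperp])
  have "norm v \<le> norm u" if uv: "(u, v) \<in> L" for u v
  proof -
    obtain x z where u: "u = S x + z" "v = Y x" "r z = 0" using uv by (auto simp: L_def)
    have "S x \<bullet> z = 0" using S(2) u(3) S0 by (metis inner_zero_right)
    then have "u \<bullet> u = v \<bullet> v + z \<bullet> z" by (simp add: u inner_add_left inner_add_right inner_commute SS)
    then show ?thesis by (simp add: norm_le)
  qed
  then have "L \<subseteq> {p. norm (snd p) \<le> norm (fst p)}" by auto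
  then have "closure L \<subseteq> {p. norm (snd p) \<le> norm (fst p)}"
    by (intro closure_minimal closed_Collect_le continuous_intros)
  then have bd: "norm v \<le> 1 * norm u" if "(u, v) \<in> closure L" for u v using that by auto
  have "D \<subseteq> fst ` closure L"
  proof
    fix u assume "u \<in> D"
    then obtain x z where "u = S x + z" "r z = 0" by (auto simp: D_def)
    then have "(u, Y x) \<in> L" by (auto simp: L_def)
    then show "u \<in> fst ` closure L" using closure_subset by force
  qed
  then have "closure (fst ` closure L) = UNIV" using Ddense closure_mono by blast
  then obtain V where V: "\<And>u v. (u, v) \<in> closure L \<longleftrightarrow> v = blinfun_apply V u"
    using graph_of_bounded_operator[OF subspace_closure[OF L] closed_closure bd] by metis
  have VS: "V (S x + z) = Y x" if "r z = 0" for x z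
  proof -
    have "(S x + z, Y x) \<in> closure L" using that closure_subset by (fastforce simp: L_def)
    then show ?thesis by (simp add: V)
  qed
  have VS0: "V (S x) = Y x" for x using VS[of 0 x] by simp
  have V0: "V z = 0" if "r z = 0" for z using VS[OF that, of 0] by simp
  have nV: "norm (V u) \<le> norm u" for u using bd[of u "V u"] V by simp
  have VM: "V \<in> M"
  proof (rule memI)
    fix B x assume B: "B \<in> commutant M"
    have "V o\<^sub>L B = B o\<^sub>L V"
    proof (rule blinfun_eq_on_dense[OF Ddense])
      fix u assume "u \<in> D"
      then obtain x z where u: "u = S x + z" "r z = 0" by (auto simp: D_def)
      have "r (B z) = 0" using u commutant_commute[OF proj_mem[OF r] B] by simp
      then show "(V o\<^sub>L B) u = (B o\<^sub>L V) u"
        by (simp add: u blinfun.add_right VS0 V0 commutant_commute[OF Y B] flip: SB[OF B])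
    qed
    then have "(V o\<^sub>L B) x = (B o\<^sub>L V) x" by simp
    then show "V (B x) = B (V x)" by simp
  qed
  \<comment> \<open>Tested against the dense set \<open>D\<close>; this is what identifies
    \<open>adj_op V o\<^sub>L V\<close> as \<open>r\<close>.\<close>
  have aVY: "adj_op V (Y x) = S x" for x
  proof -
    have "(adj_op V (Y x) - S x) \<bullet> k = 0" if k: "k \<in> D" for k
    proof -
      obtain y z where k: "k = S y + z" "r z = 0" using k by (auto simp: D_def)
      have "adj_op V (Y x) \<bullet> k = Y x \<bullet> V k" using adj_op[of "adj_op V"] by simp
      also have "V k = Y y" by (simp only: k VS)
      also have "Y x \<bullet> Y y = S x \<bullet> k"
      proof -
        have "S x \<bullet> z = 0" using S(2) S0 k(2) by (metis inner_zero_right)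
        then show ?thesis by (simp add: k(1) inner_add_right SS)
      qed
      finally show ?thesis by (simp add: inner_diff_left)
    qed
    then have "adj_op V (Y x) - S x = 0" by (rule Dperp)
    then show ?thesis by simp
  qed
  have VV: "adj_op V o\<^sub>L V = r"
  proof (rule blinfun_eq_on_dense[OF Ddense])
    fix u assume "u \<in> D"
    then obtain x z where u: "u = S x + z" "r z = 0" by (auto simp: D_def)
    show "(adj_op V o\<^sub>L V) u = r u" using u(2) by (simp add: u(1) VS0 V0 aVY blinfun.add_right rS)
  qed
  have "p o\<^sub>L V = V"
  proof (rule blinfun_eq_on_dense[OF Ddense])
    fix u assume "u \<in> D"
    then obtain x z where u: "u = S x + z" "r z = 0" by (auto simp: D_def)
    show "(p o\<^sub>L V) u = V u" by (simp add: u blinfun.add_right VS0 V0 pY)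
  qed
  then have "adj_op (p o\<^sub>L V) = adj_op V" by simp
  then have "adj_op V o\<^sub>L p = adj_op V"
    using proj_selfadjoint[OF p] by (simp add: adj_op_compose adj_op_selfadjoint[THEN iffD2])
  then have aVp: "adj_op V (p x) = adj_op V x" for x by (metis blinfun_apply_blinfun_compose)
  have naV: "norm (adj_op V x) \<le> norm x" for x
  proof -
    have "norm (adj_op V x) * norm (adj_op V x) = V (adj_op V x) \<bullet> x"
      by (simp add: adj_op power2_eq_square flip: power2_norm_eq_inner)
    also have "\<dots> \<le> norm (V (adj_op V x)) * norm x" by (rule norm_cauchy_schwarz)
    also have "\<dots> \<le> norm (adj_op V x) * norm x" by (intro mult_right_mono nV) simp
    finally show ?thesis
      by (intro le_if_square_le_mult[OF _ norm_ge_zero norm_ge_zero]) (simp only: mult.commute)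
  qed
  \<comment> \<open>\<open>V o\<^sub>L adj_op V\<close> is compared with \<open>p\<close> merely as
    a positive operator: \<open>adj_op V\<close> is a contraction that factors through
    \<open>p\<close>.\<close>
  have VaV: "(V o\<^sub>L adj_op V) x \<bullet> y = adj_op V x \<bullet> adj_op V y" for x y by (simp add: adj_op)
  have "\<tau> r = \<tau> (V o\<^sub>L adj_op V)" using trace_adj[OF VM] VV by simp
  also have "\<dots> \<le> \<tau> p"
  proof (rule trace_mono[OF _ proj_positive[OF p]])
    show "V o\<^sub>L adj_op V \<in> positive_part M"
      unfolding positive_part_iff
    proof (intro conjI allI)
      show "V o\<^sub>L adj_op V \<in> M" by (intro compose_mem adj_mem VM)
      show "(V o\<^sub>L adj_op V) x \<bullet> y = x \<bullet> (V o\<^sub>L adj_op V) y" for x y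
        using VaV[of x y] VaV[of y x] by (metis inner_commute)
      show "0 \<le> (V o\<^sub>L adj_op V) x \<bullet> x" for x by (simp only: VaV inner_ge_zero)
    qed
    fix x
    have "(V o\<^sub>L adj_op V) x \<bullet> x = (norm (adj_op V (p x)))\<^sup>2"
      by (simp only: VaV aVp power2_norm_eq_inner)
    also have "\<dots> \<le> (norm (p x))\<^sup>2" by (intro power_mono naV) simp
    finally show "(V o\<^sub>L adj_op V) x \<bullet> x \<le> p x \<bullet> x" by (simp add: proj_inner[OF p])
  qed
  finally show ?thesis .
qed

text \<open>\<open>Q\<close> is injective on the range of \<open>J - P\<close>, because a vector
  killed by both \<open>P\<close> and \<open>Q\<close> is killed by \<open>J\<close>. The result is
  an inequality version of Kaplansky's parallelogram law.\<close>

lemma trace_join_le: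
  assumes P: "P \<in> projections M" and Q: "Q \<in> projections M"
  obtains J where "J \<in> projections M" "bop_le P J" "bop_le Q J" "\<tau> J \<le> \<tau> P + \<tau> Q"
proof -
  obtain J where J: "J \<in> projections M" "bop_le P J" "bop_le Q J"
    and J0: "\<And>x. P x = 0 \<Longrightarrow> Q x = 0 \<Longrightarrow> J x = 0"
    by (rule proj_join[OF P Q]) blast
  have "\<tau> (J - P) \<le> \<tau> Q"
  proof (rule trace_le_if_injective[OF proj_mem[OF Q] Q proj_diff[OF P J(1,2)] proj_idem[OF Q]])
    fix x assume x: "(J - P) x = x" "Q x = 0"
    have PJ: "P (J y) = P y" "J (P y) = P y" for y using J(2) proj_le_iff[OF P J(1)] by blast+
    have "P x = P ((J - P) x)" by (simp only: x(1))
    also have "\<dots> = 0" by (simp add: blinfun.diff_left blinfun.diff_right PJ proj_idem[OF P])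
    finally have "P x = 0" .
    moreover from this have "J x = 0" using x(2) by (rule J0)
    ultimately show "x = 0" using x(1) by (simp add: blinfun.diff_left)
  qed
  then have "\<tau> J \<le> \<tau> P + \<tau> Q" using trace_proj_diff[OF P J(1,2)] by (simp add: add_left_mono)
  then show ?thesis using that J by blast
qed

text \<open>Chebyshev's inequality: \<open>e\<close> is the spectral projection of \<open>B\<close>
  above the level \<open>l\<close>, and \<open>l e \<le> B\<close> because \<open>e\<close> commutes
  with \<open>B\<close>. The last clause says that \<open>e\<close> lies below the support of
  \<open>B\<close>.\<close>

lemma spectral_projection_above:
  assumes B: "B \<in> positive_part M" and l: "0 < l"
  obtains e where "e \<in> projections M" "ennreal l * \<tau> e \<le> \<tau> B"
    "\<And>x. e x = 0 \<Longrightarrow> B x \<bullet> x \<le> l * (x \<bullet> x)" "\<And>x. B x \<bullet> x = 0 \<Longrightarrow> e x = 0"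
proof -
  have BM: "B \<in> M" "selfadjoint B" "\<And>x. 0 \<le> B x \<bullet> x" using B by (auto simp: positive_part_iff)
  define C where "C = B - l *\<^sub>R id_blinfun"
  have C: "C \<in> M" "selfadjoint C"
    using BM by (auto simp: C_def diff_mem scaleR_mem id_mem blinfun.diff_left blinfun.scaleR_left
        inner_diff_left inner_diff_right)
  obtain e where e: "e \<in> projections M" and eC: "\<And>x. C (e x) = e (C x)"
    and pos: "\<And>x. e x = x \<Longrightarrow> 0 \<le> C x \<bullet> x" and neg: "\<And>x. e x = 0 \<Longrightarrow> C x \<bullet> x \<le> 0"
    by (rule spectral_projection[OF C]) blast
  have CB: "C x = B x - l *\<^sub>R x" for x by (simp add: C_def blinfun.diff_left blinfun.scaleR_left)
  have eB: "B (e x) = e (B x)" for x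
    using eC[of x] by (simp add: CB blinfun.diff_right blinfun.scaleR_right)
  have le: "l * (e x \<bullet> x) \<le> B x \<bullet> x" for x
  proof -
    have ee: "e x \<bullet> x = e x \<bullet> e x" using proj_idem[OF e] proj_selfadjoint[OF e] by metis
    have "0 \<le> C (e x) \<bullet> e x" by (rule pos) (rule proj_idem[OF e])
    then have "l * (e x \<bullet> x) \<le> B (e x) \<bullet> e x" by (simp add: CB inner_diff_left ee)
    moreover have "0 \<le> B (x - e x) \<bullet> (x - e x)" by (rule BM(3))
    \<comment> \<open>The mixed term vanishes because \<open>e\<close> commutes with
      \<open>B\<close>.\<close>
    moreover have "B (e x) \<bullet> (x - e x) = 0"
    proof -
      have "B (e x) \<bullet> (x - e x) = B x \<bullet> e (x - e x)" using eB proj_selfadjoint[OF e] by metis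
      then show ?thesis by (simp add: blinfun.diff_right proj_idem[OF e])
    qed
    moreover have "B x \<bullet> x = B (e x) \<bullet> e x + 2 * (B (e x) \<bullet> (x - e x)) + B (x - e x) \<bullet> (x - e x)"
    proof -
      have "B x \<bullet> e x = x \<bullet> B (e x)" using BM(2) by blast
      then show ?thesis by (simp add: blinfun.diff_right inner_diff_left inner_diff_right inner_commute)
    qed
    ultimately show ?thesis by linarith
  qed
  have "\<tau> (l *\<^sub>R e) \<le> \<tau> B"
  proof (rule trace_mono[OF _ B])
    show "l *\<^sub>R e \<in> positive_part M"
      using l proj_mem[OF e] proj_selfadjoint[OF e] unfolding positive_part_iff
      by (auto simp: scaleR_mem blinfun.scaleR_left proj_inner[OF e])
    show "(l *\<^sub>R e) x \<bullet> x \<le> B x \<bullet> x" for x using le by (simp add: blinfun.scaleR_left)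
  qed
  then have 1: "ennreal l * \<tau> e \<le> \<tau> B" using l trace_scaleR[OF proj_positive[OF e]] by simp
  show ?thesis
  proof (rule that[OF e 1])
    show "B x \<bullet> x \<le> l * (x \<bullet> x)" if "e x = 0" for x using neg[OF that] by (simp add: CB inner_diff_left)
    show "e x = 0" if "B x \<bullet> x = 0" for x
    proof -
      have "l * (norm (e x))\<^sup>2 \<le> 0" using le[of x] that by (simp add: proj_inner[OF e])
      then show ?thesis using l by (simp add: mult_le_0_iff)
    qed
  qed
qed

text \<open>Semifiniteness supplies only a positive operator \<open>B\<close> of finite trace below
  \<open>N\<close>. A spectral projection of \<open>B\<close> has finite trace by Chebyshev, and it
  lies below \<open>N\<close> because the form of \<open>B\<close> vanishes on the kernel of
  \<open>N\<close>.\<close>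

lemma finite_trace_subprojection:
  assumes N: "N \<in> projections M" "N \<noteq> 0"
  obtains e where "e \<in> projections M" "bop_le e N" "e \<noteq> 0" "\<tau> e < \<infinity>"
proof -
  obtain B where B: "B \<in> positive_part M" "B \<noteq> 0" "bop_le B N" "\<tau> B < \<infinity>"
    using semifinite proj_positive[OF N(1)] N(2) unfolding semifinite_trace_def by blast
  have BM: "B \<in> M" "selfadjoint B" "\<And>x. 0 \<le> B x \<bullet> x" using B by (auto simp: positive_part_iff)
  have "\<exists>x. B x \<bullet> x \<noteq> 0"
  proof (rule ccontr)
    assume "\<not> ?thesis"
    then have z: "B x \<bullet> x = 0" for x by blast
    have "B x \<bullet> y = 0" for x y
    proof -
      have "B y \<bullet> x = B x \<bullet> y" using BM(2) by (metis inner_commute)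
      then show ?thesis using z[of "x + y"] z[of x] z[of y]
        by (simp add: blinfun.add_right inner_add_left inner_add_right)
    qed
    then have "B x = 0" for x by (metis inner_eq_zero_iff)
    then show False using B(2) by (metis blinfun_eqI zero_blinfun.rep_eq)
  qed
  then obtain x where x: "0 < B x \<bullet> x" using BM(3) by (metis order_le_less)
  then have x0: "0 < x \<bullet> x" by (cases "x = 0") auto
  \<comment> \<open>Half the Rayleigh quotient of \<open>B\<close> at \<open>x\<close>: the bound
    valid on the kernel of \<open>e\<close> fails at \<open>x\<close>, so \<open>e\<close> is not
    0.\<close>
  define l where "l = (B x \<bullet> x) / (2 * (x \<bullet> x))"
  have l: "0 < l" using x x0 by (simp add: l_def)
  obtain e where e: "e \<in> projections M" and te: "ennreal l * \<tau> e \<le> \<tau> B"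
    and e0: "\<And>x. e x = 0 \<Longrightarrow> B x \<bullet> x \<le> l * (x \<bullet> x)" and Be: "\<And>x. B x \<bullet> x = 0 \<Longrightarrow> e x = 0"
    by (rule spectral_projection_above[OF B(1) l]) blast
  have "l * (x \<bullet> x) < B x \<bullet> x" using x x0 by (simp add: l_def)
  then have "e \<noteq> 0" using e0[of x] by auto
  moreover have "bop_le e N"
  proof -
    have leBN: "B y \<bullet> y \<le> N y \<bullet> y" for y
      using B(3) bop_le_iff[OF BM(1) proj_mem[OF N(1)] BM(2) proj_selfadjoint[OF N(1)]] by blast
    have "e (N y) = e y" for y
    proof -
      define z where "z = y - N y"
      have "N z = 0" by (simp add: z_def blinfun.diff_right proj_idem[OF N(1)])
      then have "B z \<bullet> z = 0" using leBN[of z] BM(3)[of z] by simp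
      then have "e z = 0" by (rule Be)
      then show ?thesis by (simp add: z_def blinfun.diff_right)
    qed
    then show ?thesis using proj_le_iff(2)[OF e N(1)] by blast
  qed
  moreover have "\<tau> e < \<infinity>"
  proof (rule ccontr)
    assume "\<not> ?thesis"
    then have "\<tau> e = \<infinity>" by (metis infinity_ennreal_def less_top)
    then show False using te B(4) l by (simp add: ennreal_mult_top)
  qed
  ultimately show ?thesis using that e by blast
qed

text \<open>The projections of finite trace are directed by joins and have supremum
  \<open>I\<close>, so normality makes their traces approach the infinite trace of
  \<open>I\<close>.\<close>

lemma finite_trace_projections_unbounded:
  assumes inf: "\<tau> id_blinfun = \<infinity>"
  shows "\<exists>f\<in>projections M. \<tau> f < \<infinity> \<and> ennreal c < \<tau> f"
proof -
  define D where "D = {f \<in> projections M. \<tau> f < \<infinity>}"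
  have Dproj: "f \<in> projections M" if "f \<in> D" for f using that by (simp add: D_def)
  have D0: "0 \<in> D" using zero_proj by (simp add: D_def trace_0)
  have dir: "\<exists>h\<in>D. bop_le f h \<and> bop_le g h" if fg: "f \<in> D" "g \<in> D" for f g
  proof -
    obtain J where J: "J \<in> projections M" "bop_le f J" "bop_le g J" "\<tau> J \<le> \<tau> f + \<tau> g"
      by (rule trace_join_le[OF Dproj[OF fg(1)] Dproj[OF fg(2)]]) blast
    have "\<tau> f + \<tau> g < \<infinity>" using fg by (simp add: D_def)
    then have "J \<in> D" using J by (auto simp: D_def intro: le_less_trans)
    then show ?thesis using J by blast
  qed
  define K where "K = {x. \<exists>f\<in>D. f x = x}"
  have K: "subspace K"
    unfolding subspace_def
  proof (intro conjI ballI allI)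
    show "0 \<in> K" using D0 by (auto simp: K_def)
    show "c *\<^sub>R x \<in> K" if "x \<in> K" for c x using that by (auto simp: K_def blinfun.scaleR_right)
    fix x y assume "x \<in> K" "y \<in> K"
    then obtain f g where fg: "f \<in> D" "g \<in> D" "f x = x" "g y = y" by (auto simp: K_def)
    obtain h where h: "h \<in> D" "bop_le f h" "bop_le g h" using dir[OF fg(1,2)] by blast
    have "h (f x) = f x" "h (g y) = g y"
      using h(2,3) proj_le_iff(1)[OF Dproj Dproj] fg(1,2) h(1) by blast+
    then have "h (x + y) = x + y" using fg(3,4) by (simp add: blinfun.add_right)
    then show "x + y \<in> K" using h(1) by (auto simp: K_def)
  qed
  have dense: "closure K = UNIV"
  proof (rule dense_if_orthogonal_trivial[OF K])
    fix v assume v: "\<And>k. k \<in> K \<Longrightarrow> v \<bullet> k = 0"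
    \<comment> \<open>The complement of \<open>K\<close> is the range of a projection in
      \<open>M\<close> with no nonzero subprojection of finite trace; semifiniteness makes that
      projection 0.\<close>
    define K' where "K' = {x. \<forall>k\<in>K. x \<bullet> k = 0}"
    have K': "subspace K'" "closed K'"
      unfolding K'_def by (rule subspace_orthogonal_complement closed_orthogonal_complement)+
    have N: "orth_proj K' \<in> projections M"
    proof (rule orth_proj_in_projections[OF K'])
      fix B x assume B: "B \<in> commutant M" and x: "x \<in> K'"
      have "adj_op B k \<in> K" if k: "k \<in> K" for k
      proof -
        obtain f where f: "f \<in> D" "f k = k" using k by (auto simp: K_def)
        have "f (adj_op B k) = adj_op B k"
          using commutant_commute[OF proj_mem[OF Dproj[OF f(1)]] adj_in_commutant[OF B]] f(2) by simp
        then show ?thesis using f(1) by (auto simp: K_def)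
      qed
      then show "B x \<in> K'" using x by (simp add: K'_def adj_op)
    qed
    have "orth_proj K' = 0"
    proof (rule ccontr)
      assume "orth_proj K' \<noteq> 0"
      then obtain e where e: "e \<in> projections M" "bop_le e (orth_proj K')" "e \<noteq> 0" "\<tau> e < \<infinity>"
        by (rule finite_trace_subprojection[OF N]) blast
      have "e y = 0" for y
      proof -
        have "orth_proj K' (e y) = e y" using e(2) proj_le_iff(1)[OF e(1) N] by blast
        then have "e y \<in> K'" using orth_proj_eq_self_iff[OF K'] by blast
        moreover have "e y \<in> K" using e proj_idem[OF e(1)] by (auto simp: K_def D_def)
        ultimately have "e y \<bullet> e y = 0" by (simp add: K'_def)
        then show ?thesis by simp
      qed
      then show False using e(3) by (metis blinfun_eqI zero_blinfun.rep_eq)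
    qed
    moreover have "v \<in> K'" using v by (simp add: K'_def)
    then have "orth_proj K' v = v" by (simp add: orth_proj_eq_self_iff[OF K'])
    ultimately show "v = 0" by simp
  qed
  have lub: "is_lub_in (positive_part M) bop_le D id_blinfun"
    unfolding is_lub_in_def
  proof (intro conjI ballI impI)
    show "id_blinfun \<in> positive_part M" by (rule proj_positive[OF id_proj])
    show "bop_le f id_blinfun" if "f \<in> D" for f
      unfolding proj_le_iff(1)[OF Dproj[OF that] id_proj] by simp
    fix b assume b: "b \<in> positive_part M" "\<forall>f\<in>D. bop_le f b"
    have bM: "b \<in> M" "selfadjoint b" using b(1) by (simp_all add: positive_part_iff)
    \<comment> \<open>The upper bound \<open>b\<close> may be any positive element, so the
      inequality of forms is checked on \<open>K\<close>, where members of \<open>D\<close> act as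
      the identity, and extended by density.\<close>
    have "K \<subseteq> {x. x \<bullet> x \<le> b x \<bullet> x}"
    proof
      fix x assume "x \<in> K"
      then obtain f where f: "f \<in> D" "f x = x" by (auto simp: K_def)
      have "f x \<bullet> x \<le> b x \<bullet> x"
        using b(2) f(1) bop_le_iff[OF proj_mem[OF Dproj[OF f(1)]] bM(1) proj_selfadjoint[OF Dproj[OF f(1)]] bM(2)]
        by blast
      then show "x \<in> {x. x \<bullet> x \<le> b x \<bullet> x}" using f(2) by simp
    qed
    then have "closure K \<subseteq> {x. x \<bullet> x \<le> b x \<bullet> x}"
      by (intro closure_minimal closed_Collect_le continuous_intros)
    then have "\<forall>x. x \<bullet> x \<le> b x \<bullet> x" using dense by blast
    then show "bop_le id_blinfun b"
      using bop_le_iff[OF id_mem bM(1) _ bM(2)] by simp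
  qed
  have "D \<subseteq> positive_part M" using Dproj proj_positive by blast
  then have "\<tau> id_blinfun = (SUP f\<in>D. \<tau> f)"
    using normal lub dir D0 unfolding normal_trace_def by blast
  then have "ennreal c < (SUP f\<in>D. \<tau> f)" using inf by simp
  then show ?thesis by (auto simp: less_SUP_iff D_def)
qed

text \<open>The differences are the \<open>E\<^sub>n\<close> of the overview. Joining
  \<open>f\<close> with a finite-trace projection of trace above \<open>\<tau> f + 1\<close> keeps
  the trace finite, and finiteness is what allows \<open>\<tau> (f n)\<close> to be
  cancelled.\<close>

lemma increasing_finite_projections:
  assumes inf: "\<tau> id_blinfun = \<infinity>"
  obtains f where "\<And>n::nat. f n \<in> projections M" "\<And>n. bop_le (f n) (f (Suc n))"
    "\<And>n. 1 \<le> \<tau> (f (Suc n) - f n)"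
proof -
  let ?P = "\<lambda>f. f \<in> projections M \<and> \<tau> f < \<infinity>"
  have "\<exists>f. \<forall>n::nat. ?P (f n) \<and> (bop_le (f n) (f (Suc n)) \<and> \<tau> (f n) + 1 \<le> \<tau> (f (Suc n)))"
  proof (rule dependent_nat_choice)
    show "\<exists>f. ?P f" using zero_proj trace_0 by (intro exI[of _ 0]) simp
    fix f and n :: nat assume f: "?P f"
    then obtain c where c: "0 \<le> c" "\<tau> f = ennreal c" by (cases "\<tau> f") auto
    obtain g where g: "g \<in> projections M" "\<tau> g < \<infinity>" "ennreal (c + 1) < \<tau> g"
      using finite_trace_projections_unbounded[OF inf] by blast
    obtain J where J: "J \<in> projections M" "bop_le f J" "bop_le g J" "\<tau> J \<le> \<tau> f + \<tau> g"
      using f g(1) by (metis trace_join_le)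
    have "\<tau> f + \<tau> g < \<infinity>" using f g by simp
    then have "\<tau> J < \<infinity>" using J(4) by (rule le_less_trans[rotated])
    moreover have "\<tau> f + 1 \<le> \<tau> J"
    proof -
      have "\<tau> f + 1 = ennreal (c + 1)" using c by (simp add: ennreal_plus)
      also have "\<dots> \<le> \<tau> g" using g(3) by simp
      also have "\<dots> \<le> \<tau> J" by (rule trace_proj_mono[OF g(1) J(1,3)])
      finally show ?thesis .
    qed
    ultimately show "\<exists>g. ?P g \<and> bop_le f g \<and> \<tau> f + 1 \<le> \<tau> g" using J by blast
  qed
  then obtain f where f: "\<And>n::nat. f n \<in> projections M" "\<And>n. \<tau> (f n) < \<infinity>"
    "\<And>n. bop_le (f n) (f (Suc n))" "\<And>n. \<tau> (f n) + 1 \<le> \<tau> (f (Suc n))" by blast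
  have "1 \<le> \<tau> (f (Suc n) - f n)" for n
  proof -
    have "\<tau> (f n) + 1 \<le> \<tau> (f n) + \<tau> (f (Suc n) - f n)"
      using f(4)[of n] trace_proj_diff[OF f(1) f(1) f(3)] by simp
    then show ?thesis using f(2)[of n] by (auto simp: ennreal_add_left_cancel_le)
  qed
  then show ?thesis using that f by blast
qed

section \<open>Compressions of the increments to a projection of finite trace\<close>

lemma compression_positive:
  assumes "A \<in> positive_part M" "P \<in> projections M"
  shows "P o\<^sub>L A o\<^sub>L P \<in> positive_part M"
proof -
  have A: "A \<in> M" "selfadjoint A" "\<And>x. 0 \<le> A x \<bullet> x" using assms(1) by (auto simp: positive_part_iff)
  have 1: "P (A (P x)) \<bullet> y = A (P x) \<bullet> P y" for x y using proj_selfadjoint[OF assms(2)] by blast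
  have 2: "A (P x) \<bullet> P y = x \<bullet> P (A (P y))" for x y
    using A(2) proj_selfadjoint[OF assms(2)] by metis
  show ?thesis
    unfolding positive_part_iff
  proof (intro conjI allI)
    show "P o\<^sub>L A o\<^sub>L P \<in> M" by (intro compose_mem A(1) proj_mem[OF assms(2)])
    show "(P o\<^sub>L A o\<^sub>L P) x \<bullet> y = x \<bullet> (P o\<^sub>L A o\<^sub>L P) y" for x y
      unfolding blinfun_apply_blinfun_compose by (rule trans[OF 1 2])
    show "0 \<le> (P o\<^sub>L A o\<^sub>L P) x \<bullet> x" for x
      unfolding blinfun_apply_blinfun_compose 1 by (rule A(3))
  qed
qed

text \<open>Telescoping does the work of orthogonality: the partial sum is at most the trace of the
  compression of \<open>f N\<close>, which is dominated by \<open>P\<close>.\<close>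

lemma sum_trace_compressions_le:
  assumes f: "\<And>n::nat. f n \<in> projections M" "\<And>n. bop_le (f n) (f (Suc n))"
    and P: "P \<in> projections M"
  shows "(\<Sum>n<N. \<tau> (P o\<^sub>L (f (Suc n) - f n) o\<^sub>L P)) \<le> \<tau> P"
proof -
  note pos = compression_positive[OF proj_positive P]
  have "(\<Sum>n<N. \<tau> (P o\<^sub>L (f (Suc n) - f n) o\<^sub>L P)) \<le> \<tau> (P o\<^sub>L f N o\<^sub>L P)"
  proof (induction N)
    case (Suc N)
    have "P o\<^sub>L f (Suc N) o\<^sub>L P = (P o\<^sub>L f N o\<^sub>L P) + (P o\<^sub>L (f (Suc N) - f N) o\<^sub>L P)"
      by (simp add: compose_diff_left compose_diff_right)
    then have "\<tau> (P o\<^sub>L f (Suc N) o\<^sub>L P) = \<tau> (P o\<^sub>L f N o\<^sub>L P) + \<tau> (P o\<^sub>L (f (Suc N) - f N) o\<^sub>L P)"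
      using trace_add[OF pos[OF f(1)] pos[OF proj_diff[OF f(1) f(1) f(2)]]] by simp
    then show ?case using Suc by (simp add: add_right_mono)
  qed simp
  also have "\<dots> \<le> \<tau> P"
  proof (rule trace_mono[OF pos[OF f(1)] proj_positive[OF P]])
    fix x
    have "(P o\<^sub>L f N o\<^sub>L P) x \<bullet> x = f N (P x) \<bullet> P x" using proj_selfadjoint[OF P] by simp
    also have "\<dots> \<le> P x \<bullet> P x" by (rule proj_inner_le[OF f(1)])
    finally show "(P o\<^sub>L f N o\<^sub>L P) x \<bullet> x \<le> P x \<bullet> x"
      by (simp add: proj_inner[OF P] power2_norm_eq_inner)
  qed
  finally show ?thesis .
qed

text \<open>If every term exceeded its bound, the bounded partial sums would make the harmonic
  series converge. A single index suffices, since only membership in a closure is at stake.\<close>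

lemma small_compression:
  assumes f: "\<And>n::nat. f n \<in> projections M" "\<And>n. bop_le (f n) (f (Suc n))"
    and P: "P \<in> projections M" "\<tau> P < \<infinity>" and \<eta>: "0 < \<eta>"
  obtains n where "\<tau> (P o\<^sub>L (f (Suc n) - f n) o\<^sub>L P) \<le> ennreal (\<eta> / real (Suc n))"
proof (rule ccontr)
  assume "\<not> thesis"
  then have big: "ennreal (\<eta> / real (Suc n)) \<le> \<tau> (P o\<^sub>L (f (Suc n) - f n) o\<^sub>L P)" for n
    using that[of n] by (meson linear)
  obtain c where c: "0 \<le> c" "\<tau> P = ennreal c" using P(2) by (cases "\<tau> P") auto
  have bound: "(\<Sum>n<N. \<eta> / real (Suc n)) \<le> c" for N
  proof -
    have "ennreal (\<Sum>n<N. \<eta> / real (Suc n)) = (\<Sum>n<N. ennreal (\<eta> / real (Suc n)))"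
      using \<eta> by (intro sum_ennreal[symmetric]) simp
    also have "\<dots> \<le> (\<Sum>n<N. \<tau> (P o\<^sub>L (f (Suc n) - f n) o\<^sub>L P))" by (intro sum_mono big)
    also have "\<dots> \<le> ennreal c" using sum_trace_compressions_le[of f, OF f P(1)] c by simp
    finally show ?thesis using c(1) by (simp add: ennreal_le_iff)
  qed
  have "summable (\<lambda>n. \<eta> / real (Suc n))"
    by (rule summableI_nonneg_bounded[where x = c]) (use \<eta> bound in auto)
  then have "summable (\<lambda>n. (1 / \<eta>) * (\<eta> / real (Suc n)))" by (rule summable_mult)
  then have "summable (\<lambda>n. 1 / real (Suc n))" using \<eta> by simp
  then have "summable (\<lambda>n. 1 / real n)" using summable_Suc_iff[of "\<lambda>n. 1 / real n"] by simp
  then show False using not_summable_harmonic[where ?'a = real] by (simp add: inverse_eq_divide)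
qed

end

section \<open>Resolvents of self-adjoint operators\<close>

lemma continuous_on_iC [continuous_intros]:
  "continuous_on S f \<Longrightarrow> continuous_on S (\<lambda>x. iC (f x))"
  by (rule bounded_linear.continuous_on[OF bounded_linear_iC])

lemma cinner_nonneg_iff: "cinner x y \<in> \<real>\<^sub>\<ge>\<^sub>0 \<longleftrightarrow> 0 \<le> x \<bullet> y \<and> iC x \<bullet> y = 0"
  by (auto simp: cinner_eq complex_nonneg_Reals_iff)

lemma mem_graph_of [simp]: "(x, y) \<in> graph_of A \<longleftrightarrow> y = A x"
  by (auto simp: graph_of_def)

lemma closed_graph_of: "closed (graph_of A)"
proof -
  have "graph_of A = {p. snd p = A (fst p)}" by (auto simp: graph_of_def)
  then show ?thesis by (auto intro!: closed_Collect_eq continuous_intros)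
qed

text \<open>Lets positivity of forms pass to closures of graphs and to limits along a core.\<close>

lemma cinner_nonneg_closed: "closed {p :: 'h \<times> 'h::chilbert_space. cinner (snd p) (fst p) \<in> \<real>\<^sub>\<ge>\<^sub>0}"
proof -
  have "{p :: 'h \<times> 'h. cinner (snd p) (fst p) \<in> \<real>\<^sub>\<ge>\<^sub>0} = {p. 0 \<le> snd p \<bullet> fst p \<and> iC (snd p) \<bullet> fst p = 0}"
    by (simp add: cinner_nonneg_iff)
  then show ?thesis by (auto intro!: closed_Collect_conj closed_Collect_le closed_Collect_eq continuous_intros)
qed

text \<open>The closure inside \<open>strong_diff\<close> adds no further condition, because
  positivity of the form is a closed condition on graph points.\<close>

lemma uop_leI:
  assumes "\<And>x y z. (x, y) \<in> S \<Longrightarrow> (x, z) \<in> T \<Longrightarrow> cinner (y - z) x \<in> \<real>\<^sub>\<ge>\<^sub>0"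
  shows "uop_le T S"
proof -
  have "strong_diff S T \<subseteq> {p. cinner (snd p) (fst p) \<in> \<real>\<^sub>\<ge>\<^sub>0}"
    unfolding strong_diff_def by (rule closure_minimal[OF _ cinner_nonneg_closed]) (use assms in auto)
  then show ?thesis by (auto simp: uop_le_def)
qed

lemma uop_leD:
  assumes "uop_le T S" "(x, y) \<in> S" "(x, z) \<in> T"
  shows "cinner (y - z) x \<in> \<real>\<^sub>\<ge>\<^sub>0"
proof -
  have "(x, y - z) \<in> {(x, y - z) | x y z. (x, y) \<in> S \<and> (x, z) \<in> T}"
    by (intro CollectI exI[of _ x] exI[of _ y] exI[of _ z]) (simp add: assms(2,3))
  then have "(x, y - z) \<in> strong_diff S T" unfolding strong_diff_def by (rule subsetD[OF closure_subset])
  then show ?thesis using assms(1) unfolding uop_le_def by blast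
qed

section \<open>Graphs of closed and of self-adjoint operators\<close>

locale cdd_operator =
  fixes T :: "'h::chilbert_space uop"
  assumes cdd: "closed_densely_defined T"
begin

lemma unique: "(x, y) \<in> T \<Longrightarrow> (x, z) \<in> T \<Longrightarrow> y = z"
  using cdd by (auto simp: closed_densely_defined_def single_valued_def)

lemma add: "(x, y) \<in> T \<Longrightarrow> (u, v) \<in> T \<Longrightarrow> (x + u, y + v) \<in> T"
  using cdd by (auto simp: closed_densely_defined_def)

lemma scaleC: "(x, y) \<in> T \<Longrightarrow> (c *\<^sub>C x, c *\<^sub>C y) \<in> T"
  using cdd by (auto simp: closed_densely_defined_def)

lemma zero: "(0, 0) \<in> T" and closed: "closed T"
  using cdd by (auto simp: closed_densely_defined_def)

lemma scaleR: "(x, y) \<in> T \<Longrightarrow> (r *\<^sub>R x, r *\<^sub>R y) \<in> T"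
  by (simp add: scaleR_scaleC scaleC)

text \<open>The graph is invariant under multiplication by i, so equality of the real parts yields
  equality of the complex inner products.\<close>

lemma mem_uop_adj_iff: "(u, v) \<in> uop_adj T \<longleftrightarrow> (\<forall>x y. (x, y) \<in> T \<longrightarrow> y \<bullet> u = x \<bullet> v)"
proof
  assume "(u, v) \<in> uop_adj T"
  then show "\<forall>x y. (x, y) \<in> T \<longrightarrow> y \<bullet> u = x \<bullet> v" by (auto simp: uop_adj_def inner_cinner)
next
  assume *: "\<forall>x y. (x, y) \<in> T \<longrightarrow> y \<bullet> u = x \<bullet> v"
  have "cinner y u = cinner x v" if "(x, y) \<in> T" for x y
    using * that scaleC[OF that, of \<i>] by (simp add: cinner_eq)
  then show "(u, v) \<in> uop_adj T" by (auto simp: uop_adj_def)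
qed

end

locale selfadjoint_operator = cdd_operator +
  assumes selfadj: "uop_adj T = T"
begin

lemma symmetric: "(x, y) \<in> T \<Longrightarrow> (u, v) \<in> T \<Longrightarrow> y \<bullet> u = x \<bullet> v"
  using mem_uop_adj_iff[of u v] selfadj by simp

text \<open>Symmetry, applied to a graph point and its multiple by i, equates the number with its
  negative; it is the imaginary part of the quadratic form up to sign.\<close>

lemma inner_iC_graph: "(x, y) \<in> T \<Longrightarrow> y \<bullet> iC x = 0"
  using symmetric[of x y "iC x" "iC y"] scaleC[of x y \<i>] inner_iC_left[of x y]
  by (simp add: inner_commute)

text \<open>\<open>A = (T + i)\<^sup>-\<^sup>1\<close>\<close>

lemma resolvent:
  obtains A :: "'a bop" where "\<And>w. (A w, w - iC (A w)) \<in> T" "\<And>x y. (x, y) \<in> T \<Longrightarrow> A (y + iC x) = x"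
proof -
  \<comment> \<open>The converse of the graph of \<open>T + i\<close>.\<close>
  define L where "L = {p. (snd p, fst p - iC (snd p)) \<in> T}"
  have L: "(w, x) \<in> L \<longleftrightarrow> (x, w - iC x) \<in> T" for w x by (simp add: L_def)
  have sub: "subspace L"
    unfolding subspace_def
  proof (intro conjI ballI allI)
    show "0 \<in> L" by (simp add: L_def zero)
    fix p assume p: "p \<in> L"
    show "r *\<^sub>R p \<in> L" for r
      using p scaleR[of "snd p" "fst p - iC (snd p)" r] by (simp add: L_def iC_scaleR scaleR_diff_right)
    fix q assume "q \<in> L"
    then show "p + q \<in> L"
      using p add[of "snd p" "fst p - iC (snd p)" "snd q" "fst q - iC (snd q)"]
      by (simp add: L_def iC_add algebra_simps)
  qed
  have "L = (\<lambda>p. (snd p, fst p - iC (snd p))) -` T" by (auto simp: L_def)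
  then have cl: "closed L" by (auto intro!: closed_vimage closed continuous_intros)
  \<comment> \<open>\<open>T x\<close> and \<open>i x\<close> are orthogonal for the real inner
    product, so the norm of \<open>T x + i x\<close> is at least that of \<open>x\<close>.\<close>
  have bd: "norm x \<le> 1 * norm w" if "(w, x) \<in> L" for w x
  proof -
    define y where "y = w - iC x"
    have w: "w = y + iC x" and "(x, y) \<in> T" using that by (simp_all add: y_def L)
    then have "y \<bullet> iC x = 0" using inner_iC_graph by blast
    then have "w \<bullet> w = y \<bullet> y + iC x \<bullet> iC x" by (simp add: w inner_add_left inner_add_right inner_commute)
    then have "iC x \<bullet> iC x \<le> w \<bullet> w" by simp
    then have "norm (iC x) \<le> norm w" by (simp only: norm_le)
    then show ?thesis by simp
  qed
  have "fst ` L = {y + iC x | x y. (x, y) \<in> T}"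
  proof (intro equalityI subsetI)
    fix w assume "w \<in> fst ` L"
    then obtain x where "(x, w - iC x) \<in> T" by (auto simp: L_def)
    moreover have "w = (w - iC x) + iC x" by simp
    ultimately show "w \<in> {y + iC x | x y. (x, y) \<in> T}" by blast
  next
    fix w assume "w \<in> {y + iC x | x y. (x, y) \<in> T}"
    then obtain x y where "(x, y) \<in> T" "w = y + iC x" by blast
    then have "(w, x) \<in> L" by (simp add: L)
    then show "w \<in> fst ` L" by force
  qed
  moreover have "closure (fst ` L) = UNIV"
  proof (rule dense_if_orthogonal_trivial)
    show "subspace (fst ` L)" by (intro linear_subspace_image sub) (simp add: linear_fst)
    fix v assume "\<And>k. k \<in> fst ` L \<Longrightarrow> v \<bullet> k = 0"
    then have v: "v \<bullet> (y + iC x) = 0" if "(x, y) \<in> T" for x y using that calculation by blast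
    \<comment> \<open>A vector orthogonal to the range of \<open>T + i\<close> is mapped by the
      adjoint, hence by \<open>T\<close>, to its multiple by i; the quadratic form being real, it is
      0.\<close>
    have "y \<bullet> v = x \<bullet> iC v" if "(x, y) \<in> T" for x y
      using v[OF that] inner_iC_left[of x v] by (simp add: inner_add_right inner_commute)
    then have "(v, iC v) \<in> T" using mem_uop_adj_iff[of v "iC v"] selfadj by simp
    from inner_iC_graph[OF this] have "iC v = 0" by simp
    then have "norm (iC v) = 0" by (simp only: norm_zero)
    then show "v = 0" by simp
  qed
  ultimately obtain A :: "'a bop" where A: "\<And>w x. (w, x) \<in> L \<longleftrightarrow> x = A w"
    using graph_of_bounded_operator[OF sub cl bd] by metis
  show ?thesis
  proof (rule that)
    show "(A w, w - iC (A w)) \<in> T" for w using A[of w "A w"] by (simp add: L)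
    show "A (y + iC x) = x" if "(x, y) \<in> T" for x y using A[of "y + iC x" x] that by (simp add: L)
  qed
qed

end

lemma closed_densely_defined_graph_of:
  assumes "A \<in> bounded_ops"
  shows "closed_densely_defined (graph_of A)"
proof -
  have "Domain (graph_of A) = UNIV" by (auto simp: graph_of_def)
  then show ?thesis
    using assms closed_graph_of
    by (auto simp: closed_densely_defined_def single_valued_def bounded_ops_def blinfun.add_right)
qed

lemma uop_adj_graph_of:
  assumes "A \<in> bounded_ops" "selfadjoint A"
  shows "uop_adj (graph_of A) = graph_of A"
proof -
  interpret cdd_operator "graph_of A"
    by unfold_locales (rule closed_densely_defined_graph_of[OF assms(1)])
  have "(u, v) \<in> uop_adj (graph_of A) \<longleftrightarrow> (u, v) \<in> graph_of A" for u v
  proof -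
    have "(u, v) \<in> uop_adj (graph_of A) \<longleftrightarrow> (\<forall>x. x \<bullet> A u = x \<bullet> v)"
      using assms(2) by (simp add: mem_uop_adj_iff)
    also have "\<dots> \<longleftrightarrow> A u = v" by (rule vector_eq_ldot)
    finally show ?thesis by auto
  qed
  then show ?thesis by auto
qed

section \<open>Affiliation and membership of the resolvent in the algebra\<close>

context vna
begin

lemma iop_unitary: "unitary_bop iop"
  by (auto simp: unitary_bop_def iop_in_bounded_ops bop_adj_eq adj_op_iop blinfun.minus_left blinfun.minus_right
      iC_minus intro!: blinfun_eqI)

text \<open>The Cayley transform \<open>(B - i) (B + i)\<^sup>-\<^sup>1\<close> is a unitary in the commutant from which \<open>B\<close> can be
  recovered.\<close>

lemma commute_selfadjoint_if_commute_unitaries: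
  assumes A: "\<And>U x. U \<in> commutant M \<Longrightarrow> unitary_bop U \<Longrightarrow> blinfun_apply A (U x) = U (A x)"
    and B: "B \<in> commutant M" "selfadjoint B"
  shows "A (B x) = B (A x)"
proof -
  have Bb: "B \<in> bounded_ops" using B(1) by (simp add: commutant_def)
  have Bi: "B (iC x) = iC (B x)" for x using Bb by (simp add: bounded_ops_iff)
  have Ai: "A (iC x) = iC (A x)" for x using A[OF iop_in_commutant iop_unitary] by simp
  interpret selfadjoint_operator "graph_of B"
    by unfold_locales (simp_all add: closed_densely_defined_graph_of uop_adj_graph_of Bb B(2))
  obtain C :: "'h bop" where "\<And>w. (C w, w - iC (C w)) \<in> graph_of B" "\<And>x y. (x, y) \<in> graph_of B \<Longrightarrow> C (y + iC x) = x"
    by (rule resolvent) blast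
  then have BC: "B (C w) = w - iC (C w)" and CB: "C (B x + iC x) = x" for w x by simp_all
  have Ccomm: "C (X w) = X (C w)" if "\<And>x. X (B x) = B (X x)" "\<And>x. X (iC x) = iC (X x)"
    for X :: "'h bop" and w
  proof -
    have "X w = X (B (C w) + iC (C w))" by (simp add: BC)
    also have "\<dots> = B (X (C w)) + iC (X (C w))" by (simp add: blinfun.add_right that)
    finally show ?thesis by (simp add: CB)
  qed
  have Ci: "C (iC w) = iC (C w)" for w using Ccomm[of iop] by (simp add: Bi)
  have Cb: "C \<in> bounded_ops" by (simp add: bounded_ops_iff Ci)
  have CM: "C \<in> commutant M"
    unfolding commutant_def
  proof safe
    show "C \<in> bounded_ops" by (rule Cb)
    fix X assume "X \<in> M"
    then show "X o\<^sub>L C = C o\<^sub>L X"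
      by (intro blinfun_eqI) (simp add: Ccomm commutant_commute[OF _ B(1)] iC_commute)
  qed
  \<comment> \<open>\<open>adj_op C\<close> is the inverse of \<open>B - i\<close>; this and the
    next fact are its two halves.\<close>
  have aC1: "adj_op C (B x - iC x) = x" for x
  proof (rule vector_eq_rdot[THEN iffD1], rule allI)
    fix z
    have "adj_op C (B x - iC x) \<bullet> z = (B x - iC x) \<bullet> C z" using adj_op[of "adj_op C"] by simp
    also have "\<dots> = x \<bullet> (B (C z) + iC (C z))"
      using B(2) by (simp add: inner_diff_left inner_add_right inner_iC_left)
    finally show "adj_op C (B x - iC x) \<bullet> z = x \<bullet> z" by (simp add: BC)
  qed
  have aC2: "B (adj_op C w) - iC (adj_op C w) = w" for w
  proof (rule vector_eq_rdot[THEN iffD1], rule allI)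
    fix x
    have "(B (adj_op C w) - iC (adj_op C w)) \<bullet> x = adj_op C w \<bullet> (B x + iC x)"
      using B(2) by (simp add: inner_diff_left inner_add_right inner_iC_left)
    also have "\<dots> = w \<bullet> C (B x + iC x)" using adj_op[of "adj_op C"] by simp
    finally show "(B (adj_op C w) - iC (adj_op C w)) \<bullet> x = w \<bullet> x" by (simp add: CB)
  qed
  \<comment> \<open>\<open>1 - 2 i C\<close> is the Cayley transform because
    \<open>B - i = (B + i) - 2 i\<close>; its adjoint is \<open>1 + 2 i adj_op C\<close>.\<close>
  define U where "U = id_blinfun - (2::real) *\<^sub>R (iop o\<^sub>L C)"
  have U: "U w = w - 2 *\<^sub>R iC (C w)" for w by (simp add: U_def blinfun.diff_left blinfun.scaleR_left)
  have Ub: "U \<in> bounded_ops"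
    by (simp add: bounded_ops_iff U Ci iC_diff iC_scaleR iC_minus)
  have UM: "U \<in> commutant M"
    unfolding commutant_def
  proof safe
    show "U \<in> bounded_ops" by (rule Ub)
    fix X assume "X \<in> M"
    then show "X o\<^sub>L U = U o\<^sub>L X"
      by (intro blinfun_eqI)
        (simp add: U blinfun.diff_right blinfun.scaleR_right iC_commute commutant_commute[OF _ CM])
  qed
  have aCi: "adj_op C (iC w) = iC (adj_op C w)" for w
    using adj_op_bounded_ops[OF Cb] by (simp add: bounded_ops_iff)
  have aU: "adj_op U w = w + 2 *\<^sub>R iC (adj_op C w)" for w
  proof -
    have "adj_op U = id_blinfun - (2::real) *\<^sub>R (adj_op C o\<^sub>L (- iop))"
      by (simp add: U_def adj_op_diff adj_op_scaleR adj_op_compose adj_op_iop adj_op_selfadjoint[THEN iffD2])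
    then show ?thesis
      by (simp add: blinfun.diff_left blinfun.scaleR_left blinfun.minus_left blinfun.minus_right aCi)
  qed
  have "unitary_bop U"
    unfolding unitary_bop_def bop_adj_eq[OF Ub]
  proof (intro conjI Ub blinfun_eqI)
    fix w
    have "U w = B (C w) - iC (C w)" by (simp add: U BC scaleR_2)
    then show "(adj_op U o\<^sub>L U) w = id_blinfun w"
      by (simp add: aU aC1) (simp add: BC scaleR_2)
    have "adj_op U w = B (adj_op C w) + iC (adj_op C w)"
      using aC2[of w] by (simp add: aU scaleR_2 algebra_simps)
    then have "U (adj_op U w) = B (adj_op C w) - iC (adj_op C w)" by (simp add: U CB scaleR_2)
    then show "(U o\<^sub>L adj_op U) w = id_blinfun w" by (simp add: aC2)
  qed
  then have AU: "A (U w) = U (A w)" for w using A[OF UM] by blast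
  have AC: "A (C w) = C (A w)" for w
  proof -
    have "iC (A (C w)) = iC (C (A w))"
      using AU[of w] by (simp add: U blinfun.diff_right blinfun.scaleR_right Ai)
    then have "iC (iC (A (C w))) = iC (iC (C (A w)))" by (simp only:)
    then show ?thesis by simp
  qed
  \<comment> \<open>\<open>B\<close> is recovered as the inverse of \<open>C\<close> minus
    multiplication by i, so commutation passes from \<open>C\<close> to \<open>B\<close>.\<close>
  have "A x = C (A (B x + iC x))" using AC[of "B x + iC x"] by (simp add: CB)
  then have "B (A x) = A (B x + iC x) - iC (A x)" by (metis BC)
  then show ?thesis by (simp add: blinfun.add_right Ai)
qed

text \<open>Affiliation tests unitaries, while \<open>memI\<close> asks for the whole commutant. The
  gap is closed by splitting \<open>B\<close> into the self-adjoint elements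
  \<open>B + adj_op B\<close> and \<open>i (B - adj_op B)\<close> of the commutant.\<close>

lemma mem_if_commute_unitaries:
  assumes A: "\<And>U x. U \<in> commutant M \<Longrightarrow> unitary_bop U \<Longrightarrow> blinfun_apply A (U x) = U (A x)"
  shows "A \<in> M"
proof (rule memI)
  fix B x assume B: "B \<in> commutant M"
  note aB = adj_in_commutant[OF B]
  have Bb: "B \<in> bounded_ops" "adj_op B \<in> bounded_ops" using B aB by (simp_all add: commutant_def)
  have BM: "B + adj_op B \<in> commutant M" "iop o\<^sub>L (B - adj_op B) \<in> commutant M"
    unfolding commutant_def
    using Bb commutant_commute[OF _ B] commutant_commute[OF _ aB]
    by (auto intro!: blinfun_eqI simp: bounded_ops_iff blinfun.bilinear_simps iC_add iC_diff iC_minus iC_commute)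
  have "adj_op (B + adj_op B) = B + adj_op B" by (simp add: adj_op_add)
  then have 1: "A ((B + adj_op B) x) = (B + adj_op B) (A x)"
    using commute_selfadjoint_if_commute_unitaries[OF A BM(1)] by (simp add: adj_op_selfadjoint)
  have "adj_op (iop o\<^sub>L (B - adj_op B)) = iop o\<^sub>L (B - adj_op B)"
    using Bb by (auto intro!: blinfun_eqI simp: adj_op_compose adj_op_diff adj_op_iop bounded_ops_iff
        blinfun.bilinear_simps iC_diff)
  then have "A ((iop o\<^sub>L (B - adj_op B)) x) = (iop o\<^sub>L (B - adj_op B)) (A x)"
    using commute_selfadjoint_if_commute_unitaries[OF A BM(2)] by (simp add: adj_op_selfadjoint)
  then have "iC (A ((B - adj_op B) x)) = iC ((B - adj_op B) (A x))"
    using A[OF iop_in_commutant iop_unitary] by simp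
  then have "iC (iC (A ((B - adj_op B) x))) = iC (iC ((B - adj_op B) (A x)))" by (simp only:)
  then have 2: "A ((B - adj_op B) x) = (B - adj_op B) (A x)" by simp
  have "2 *\<^sub>R A (B x) = A ((B + adj_op B) x) + A ((B - adj_op B) x)"
    by (simp add: blinfun.bilinear_simps scaleR_2)
  also have "\<dots> = 2 *\<^sub>R B (A x)" unfolding 1 2 by (simp add: blinfun.bilinear_simps scaleR_2)
  finally show "A (B x) = B (A x)" by simp
qed

text \<open>A unitary \<open>U\<close> of the commutant maps the graph of \<open>T\<close> into
  itself, so it carries the solution of \<open>(T + i) x = w\<close> to that for \<open>U w\<close>;
  uniqueness of solutions gives commutation.\<close>

lemma affiliated_resolvent_mem:
  assumes aff: "affiliated M T" and res: "\<And>w. (blinfun_apply A w, w - iC (A w)) \<in> T"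
    "\<And>x y. (x, y) \<in> T \<Longrightarrow> A (y + iC x) = x"
  shows "A \<in> M"
proof (rule mem_if_commute_unitaries)
  fix U x assume U: "U \<in> commutant M" "unitary_bop U"
  have "U \<in> bounded_ops" using U(1) by (simp add: commutant_def)
  then have Ui: "U (iC z) = iC (U z)" for z by (simp add: bounded_ops_iff)
  have "(U (A x), U (x - iC (A x))) \<in> T"
    using aff U res(1)[of x] unfolding affiliated_def by blast
  then have "A (U (x - iC (A x)) + iC (U (A x))) = U (A x)" by (rule res(2))
  then show "A (U x) = U (A x)" by (simp add: blinfun.diff_right Ui)
qed

end

section \<open>The two topologies on measurable operators\<close>

text \<open>Identifies the translate by the zero operator, through which neighbourhoods of 0 enter
  \<open>tau_l_topology\<close>.\<close>

lemma strong_sum_zero: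
  assumes "closed T"
  shows "strong_sum (graph_of 0) T = T"
proof -
  have "{(x, y + z) | x y z. (x, y) \<in> graph_of 0 \<and> (x, z) \<in> T} = T" by auto
  then show ?thesis using assms by (simp add: strong_sum_def)
qed

text \<open>The composition already has a closed graph, being the preimage of \<open>T\<close> under
  a continuous map.\<close>

lemma strong_prod_graph_of:
  assumes "closed T"
  shows "strong_prod T (graph_of Q) = {(x, z). (Q x, z) \<in> T}"
proof -
  have "{(x, z) | x y z. (x, y) \<in> graph_of Q \<and> (y, z) \<in> T} = {(x, z). (Q x, z) \<in> T}" by auto
  moreover have "{(x, z). (Q x, z) \<in> T} = (\<lambda>p. (Q (fst p), snd p)) -` T" by auto
  moreover have "closed \<dots>" by (intro closed_vimage assms continuous_intros)
  ultimately show ?thesis by (simp add: strong_prod_def)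
qed

context traced_vna
begin

section \<open>Measurable operators, cores and the order\<close>

abbreviation "S\<^sub>\<tau> \<equiv> tau_measurable_ops M \<tau>"
abbreviation "S\<^sub>h \<equiv> tau_measurable_sa M \<tau>"

lemma tau_measurable_cdd: "T \<in> S\<^sub>\<tau> \<Longrightarrow> cdd_operator T"
  by unfold_locales (simp add: tau_measurable_ops_def measurable_ops_def)

lemma tau_measurable_sa: "T \<in> S\<^sub>h \<Longrightarrow> T \<in> S\<^sub>\<tau>" "T \<in> S\<^sub>h \<Longrightarrow> selfadjoint_operator T"
  using tau_measurable_cdd unfolding tau_measurable_sa_def selfadjoint_operator_def
    selfadjoint_operator_axioms_def by blast+

lemma tau_measurable_proj:
  assumes "T \<in> S\<^sub>\<tau>" "0 < (\<epsilon>::real)"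
  obtains p where "p \<in> projections M" "\<And>x. p x = x \<Longrightarrow> x \<in> Domain T" "\<tau> (id_blinfun - p) < ennreal \<epsilon>"
proof -
  obtain p where p: "p \<in> projections M" "range (blinfun_apply p) \<subseteq> Domain T" "\<tau> (id_blinfun - p) < ennreal \<epsilon>"
    using assms unfolding tau_measurable_ops_def by blast
  have "x \<in> Domain T" if "p x = x" for x using p(2) that by (metis rangeI subsetD)
  then show ?thesis using p that by blast
qed

lemma graph_of_tau_measurable:
  assumes A: "A \<in> M"
  shows "graph_of A \<in> S\<^sub>\<tau>"
proof -
  have cdd: "closed_densely_defined (graph_of A)"
    by (rule closed_densely_defined_graph_of[OF in_bounded_ops[OF A]])
  have aff: "affiliated M (graph_of A)"
    using commutant_commute[OF A] by (auto simp: affiliated_def graph_of_def)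
  have dom: "Domain (graph_of A) = UNIV" by (auto simp: graph_of_def)
  \<comment> \<open>The constant sequence \<open>I\<close> witnesses measurability; its complements
    are 0, which has to be a finite projection.\<close>
  have "finite_projection M 0"
    unfolding finite_projection_def
  proof (intro conjI ballI impI zero_proj)
    fix Q assume Q: "Q \<in> projections M" "bop_le Q 0 \<and> mvn_equiv M Q 0"
    have "bop_le 0 Q" unfolding proj_le_iff(1)[OF zero_proj Q(1)] by simp
    then show "Q = 0" using projections_eqI[OF Q(1) zero_proj] Q(2) by blast
  qed
  moreover have "bop_le (id_blinfun :: 'h bop) id_blinfun" unfolding proj_le_iff(1)[OF id_proj id_proj] by simp
  ultimately have "graph_of A \<in> measurable_ops M"
    unfolding measurable_ops_def using cdd aff id_proj
    by (auto intro!: exI[of _ "\<lambda>_. id_blinfun"] simp: dom is_lub_in_def)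
  moreover have "\<exists>P\<in>projections M. range (blinfun_apply P) \<subseteq> Domain (graph_of A) \<and>
      \<tau> (id_blinfun - P) < ennreal \<epsilon>" if "0 < \<epsilon>" for \<epsilon> :: real
    using that by (intro bexI[of _ id_blinfun] id_proj) (simp add: dom trace_0)
  ultimately show ?thesis by (simp add: tau_measurable_ops_def)
qed

lemma graph_of_tau_measurable_sa: "A \<in> M \<Longrightarrow> selfadjoint A \<Longrightarrow> graph_of A \<in> S\<^sub>h"
  using graph_of_tau_measurable uop_adj_graph_of[OF in_bounded_ops] by (simp add: tau_measurable_sa_def)

text \<open>With \<open>A\<close> the resolvent of \<open>R\<close>, it suffices that the
  \<open>w\<close> with \<open>A w\<close> in the domain of \<open>T\<close> are dense; the graph
  points are then \<open>(A w, w - iC (A w))\<close>. The projection onto the complement of a set of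
  such \<open>w\<close> has trace at most \<open>\<tau> (id_blinfun - p n)\<close> for every
  \<open>n\<close>, hence is 0 by faithfulness.\<close>

lemma domain_core:
  assumes R: "R \<in> S\<^sub>h" and T: "T \<in> S\<^sub>\<tau>" and xz: "(x, z) \<in> R"
  obtains u v where "u \<longlonglongrightarrow> x" "v \<longlonglongrightarrow> z" "\<And>n::nat. (u n, v n) \<in> R" "\<And>n. u n \<in> Domain T"
proof -
  interpret R: selfadjoint_operator R by (rule tau_measurable_sa(2)[OF R])
  interpret T: cdd_operator T by (rule tau_measurable_cdd[OF T])
  obtain A :: "'h bop" where A1: "\<And>w. (A w, w - iC (A w)) \<in> R" and A2: "\<And>x y. (x, y) \<in> R \<Longrightarrow> A (y + iC x) = x"
    by (rule R.resolvent) blast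
  have "affiliated M R" using R by (simp add: tau_measurable_sa_def tau_measurable_ops_def measurable_ops_def)
  then have AM: "A \<in> M" using A1 A2 by (rule affiliated_resolvent_mem)
  define W where "W = {w. A w \<in> Domain T}"
  have W: "subspace W"
    unfolding subspace_def
  proof (intro conjI ballI allI)
    show "0 \<in> W" using T.zero by (auto simp: W_def)
    show "c *\<^sub>R x \<in> W" if "x \<in> W" for c x
      using that T.scaleR by (auto simp: W_def blinfun.scaleR_right)
    show "x + y \<in> W" if "x \<in> W" "y \<in> W" for x y
      using that by (auto simp: W_def blinfun.add_right Domain_iff) (blast intro: T.add)
  qed
  have "\<forall>n. \<exists>p. p \<in> projections M \<and> (\<forall>x. p x = x \<longrightarrow> x \<in> Domain T) \<and>
      \<tau> (id_blinfun - p) < ennreal (1 / real (Suc n))"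
  proof
    fix n
    obtain p where "p \<in> projections M" "\<And>x. p x = x \<Longrightarrow> x \<in> Domain T"
      "\<tau> (id_blinfun - p) < ennreal (1 / real (Suc n))"
      by (rule tau_measurable_proj[OF T, of "1 / real (Suc n)"]) auto
    then show "\<exists>p. p \<in> projections M \<and> (\<forall>x. p x = x \<longrightarrow> x \<in> Domain T) \<and>
      \<tau> (id_blinfun - p) < ennreal (1 / real (Suc n))" by blast
  qed
  then obtain p where p: "\<And>n. p n \<in> projections M" "\<And>n x. p n x = x \<Longrightarrow> x \<in> Domain T"
    "\<And>n. \<tau> (id_blinfun - p n) < ennreal (1 / real (Suc n))" by metis
  \<comment> \<open>Defined through elements of \<open>M\<close> alone, this subset of
    \<open>W\<close> is stable under the whole commutant, so its orthogonal complement gives a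
    projection in \<open>M\<close>. A complement can be taken whether or not the set is a
    subspace.\<close>
  define W' where "W' = {w. \<exists>n. p n (A w) = A w}"
  define K where "K = {v. \<forall>w\<in>W'. v \<bullet> w = 0}"
  have K: "subspace K" "closed K"
    unfolding K_def by (rule subspace_orthogonal_complement closed_orthogonal_complement)+
  have N: "orth_proj K \<in> projections M"
  proof (rule orth_proj_in_projections[OF K])
    fix B v assume B: "B \<in> commutant M" and v: "v \<in> K"
    have "adj_op B w \<in> W'" if w: "w \<in> W'" for w
    proof -
      obtain n where n: "p n (A w) = A w" using w by (auto simp: W'_def)
      have "p n (A (adj_op B w)) = A (adj_op B w)"
        by (simp add: n commutant_commute[OF AM adj_in_commutant[OF B]]
            commutant_commute[OF proj_mem[OF p(1)] adj_in_commutant[OF B]])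
      then show ?thesis by (auto simp: W'_def)
    qed
    then show "B v \<in> K" using v by (simp add: K_def adj_op)
  qed
  have "\<tau> (orth_proj K) \<le> ennreal (1 / real (Suc n))" for n
  proof -
    note q = proj_complement[OF p(1)[of n]]
    \<comment> \<open>If \<open>(id_blinfun - p n) o\<^sub>L A\<close> kills a vector of
      \<open>K\<close>, that vector is also in \<open>W'\<close> and thus orthogonal to
      itself.\<close>
    have "\<tau> (orth_proj K) \<le> \<tau> (id_blinfun - p n)"
    proof (rule trace_le_if_injective[OF compose_mem[OF proj_mem[OF q] AM] q N])
      show "(id_blinfun - p n) (((id_blinfun - p n) o\<^sub>L A) x) = ((id_blinfun - p n) o\<^sub>L A) x" for x
        using proj_idem[OF q] by simp
      fix x assume x: "orth_proj K x = x" "((id_blinfun - p n) o\<^sub>L A) x = 0"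
      then have "x \<in> K" using orth_proj_eq_self_iff[OF K] by blast
      moreover have "x \<in> W'" using x(2) by (auto simp: W'_def blinfun.diff_left intro!: exI[of _ n])
      ultimately have "x \<bullet> x = 0" by (simp add: K_def)
      then show "x = 0" by simp
    qed
    then show ?thesis using p(3)[of n] by simp
  qed
  moreover have "(\<lambda>n. ennreal (1 / real (Suc n))) \<longlonglongrightarrow> ennreal 0"
    by (intro tendsto_ennrealI LIMSEQ_Suc[OF lim_1_over_n])
  ultimately have "\<tau> (orth_proj K) \<le> ennreal 0" by (intro LIMSEQ_le_const) auto
  then have K0: "orth_proj K = 0" by (intro proj_eq_0_if_trace_0[OF N]) simp
  have "closure W = UNIV"
  proof (rule dense_if_orthogonal_trivial[OF W])
    fix v assume v: "\<And>k. k \<in> W \<Longrightarrow> v \<bullet> k = 0"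
    have "W' \<subseteq> W" using p(2) by (auto simp: W'_def W_def)
    then have "v \<in> K" using v by (auto simp: K_def)
    then show "v = 0" using orth_proj_eq_self_iff[OF K] K0 by (metis zero_blinfun.rep_eq)
  qed
  then obtain w where w: "\<And>n::nat. w n \<in> W" "w \<longlonglongrightarrow> z + iC x"
    using closure_sequential[of "z + iC x" W] by auto
  have Aw: "(\<lambda>n. A (w n)) \<longlonglongrightarrow> x"
    using bounded_linear.tendsto[OF blinfun.bounded_linear_right w(2), of A] A2[OF xz] by simp
  show ?thesis
  proof (rule that[OF Aw])
    have "(\<lambda>n. w n - iC (A (w n))) \<longlonglongrightarrow> (z + iC x) - iC x"
      by (intro tendsto_diff w bounded_linear.tendsto[OF bounded_linear_iC] Aw)
    then show "(\<lambda>n. w n - iC (A (w n))) \<longlonglongrightarrow> z" by simp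
    show "(A (w n), w n - iC (A (w n))) \<in> R" for n by (rule A1)
    show "A (w n) \<in> Domain T" for n using w(1) by (simp add: W_def)
  qed
qed

text \<open>On the common domain of \<open>R\<close> and \<open>T\<close> the two inequalities add
  up; \<open>domain_core\<close> extends the sum to the whole domain of \<open>R\<close>, since
  \<open>F\<close> is continuous.\<close>

lemma bounded_uop_le_trans:
  assumes T: "T \<in> S\<^sub>\<tau>" and R: "R \<in> S\<^sub>h" and FT: "uop_le (graph_of F) T" and TR: "uop_le T R"
  shows "uop_le (graph_of F) R"
proof (rule uop_leI)
  fix x z y assume xz: "(x, z) \<in> R" and "(x, y) \<in> graph_of F"
  then have y: "y = F x" by simp
  obtain u v where u: "u \<longlonglongrightarrow> x" and v: "v \<longlonglongrightarrow> z" and R': "\<And>n::nat. (u n, v n) \<in> R"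
    and dom: "\<And>n. u n \<in> Domain T"
    by (rule domain_core[OF R T xz]) blast
  have "cinner (v n - F (u n)) (u n) \<in> \<real>\<^sub>\<ge>\<^sub>0" for n
  proof -
    obtain t where t: "(u n, t) \<in> T" using dom by blast
    have "cinner (v n - t) (u n) \<in> \<real>\<^sub>\<ge>\<^sub>0" by (rule uop_leD[OF TR R' t])
    moreover have "cinner (t - F (u n)) (u n) \<in> \<real>\<^sub>\<ge>\<^sub>0" by (rule uop_leD[OF FT t]) simp
    ultimately have "cinner (v n - t) (u n) + cinner (t - F (u n)) (u n) \<in> \<real>\<^sub>\<ge>\<^sub>0"
      by (rule nonneg_Reals_add_I)
    then show ?thesis by (simp flip: cinner_add_left)
  qed
  then have "(u n, v n - F (u n)) \<in> {p. cinner (snd p) (fst p) \<in> \<real>\<^sub>\<ge>\<^sub>0}" for n by simp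
  moreover have "(\<lambda>n. (u n, v n - F (u n))) \<longlonglongrightarrow> (x, z - F x)"
    by (intro tendsto_intros u v)
  ultimately have "(x, z - F x) \<in> {p. cinner (snd p) (fst p) \<in> \<real>\<^sub>\<ge>\<^sub>0}"
    by (rule closed_sequentially[OF cinner_nonneg_closed])
  then show "cinner (z - y) x \<in> \<real>\<^sub>\<ge>\<^sub>0" by (simp add: y)
qed

text \<open>A Hellinger-Toeplitz argument: \<open>p R p\<close> is symmetric and everywhere defined,
  so the functionals given by \<open>p R p x\<close>, for \<open>x\<close> in the unit ball, are
  bounded at \<open>u\<close> by the norm of \<open>R p u\<close>, and therefore uniformly
  bounded.\<close>

lemma quadratic_form_bounded:
  assumes R: "selfadjoint_operator R" and p: "p \<in> projections M" "\<And>x. p x = x \<Longrightarrow> x \<in> Domain R"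
  obtains C where "\<And>x y. p x = x \<Longrightarrow> (x, y) \<in> R \<Longrightarrow> y \<bullet> x \<le> C * (x \<bullet> x)"
proof -
  interpret selfadjoint_operator R by (rule R)
  have "\<exists>y. (p x, y) \<in> R" for x using p(2)[OF proj_idem[OF p(1)]] by blast
  then obtain g where g: "\<And>x. (p x, g x) \<in> R" by metis
  \<comment> \<open>The value 0 outside the unit ball lets the family be indexed by the whole
    type.\<close>
  define f where "f = (\<lambda>x. if norm x \<le> 1 then blinfun_inner_right (p (g x)) else 0)"
  have "\<exists>C. \<forall>x. norm (f x u) \<le> C" for u
  proof (intro exI[of _ "norm (g u)"] allI)
    fix x
    show "norm (f x u) \<le> norm (g u)"
    proof (cases "norm x \<le> 1")
      case True
      have "f x u = g x \<bullet> p u"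
        using True proj_selfadjoint[OF p(1)] by (simp add: f_def blinfun_inner_right.rep_eq)
      also have "\<dots> = p x \<bullet> g u" by (rule symmetric[OF g g])
      finally have "norm (f x u) \<le> norm (p x) * norm (g u)" using Cauchy_Schwarz_ineq2 by simp
      also have "\<dots> \<le> 1 * norm (g u)"
        using True proj_norm_le[OF p(1), of x] by (intro mult_right_mono) auto
      finally show ?thesis by simp
    qed (simp add: f_def)
  qed
  then obtain C where C: "\<And>x. norm (f x) \<le> C" using uniform_boundedness[of f] by blast
  have "y \<bullet> x \<le> C * (x \<bullet> x)" if x: "p x = x" "(x, y) \<in> R" for x y
  proof (cases "x = 0")
    case False
    define s where "s = inverse (norm x)"
    have s: "s > 0" using False by (simp add: s_def)
    have "p (s *\<^sub>R x) = s *\<^sub>R x" using x(1) by (simp add: blinfun.scaleR_right)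
    then have gs: "g (s *\<^sub>R x) = s *\<^sub>R y"
      using unique[OF _ scaleR[OF x(2), of s]] g[of "s *\<^sub>R x"] by simp
    have "norm (s *\<^sub>R x) \<le> 1" using False by (simp add: s_def)
    then have "f (s *\<^sub>R x) x = s * (y \<bullet> x)"
      using proj_selfadjoint[OF p(1)] x(1) by (simp add: f_def blinfun_inner_right.rep_eq gs)
    moreover have "norm (f (s *\<^sub>R x) x) \<le> C * norm x"
      by (rule order_trans[OF norm_blinfun mult_right_mono[OF C norm_ge_zero]])
    ultimately have "s * (y \<bullet> x) \<le> C * norm x" by simp
    then show ?thesis using False
      by (simp add: s_def field_simps power2_eq_square flip: power2_norm_eq_inner)
  qed simp
  then show ?thesis by (rule that)
qed

text \<open>The bound is uniform in \<open>n\<close> because \<open>p\<close> and the form bound on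
  its range depend on \<open>R\<close> alone. As \<open>\<tau> (P n)\<close> exceeds
  \<open>\<tau> (id_blinfun - p)\<close>, the ranges of \<open>P n\<close> and \<open>p\<close>
  share a nonzero vector, at which the forms are compared.\<close>

lemma scaled_proj_le_bounded:
  assumes R: "R \<in> S\<^sub>h" and P: "\<And>n. P n \<in> projections M" "\<And>n. 1 \<le> \<tau> (P n)"
  obtains C where "\<And>n c. uop_le (graph_of (c *\<^sub>R P n)) R \<Longrightarrow> c \<le> C"
proof -
  note saR = tau_measurable_sa(2)[OF R]
  obtain p where p: "p \<in> projections M" "\<And>x. p x = x \<Longrightarrow> x \<in> Domain R" "\<tau> (id_blinfun - p) < ennreal 1"
    by (rule tau_measurable_proj[OF tau_measurable_sa(1)[OF R], of 1]) auto
  obtain C where C: "\<And>x y. p x = x \<Longrightarrow> (x, y) \<in> R \<Longrightarrow> y \<bullet> x \<le> C * (x \<bullet> x)"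
    by (rule quadratic_form_bounded[OF saR p(1,2)]) blast+
  have "c \<le> C" if le: "uop_le (graph_of (c *\<^sub>R P n)) R" for n c
  proof -
    note q = proj_complement[OF p(1)]
    have "\<exists>x. P n x = x \<and> (id_blinfun - p) x = 0 \<and> x \<noteq> 0"
    proof (rule ccontr)
      assume "\<not> ?thesis"
      then have "\<tau> (P n) \<le> \<tau> (id_blinfun - p)"
        by (intro trace_le_if_injective[OF proj_mem[OF q] q P(1) proj_idem[OF q]]) blast
      then show False using p(3) P(2)[of n] by (simp add: not_less[symmetric])
    qed
    then obtain x where x: "P n x = x" "p x = x" "x \<noteq> 0" by (auto simp: blinfun.diff_left)
    then obtain y where y: "(x, y) \<in> R" using p(2) by blast
    have "cinner (y - c *\<^sub>R x) x \<in> \<real>\<^sub>\<ge>\<^sub>0" by (rule uop_leD[OF le y]) (simp add: x blinfun.scaleR_left)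
    then have "c * (x \<bullet> x) \<le> y \<bullet> x" by (simp add: cinner_nonneg_iff inner_diff_left)
    also have "\<dots> \<le> C * (x \<bullet> x)" by (rule C[OF x(2) y])
    finally show ?thesis using x(3) by simp
  qed
  then show ?thesis by (rule that)
qed

text \<open>The growth of \<open>c\<close> confines the indices of the scaled projections below
  \<open>R a0\<close> to a finite set, and this is what lets directedness single out one index for
  the whole upper net.\<close>

lemma o_open_not_above:
  fixes c :: "nat \<Rightarrow> real"
  assumes P: "\<And>n. P n \<in> projections M" "\<And>n. 1 \<le> \<tau> (P n)" and c: "\<And>C. finite {n. c n \<le> C}"
  shows "openin (o_topology M \<tau>) {T \<in> S\<^sub>h. \<forall>n. \<not> uop_le (graph_of (c n *\<^sub>R P n)) T}"
  unfolding o_topology_strongest(3)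
proof (intro conjI allI impI)
  let ?W = "{T \<in> S\<^sub>h. \<forall>n. \<not> uop_le (graph_of (c n *\<^sub>R P n)) T}"
  let ?F = "\<lambda>n. graph_of (c n *\<^sub>R P n)"
  show "?W \<subseteq> S\<^sub>h" by blast
  fix A :: "('h uop \<times> 'h uop \<times> 'h uop) set" and le T t
  assume "o_converges M \<tau> A le T t \<and> t \<in> ?W"
  then have conv: "o_converges M \<tau> A le T t" and tW: "t \<in> ?W" by blast+
  have dir: "directed_set A le" and TH: "T ` A \<subseteq> S\<^sub>h"
    using conv unfolding o_converges_def by simp_all
  obtain S R where "S ` A \<subseteq> S\<^sub>h" and RH: "R ` A \<subseteq> S\<^sub>h"
    and STR: "\<forall>a\<in>A. uop_le (S a) (T a) \<and> uop_le (T a) (R a)"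
    and "monotone_on A le uop_le S" and "is_lub_in S\<^sub>h uop_le (S ` A) t"
    and R: "monotone_on A le (\<lambda>X Y. uop_le Y X) R"
    and Rlub: "is_lub_in S\<^sub>h (\<lambda>X Y. uop_le Y X) (R ` A) t"
    using conv unfolding o_converges_def by (elim conjE exE) (rule that)
  have TR: "uop_le (T a) (R a)" if "a \<in> A" for a using STR that by blast
  \<comment> \<open>Domination passes from an index to every earlier one, because the upper net
    decreases.\<close>
  have FR: "uop_le (?F n) (R a)" if "a \<in> A" "b \<in> A" "le a b" "uop_le (?F n) (R b)" for n a b
  proof (rule bounded_uop_le_trans[OF _ _ that(4)])
    show "R b \<in> S\<^sub>\<tau>" using RH that(2) tau_measurable_sa(1) by blast
    show "R a \<in> S\<^sub>h" using RH that(1) by blast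
    show "uop_le (R b) (R a)" using monotone_onD[OF R that(1-3)] .
  qed
  show "eventually (\<lambda>a. T a \<in> ?W) (net_filter A le)"
  proof (rule ccontr)
    assume "\<not> ?thesis"
    then have freq0: "\<forall>a\<in>A. \<exists>b\<in>A. le a b \<and> T b \<notin> ?W"
      unfolding eventually_net_filter[OF dir] by blast
    have freq: "\<exists>b\<in>A. le a b \<and> (\<exists>n. uop_le (?F n) (R b))" if a: "a \<in> A" for a
    proof -
      obtain b where b: "b \<in> A" "le a b" "T b \<notin> ?W" using freq0 a by blast
      have Tb: "T b \<in> S\<^sub>h" and Rb: "R b \<in> S\<^sub>h" using b(1) TH RH by auto
      then obtain n where "uop_le (?F n) (T b)" using b(3) by blast
      then have "uop_le (?F n) (R b)"
        by (rule bounded_uop_le_trans[OF tau_measurable_sa(1)[OF Tb] Rb _ TR[OF b(1)]])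
      then show ?thesis using b by blast
    qed
    obtain a0 where a0: "a0 \<in> A" using dir by (auto simp: directed_set_def)
    have Ra0: "R a0 \<in> S\<^sub>h" using RH a0 by blast
    obtain C where C: "\<And>n d. uop_le (graph_of (d *\<^sub>R P n)) (R a0) \<Longrightarrow> d \<le> C"
      by (rule scaled_proj_le_bounded[of "R a0" P, OF Ra0 P]) blast
    define I where "I = {n. c n \<le> C}"
    have fin: "finite I" unfolding I_def by (rule c)
    have "\<exists>n\<in>I. \<forall>a\<in>A. uop_le (?F n) (R a)"
    proof (rule ccontr)
      assume "\<not> ?thesis"
      then have "\<forall>n\<in>I. \<exists>a\<in>A. \<not> uop_le (?F n) (R a)" by blast
      then obtain h where h: "\<And>n. n \<in> I \<Longrightarrow> h n \<in> A \<and> \<not> uop_le (?F n) (R (h n))" by metis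
      \<comment> \<open>Directedness gives an index above \<open>a0\<close> and above the finitely
        many counterexamples \<open>h n\<close>.\<close>
      have "\<exists>a\<in>A. le a0 a \<and> (\<forall>n\<in>J. le (h n) a)" if "finite J" "J \<subseteq> I" for J
        using that
      proof (induction J rule: finite_induct)
        case empty
        then show ?case using dir a0 by (auto simp: directed_set_def dest: reflp_onD)
      next
        case (insert n J)
        then obtain a where a: "a \<in> A" "le a0 a" "\<forall>n\<in>J. le (h n) a" by blast
        obtain b where b: "b \<in> A" "le a b" "le (h n) b"
          using dir a(1) h[of n] insert.prems unfolding directed_set_def by blast
        have tr: "le u b" if "u \<in> A" "le u a" for u
          using dir that a(1) b(1,2) unfolding directed_set_def by (meson transp_onD)
        have "le (h m) b" if "m \<in> J" for m using tr[of "h m"] a(3) h insert.prems that by blast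
        then have "\<forall>m\<in>insert n J. le (h m) b" using b(3) by blast
        then show ?case using tr[OF a0 a(2)] b(1) by blast
      qed
      from this[OF fin order_refl] obtain a where a: "a \<in> A" "le a0 a" "\<forall>n\<in>I. le (h n) a" by blast
      \<comment> \<open>The \<open>n\<close> found beyond \<open>a\<close> belongs to
        \<open>I\<close> by comparison with \<open>R a0\<close>, yet \<open>?F n\<close> then lies
        below \<open>R (h n)\<close>, contrary to the choice of \<open>h\<close>.\<close>
      obtain b n where b: "b \<in> A" "le a b" "uop_le (?F n) (R b)" using freq[OF a(1)] by blast
      have Fa: "uop_le (?F n) (R a)" by (rule FR[OF a(1) b])
      then have "uop_le (?F n) (R a0)" by (rule FR[OF a0 a(1,2)])
      then have n: "n \<in> I" using C by (simp add: I_def)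
      then have "uop_le (?F n) (R (h n))" using FR[OF _ a(1) _ Fa] h a(3) by blast
      then show False using h n by blast
    qed
    then obtain n where n: "\<forall>a\<in>A. uop_le (?F n) (R a)" by blast
    have "c n *\<^sub>R P n \<in> M" "selfadjoint (c n *\<^sub>R P n)"
      using proj_selfadjoint[OF P(1)] by (simp_all add: scaleR_mem proj_mem[OF P(1)] blinfun.scaleR_left)
    then have "?F n \<in> S\<^sub>h" by (rule graph_of_tau_measurable_sa)
    then have "uop_le (?F n) t" using Rlub n unfolding is_lub_in_def by blast
    then show False using tW by blast
  qed
qed

text \<open>Makes the open sets stable under intersection. The join \<open>J\<close> serves both
  projections: if \<open>Q\<close> is a witness for \<open>J\<close>, the meet of \<open>Q\<close>
  with \<open>P\<^sub>1\<close> or \<open>P\<^sub>2\<close> is one for that projection, at no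
  greater loss of trace.\<close>

lemma tau_l_nhd_inter:
  assumes P: "P\<^sub>1 \<in> projections M" "P\<^sub>2 \<in> projections M" "\<tau> P\<^sub>1 < \<infinity>" "\<tau> P\<^sub>2 < \<infinity>"
    and pos: "0 < \<epsilon>\<^sub>1" "0 < \<epsilon>\<^sub>2" "0 < \<delta>\<^sub>1" "0 < \<delta>\<^sub>2"
  shows "\<exists>\<epsilon>>0. \<exists>\<delta>>0. \<exists>P\<in>projections M. \<tau> P < \<infinity> \<and>
    tau_l_nhd M \<tau> \<epsilon> \<delta> P \<subseteq> tau_l_nhd M \<tau> \<epsilon>\<^sub>1 \<delta>\<^sub>1 P\<^sub>1 \<inter> tau_l_nhd M \<tau> \<epsilon>\<^sub>2 \<delta>\<^sub>2 P\<^sub>2"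
proof -
  obtain J where J: "J \<in> projections M" "bop_le P\<^sub>1 J" "bop_le P\<^sub>2 J" "\<tau> J \<le> \<tau> P\<^sub>1 + \<tau> P\<^sub>2"
    by (rule trace_join_le[OF P(1,2)]) blast
  have "\<tau> P\<^sub>1 + \<tau> P\<^sub>2 < \<infinity>" using P(3,4) by simp
  then have tJ: "\<tau> J < \<infinity>" using J(4) by (rule le_less_trans[rotated])
  have sub: "T \<in> tau_l_nhd M \<tau> \<epsilon> \<delta> P"
    if T: "T \<in> tau_l_nhd M \<tau> \<epsilon>' \<delta>' J" and P: "P \<in> projections M" "bop_le P J" and le: "\<epsilon>' \<le> \<epsilon>" "\<delta>' \<le> \<delta>"
    for T \<epsilon> \<epsilon>' \<delta> \<delta>' P
  proof -
    obtain Q B where TS: "T \<in> S\<^sub>\<tau>" and Q: "Q \<in> projections M" "bop_le Q J" "\<tau> (J - Q) \<le> ennreal \<delta>'"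
      and B: "B \<in> M" "strong_prod T (graph_of Q) = graph_of B" "norm B \<le> \<epsilon>'"
      using T unfolding tau_l_nhd_def by blast
    interpret T: cdd_operator T by (rule tau_measurable_cdd[OF TS])
    obtain R where R: "R \<in> projections M" "bop_le R P" "bop_le R Q"
      and Rfix: "\<And>x. P x = x \<Longrightarrow> Q x = x \<Longrightarrow> R x = x"
      by (rule proj_meet[OF P(1) Q(1)]) blast
    have JQ: "J - Q \<in> projections M" by (rule proj_diff[OF Q(1) J(1) Q(2)])
    have PR: "P - R \<in> projections M" by (rule proj_diff[OF R(1) P(1) R(2)])
    \<comment> \<open>A vector in the range of \<open>P - R\<close> that \<open>J - Q\<close> kills
      is fixed by \<open>P\<close> and \<open>Q\<close>, hence by \<open>R\<close>, which also kills
      it.\<close>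
    have "\<tau> (P - R) \<le> \<tau> (J - Q)"
    proof (rule trace_le_if_injective[OF proj_mem[OF JQ] JQ PR proj_idem[OF JQ]])
      fix x assume x: "(P - R) x = x" "(J - Q) x = 0"
      have rp: "P (R y) = R y" "R (P y) = R y" for y using R(2) proj_le_iff[OF R(1) P(1)] by blast+
      have "P ((P - R) x) = (P - R) x" "R ((P - R) x) = 0"
        using proj_idem[OF P(1)] proj_idem[OF R(1)] by (simp_all add: blinfun.diff_left blinfun.diff_right rp)
      then have Px: "P x = x" and Rx: "R x = 0" by (simp_all only: x(1))
      have "J (P x) = P x" using P(2) proj_le_iff(1)[OF P(1) J(1)] by blast
      then have "Q x = x" using x(2) by (simp add: Px blinfun.diff_left)
      then show "x = 0" using Rfix[OF Px] Rx by simp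
    qed
    also have "\<dots> \<le> ennreal \<delta>" using Q(3) le(2) by (meson ennreal_leI order_trans)
    finally have tr: "\<tau> (P - R) \<le> ennreal \<delta>" .
    have BT: "(Q x, B x) \<in> T" for x
    proof -
      have "(x, B x) \<in> strong_prod T (graph_of Q)" by (simp add: B(2))
      then show ?thesis by (simp add: strong_prod_graph_of[OF T.closed])
    qed
    have QR: "Q (R x) = R x" for x using R(3) proj_le_iff(1)[OF R(1) Q(1)] by blast
    have "strong_prod T (graph_of R) = graph_of (B o\<^sub>L R)"
    proof -
      have "(R x, z) \<in> T \<longleftrightarrow> z = B (R x)" for x z
        using BT[of "R x"] T.unique by (auto simp: QR)
      then show ?thesis by (auto simp: strong_prod_graph_of[OF T.closed])
    qed
    moreover have "norm (B o\<^sub>L R) \<le> \<epsilon>"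
    proof -
      have "norm R \<le> 1" by (rule norm_blinfun_bound) (simp_all add: proj_norm_le[OF R(1)])
      then have "norm B * norm R \<le> norm B * 1" by (intro mult_left_mono) simp_all
      then show ?thesis using norm_blinfun_compose[of B R] B(3) le(1) by simp
    qed
    moreover have "B o\<^sub>L R \<in> M" by (intro compose_mem B proj_mem R)
    ultimately show ?thesis unfolding tau_l_nhd_def using TS R(1,2) tr by blast
  qed
  have "tau_l_nhd M \<tau> (min \<epsilon>\<^sub>1 \<epsilon>\<^sub>2) (min \<delta>\<^sub>1 \<delta>\<^sub>2) J \<subseteq> tau_l_nhd M \<tau> \<epsilon>\<^sub>1 \<delta>\<^sub>1 P\<^sub>1 \<inter> tau_l_nhd M \<tau> \<epsilon>\<^sub>2 \<delta>\<^sub>2 P\<^sub>2"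
    using sub[OF _ P(1) J(2), of _ "min \<epsilon>\<^sub>1 \<epsilon>\<^sub>2" "min \<delta>\<^sub>1 \<delta>\<^sub>2" \<epsilon>\<^sub>1 \<delta>\<^sub>1]
      sub[OF _ P(2) J(3), of _ "min \<epsilon>\<^sub>1 \<epsilon>\<^sub>2" "min \<delta>\<^sub>1 \<delta>\<^sub>2" \<epsilon>\<^sub>2 \<delta>\<^sub>2] by auto
  then show ?thesis
    using pos J(1) tJ by (intro exI[of _ "min \<epsilon>\<^sub>1 \<epsilon>\<^sub>2"] exI[of _ "min \<delta>\<^sub>1 \<delta>\<^sub>2"] conjI bexI[of _ J]) auto
qed

text \<open>\<open>topology\<close> has the intended open sets once its predicate satisfies
  \<open>istopology\<close>; closure under intersection is the only substantial point.\<close>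

lemma openin_tau_l_topology:
  "openin (tau_l_topology M \<tau>) W \<longleftrightarrow> W \<subseteq> S\<^sub>\<tau> \<and>
     (\<forall>T\<in>W. \<exists>\<epsilon>>0. \<exists>\<delta>>0. \<exists>P\<in>projections M. \<tau> P < \<infinity> \<and> strong_sum T ` tau_l_nhd M \<tau> \<epsilon> \<delta> P \<subseteq> W)"
proof -
  define opn where "opn = (\<lambda>W. W \<subseteq> S\<^sub>\<tau> \<and>
     (\<forall>T\<in>W. \<exists>\<epsilon>>0. \<exists>\<delta>>0. \<exists>P\<in>projections M. \<tau> P < \<infinity> \<and> strong_sum T ` tau_l_nhd M \<tau> \<epsilon> \<delta> P \<subseteq> W))"
  have "istopology opn"
    unfolding istopology_def
  proof (intro conjI allI impI)
    fix V W assume VW: "opn V" "opn W"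
    show "opn (V \<inter> W)"
      unfolding opn_def
    proof (intro conjI ballI)
      show "V \<inter> W \<subseteq> S\<^sub>\<tau>" using VW by (auto simp: opn_def)
      fix T assume T: "T \<in> V \<inter> W"
      obtain \<epsilon>\<^sub>1 \<delta>\<^sub>1 P\<^sub>1 where 1: "0 < \<epsilon>\<^sub>1" "0 < \<delta>\<^sub>1" "P\<^sub>1 \<in> projections M" "\<tau> P\<^sub>1 < \<infinity>"
        "strong_sum T ` tau_l_nhd M \<tau> \<epsilon>\<^sub>1 \<delta>\<^sub>1 P\<^sub>1 \<subseteq> V"
        using VW(1) T unfolding opn_def by blast
      obtain \<epsilon>\<^sub>2 \<delta>\<^sub>2 P\<^sub>2 where 2: "0 < \<epsilon>\<^sub>2" "0 < \<delta>\<^sub>2" "P\<^sub>2 \<in> projections M" "\<tau> P\<^sub>2 < \<infinity>"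
        "strong_sum T ` tau_l_nhd M \<tau> \<epsilon>\<^sub>2 \<delta>\<^sub>2 P\<^sub>2 \<subseteq> W"
        using VW(2) T unfolding opn_def by blast
      obtain \<epsilon> \<delta> P where "0 < \<epsilon>" "0 < \<delta>" "P \<in> projections M" "\<tau> P < \<infinity>"
        "tau_l_nhd M \<tau> \<epsilon> \<delta> P \<subseteq> tau_l_nhd M \<tau> \<epsilon>\<^sub>1 \<delta>\<^sub>1 P\<^sub>1 \<inter> tau_l_nhd M \<tau> \<epsilon>\<^sub>2 \<delta>\<^sub>2 P\<^sub>2"
        using tau_l_nhd_inter[OF 1(3) 2(3) 1(4) 2(4) 1(1) 2(1) 1(2) 2(2)] by blast
      moreover from this(5) have "strong_sum T ` tau_l_nhd M \<tau> \<epsilon> \<delta> P \<subseteq> V \<inter> W" using 1(5) 2(5) by blast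
      ultimately show "\<exists>\<epsilon>>0. \<exists>\<delta>>0. \<exists>P\<in>projections M. \<tau> P < \<infinity> \<and>
          strong_sum T ` tau_l_nhd M \<tau> \<epsilon> \<delta> P \<subseteq> V \<inter> W" by blast
    qed
  next
    fix K assume K: "\<forall>W\<in>K. opn W"
    show "opn (\<Union>K)"
      unfolding opn_def
    proof (intro conjI ballI)
      show "\<Union>K \<subseteq> S\<^sub>\<tau>" using K unfolding opn_def by blast
      fix T assume "T \<in> \<Union>K"
      then obtain W where W: "W \<in> K" "T \<in> W" by blast
      have "opn W" using K W(1) by blast
      then obtain \<epsilon> \<delta> P where "0 < \<epsilon>" "0 < \<delta>" "P \<in> projections M" "\<tau> P < \<infinity>"
        "strong_sum T ` tau_l_nhd M \<tau> \<epsilon> \<delta> P \<subseteq> W"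
        using W(2) unfolding opn_def by blast
      moreover from this(5) have "strong_sum T ` tau_l_nhd M \<tau> \<epsilon> \<delta> P \<subseteq> \<Union>K"
        by (rule order_trans[OF _ Union_upper[OF W(1)]])
      ultimately show "\<exists>\<epsilon>>0. \<exists>\<delta>>0. \<exists>P\<in>projections M. \<tau> P < \<infinity> \<and>
          strong_sum T ` tau_l_nhd M \<tau> \<epsilon> \<delta> P \<subseteq> \<Union>K" by blast
    qed
  qed
  then show ?thesis unfolding tau_l_topology_def opn_def by simp
qed

text \<open>\<open>Q\<close> is \<open>P\<close> minus the spectral projection \<open>e\<close> of
  \<open>B\<close> above a level \<open>l\<close>. Chebyshev bounds the trace of \<open>e\<close>;
  on the range of \<open>Q\<close> the form of \<open>B\<close>, which there is the squared norm
  under \<open>E\<close>, is at most \<open>l\<close>.\<close>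

lemma scaled_proj_in_tau_l_nhd:
  assumes f: "\<And>n::nat. f n \<in> projections M" "\<And>n. bop_le (f n) (f (Suc n))"
    and P: "P \<in> projections M" "\<tau> P < \<infinity>" and pos: "0 < \<epsilon>" "0 < \<delta>"
  obtains n where "graph_of (sqrt (real (Suc n)) *\<^sub>R (f (Suc n) - f n)) \<in> tau_l_nhd M \<tau> \<epsilon> \<delta> P"
proof -
  \<comment> \<open>The constant is chosen so that the bound equals \<open>l * \<delta>\<close> for
    the level \<open>l\<close> below, whence \<open>\<tau> e \<le> \<delta>\<close>.\<close>
  obtain n where n: "\<tau> (P o\<^sub>L (f (Suc n) - f n) o\<^sub>L P) \<le> ennreal ((\<delta> * \<epsilon>\<^sup>2) / real (Suc n))"
    by (rule small_compression[of f P "\<delta> * \<epsilon>\<^sup>2", OF f P]) (use pos in auto)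
  define E where "E = f (Suc n) - f n"
  define c where "c = sqrt (real (Suc n))"
  have c: "0 < c" "c\<^sup>2 = real (Suc n)" by (simp_all add: c_def)
  have E: "E \<in> projections M" unfolding E_def by (rule proj_diff[OF f(1) f(1) f(2)])
  define B where "B = P o\<^sub>L E o\<^sub>L P"
  have B: "B \<in> positive_part M" unfolding B_def by (rule compression_positive[OF proj_positive[OF E] P(1)])
  \<comment> \<open>The level at which \<open>c\<^sup>2 * l = \<epsilon>\<^sup>2\<close>.\<close>
  define l where "l = \<epsilon>\<^sup>2 / real (Suc n)"
  have l: "0 < l" using pos by (simp add: l_def)
  obtain e where e: "e \<in> projections M" and te: "ennreal l * \<tau> e \<le> \<tau> B"
    and above: "\<And>x. e x = 0 \<Longrightarrow> B x \<bullet> x \<le> l * (x \<bullet> x)" and e0: "\<And>x. B x \<bullet> x = 0 \<Longrightarrow> e x = 0"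
    by (rule spectral_projection_above[OF B l]) blast
  have "bop_le e P"
    unfolding proj_le_iff(2)[OF e P(1)]
  proof
    fix x
    have "B (x - P x) = 0" by (simp add: B_def blinfun.diff_right proj_idem[OF P(1)])
    then have "e (x - P x) = 0" by (intro e0) simp
    then show "e (P x) = e x" by (simp add: blinfun.diff_right)
  qed
  then have eP: "e (P x) = e x" "P (e x) = e x" for x using proj_le_iff[OF e P(1)] by blast+
  define Q where "Q = P - e"
  have Q: "Q \<in> projections M" unfolding Q_def by (rule proj_diff[OF e P(1) \<open>bop_le e P\<close>])
  have PQ: "P (Q x) = Q x" and eQ: "e (Q x) = 0" for x
    by (simp_all add: Q_def blinfun.diff_left blinfun.diff_right proj_idem[OF P(1)] proj_idem[OF e] eP)
  have "bop_le Q P" unfolding proj_le_iff(1)[OF Q P(1)] using PQ by blast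
  moreover have "\<tau> (P - Q) \<le> ennreal \<delta>"
  proof -
    have "ennreal l * \<tau> e \<le> ennreal (l * \<delta>)"
      using te n by (simp add: B_def E_def l_def mult.commute order_trans)
    also have "\<dots> = ennreal l * ennreal \<delta>" using l pos by (simp add: ennreal_mult)
    finally have "\<tau> e \<le> ennreal \<delta>"
      using l by (simp add: ennreal_mult_le_mult_iff)
    then show ?thesis by (simp add: Q_def)
  qed
  moreover have "strong_prod (graph_of (c *\<^sub>R E)) (graph_of Q) = graph_of ((c *\<^sub>R E) o\<^sub>L Q)"
    by (auto simp: strong_prod_graph_of[OF closed_graph_of])
  moreover have cE: "c *\<^sub>R E \<in> M" by (intro scaleR_mem proj_mem E)
  moreover have "(c *\<^sub>R E) o\<^sub>L Q \<in> M" by (intro compose_mem cE proj_mem Q)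
  moreover have "norm ((c *\<^sub>R E) o\<^sub>L Q) \<le> \<epsilon>"
  proof (rule norm_blinfun_bound)
    fix x
    have "(norm (E (Q x)))\<^sup>2 = B (Q x) \<bullet> Q x"
    proof -
      have "(norm (E (Q x)))\<^sup>2 = E (Q x) \<bullet> Q x" by (simp add: proj_inner[OF E])
      also have "\<dots> = E (P (Q x)) \<bullet> P (Q x)" by (simp add: PQ)
      also have "\<dots> = B (Q x) \<bullet> Q x" using proj_selfadjoint[OF P(1)] by (simp add: B_def)
      finally show ?thesis .
    qed
    also have "\<dots> \<le> l * (Q x \<bullet> Q x)" by (rule above[OF eQ])
    also have "\<dots> \<le> l * (norm x)\<^sup>2"
      using l proj_norm_le[OF Q, of x] by (intro mult_left_mono) (simp_all add: flip: power2_norm_eq_inner)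
    finally have "c\<^sup>2 * (norm (E (Q x)))\<^sup>2 \<le> c\<^sup>2 * (l * (norm x)\<^sup>2)" by (intro mult_left_mono) simp_all
    also have "\<dots> = (\<epsilon> * norm x)\<^sup>2" by (simp add: c(2) l_def power_mult_distrib del: of_nat_Suc)
    finally have "(c * norm (E (Q x)))\<^sup>2 \<le> (\<epsilon> * norm x)\<^sup>2" by (simp add: power_mult_distrib)
    then have "c * norm (E (Q x)) \<le> \<epsilon> * norm x" by (rule power2_le_imp_le) (use pos in simp)
    then show "norm (((c *\<^sub>R E) o\<^sub>L Q) x) \<le> \<epsilon> * norm x" using c(1) by (simp add: blinfun.scaleR_left)
  qed (use pos in simp)
  ultimately have "graph_of (c *\<^sub>R E) \<in> tau_l_nhd M \<tau> \<epsilon> \<delta> P"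
    unfolding tau_l_nhd_def using Q graph_of_tau_measurable[OF cE] by blast
  then show ?thesis by (intro that[of n]) (simp add: c_def E_def)
qed

text \<open>The set \<open>W\<close> contains 0 because every \<open>E n\<close> is nonzero, and it
  contains no scaled projection because each lies above itself; yet every neighbourhood of 0 in the
  other topology contains one.\<close>

lemma finite_trace_if_topologies_eq:
  assumes eq: "subtopology (tau_l_topology M \<tau>) S\<^sub>h = o_topology M \<tau>"
  shows "\<tau> id_blinfun < \<infinity>"
proof (rule ccontr)
  assume "\<not> ?thesis"
  then have "\<tau> id_blinfun = \<infinity>" by (metis infinity_ennreal_def less_top)
  then obtain f where f: "\<And>n::nat. f n \<in> projections M" "\<And>n. bop_le (f n) (f (Suc n))"
    and big: "\<And>n. 1 \<le> \<tau> (f (Suc n) - f n)"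
    by (rule increasing_finite_projections) blast
  define E where "E = (\<lambda>n. f (Suc n) - f n)"
  define c where "c = (\<lambda>n. sqrt (real (Suc n)))"
  have E: "E n \<in> projections M" for n unfolding E_def by (rule proj_diff[OF f(1) f(1) f(2)])
  have tE: "1 \<le> \<tau> (E n)" for n using big by (simp add: E_def)
  \<comment> \<open>\<open>c n\<close> is nonnegative, so squaring preserves the inequality and
    bounds \<open>n + 1\<close> by \<open>C\<^sup>2\<close>.\<close>
  have fin: "finite {n. c n \<le> C}" for C
  proof (rule finite_subset)
    show "{n. c n \<le> C} \<subseteq> {..nat \<lceil>C\<^sup>2\<rceil>}"
    proof
      fix n assume "n \<in> {n. c n \<le> C}"
      then have "c n \<le> C" by simp
      then have "(c n)\<^sup>2 \<le> C\<^sup>2" by (intro power_mono) (simp_all add: c_def)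
      then have "real n \<le> C\<^sup>2" by (simp add: c_def)
      then show "n \<in> {..nat \<lceil>C\<^sup>2\<rceil>}" by (simp add: nat_le_iff le_nat_iff) linarith
    qed
  qed simp
  define W where "W = {T \<in> S\<^sub>h. \<forall>n. \<not> uop_le (graph_of (c n *\<^sub>R E n)) T}"
  have "openin (o_topology M \<tau>) W" unfolding W_def by (rule o_open_not_above[OF E tE fin])
  then obtain V where V: "openin (tau_l_topology M \<tau>) V" "W = V \<inter> S\<^sub>h"
    unfolding eq[symmetric] by (auto simp: openin_subtopology)
  have "graph_of 0 \<in> W"
  proof -
    have "graph_of 0 \<in> S\<^sub>h" by (rule graph_of_tau_measurable_sa[OF zero_mem]) simp
    moreover have "\<not> uop_le (graph_of (c n *\<^sub>R E n)) (graph_of 0)" for n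
    proof
      assume le: "uop_le (graph_of (c n *\<^sub>R E n)) (graph_of 0)"
      have "E n x = 0" for x
      proof -
        have "cinner (0 - (c n *\<^sub>R E n) x) x \<in> \<real>\<^sub>\<ge>\<^sub>0" by (rule uop_leD[OF le]) simp_all
        then have "c n * (norm (E n x))\<^sup>2 \<le> 0"
          by (simp add: cinner_nonneg_iff blinfun.scaleR_left proj_inner[OF E])
        moreover have "0 < c n" by (simp add: c_def)
        ultimately show ?thesis by (simp add: mult_le_0_iff)
      qed
      then have "E n = 0" by (intro blinfun_eqI) simp
      then show False using tE[of n] trace_0 by simp
    qed
    ultimately show ?thesis by (simp add: W_def)
  qed
  then have "graph_of 0 \<in> V" using V by blast
  then obtain \<epsilon> \<delta> P where P: "0 < \<epsilon>" "0 < \<delta>" "P \<in> projections M" "\<tau> P < \<infinity>"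
    "strong_sum (graph_of 0) ` tau_l_nhd M \<tau> \<epsilon> \<delta> P \<subseteq> V"
    using V(1) unfolding openin_tau_l_topology by blast
  obtain n where "graph_of (c n *\<^sub>R E n) \<in> tau_l_nhd M \<tau> \<epsilon> \<delta> P"
    using scaled_proj_in_tau_l_nhd[of f P \<epsilon> \<delta>, OF f P(3,4,1,2)] unfolding c_def E_def by blast
  then have "strong_sum (graph_of 0) (graph_of (c n *\<^sub>R E n)) \<in> V" using P(5) by blast
  then have "graph_of (c n *\<^sub>R E n) \<in> V" by (simp add: strong_sum_zero[OF closed_graph_of])
  moreover have "graph_of (c n *\<^sub>R E n) \<in> S\<^sub>h"
    using proj_selfadjoint[OF E]
    by (intro graph_of_tau_measurable_sa scaleR_mem proj_mem[OF E]) (simp add: blinfun.scaleR_left)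
  moreover have "uop_le (graph_of (c n *\<^sub>R E n)) (graph_of (c n *\<^sub>R E n))"
    by (rule uop_leI) (simp add: cinner_nonneg_iff)
  ultimately show False using V(2) by (auto simp: W_def)
qed

end

theorem theorem5:
  fixes M :: "'h::chilbert_space bop set" and \<tau> :: "'h bop \<Rightarrow> ennreal"
  assumes "von_neumann_algebra M" and "semifinite_algebra M"
    and "is_trace M \<tau>" and "faithful_trace M \<tau>" and "normal_trace M \<tau>" and "semifinite_trace M \<tau>"
    and "subtopology (tau_l_topology M \<tau>) (tau_measurable_sa M \<tau>) = o_topology M \<tau>"
  shows "\<tau> id_blinfun < \<infinity>"
proof -
  interpret traced_vna M \<tau> by unfold_locales (rule assms)+
  show ?thesis by (rule finite_trace_if_topologies_eq[OF assms(7)])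
qed

end
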